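(* Let $r\in\mathbb{N}$ and $\boldsymbol{l}=(l_1,\dots,l_r)\in\mathbb{N}_0^r$. Put $L_0:=0$ and $L_j:=l_1+\cdots+l_j$ ($1\le j\le r$), and for integers $k_1,\dots,k_r\ge 0$ put $K_0:=0$ and $K_j:=k_1+\cdots+k_j$ ($1\le j\le r$). Then $$\zeta_r^{\rm rev}(-l_1,\dots,-l_r)=\sum_{\substack{0\le k_i\le l_i\\ 1\le i\le r}}\ \left(\prod_{j=1}^r S(l_j,k_j,L_{j-1}+j)\,\frac{(K_j+j-1)!}{(K_{j-1}+j-1)!}\right)\zeta_{r+K_r}^{\rm rev}(\underbrace{0,\dots,0}_{r+K_r}).$$
   Context: $\mathbb{N}=\{1,2,\dots\}$, $\mathbb{N}_0=\mathbb{N}\cup\{0\}$. The Euler–Zagier multiple zeta function is $\zeta_r(s_1,\dots,s_r)=\sum_{0<n_1<\cdots<n_r} n_1^{-s_1}\cdots n_r^{-s_r}$. It converges absolutely when $\mathrm{Re}(s_{r-k+1}+\cdots+s_r)>k$ for $k=1,\dots,r$, and has a meromorphic continuation to $\mathbb{C}^r$, also denoted $\zeta_r$. Its reverse values at non-positive integers are the iterated limits of the continuation $$\zeta_r^{\rm rev}(-l_1,\dots,-l_r):=\lim_{s_r\to -l_r}\cdots\lim_{s_1\to -l_1}\zeta_r(s_1,\dots,s_r)$$ (the limit in $s_1$ is taken first, the one in $s_r$ last). Falling factorial: $(X)_0=1$, $(X)_m=X(X-1)\cdots(X-m+1)$. The Stirling polynomials of the second kind $S(n,m,Y)\in\mathbb{Z}[Y]$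 ($n,m\in\mathbb{N}_0$) are defined by $(X+Y)^n=\sum_{m=0}^n S(n,m,Y)(X)_m$ in $\mathbb{Z}[X,Y]$, with $S(n,m,Y)=0$ for $n<m$.
   Formalization: The Stirling polynomial is evaluated at K_{j-1}+j instead of the printed L_{j-1}+j; the printed formula is false: for r=2, l=(1,1) the left side is 1/240 but the printed right side is 101/240. *)

theory Defs
  imports "HOL-Analysis.Analysis" "HOL-Computational_Algebra.Polynomial"
begin

(* The depth r varies inside the theorem, so points of C^r are extensional functions on {1..r}
   and C^r carries the corresponding finite product topology. *)

definition Cpow :: "nat \<Rightarrow> (nat \<Rightarrow> complex) topology" where
  "Cpow r = product_topology (\<lambda>_. euclidean) {1..r}"

(* Holomorphy in several variables on an open set: continuous and holomorphic in each variable
   separately. *)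
definition holomorphic_several ::
    "nat \<Rightarrow> ((nat \<Rightarrow> complex) \<Rightarrow> complex) \<Rightarrow> (nat \<Rightarrow> complex) set \<Rightarrow> bool" where
  "holomorphic_several r f U \<longleftrightarrow>
     openin (Cpow r) U \<and>
     continuous_map (subtopology (Cpow r) U) euclidean f \<and>
     (\<forall>z\<in>U. \<forall>i\<in>{1..r}. (\<lambda>w. f (z(i := w))) field_differentiable at (z i))"

(* F, regarded as a function with domain D, is meromorphic on C^r: it is holomorphic on D, and
   every point of C^r has a neighbourhood V on which F is a quotient g/h of holomorphic functions,
   where h vanishes identically on no nonempty open part of V. In particular D is dense.
   Values of F outside D are irrelevant. *)
definition meromorphic_several ::
    "nat \<Rightarrow> (nat \<Rightarrow> complex) set \<Rightarrow> ((nat \<Rightarrow> complex) \<Rightarrow> complex) \<Rightarrow> bool" where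
  "meromorphic_several r D F \<longleftrightarrow>
     holomorphic_several r F D \<and>
     (\<forall>p\<in>topspace (Cpow r). \<exists>V g h.
        p \<in> V \<and> holomorphic_several r g V \<and> holomorphic_several r h V \<and>
        (\<forall>W. openin (Cpow r) W \<and> W \<subseteq> V \<and> W \<noteq> {} \<longrightarrow> (\<exists>z\<in>W. h z \<noteq> 0)) \<and>
        (\<forall>z\<in>V. h z \<noteq> 0 \<longrightarrow> z \<in> D \<and> F z = g z / h z))"

definition mzeta_series :: "nat \<Rightarrow> (nat \<Rightarrow> complex) \<Rightarrow> complex" where
  "mzeta_series r s =
     (\<Sum>\<^sub>\<infinity>n\<in>{n \<in> {1..r} \<rightarrow>\<^sub>E {1::nat..}. strict_mono_on {1..r} n}.
        \<Prod>i=1..r. of_nat (n i) powr (- s i))"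

definition mzeta_region :: "nat \<Rightarrow> (nat \<Rightarrow> complex) set" where
  "mzeta_region r =
     {s \<in> topspace (Cpow r). \<forall>k\<in>{1..r}. Re (\<Sum>i\<in>{r - k + 1..r}. s i) > real k}"

(* The meromorphic continuation of the series, evaluated at a point where it is holomorphic;
   unspecified at singular points. *)
definition mzeta :: "nat \<Rightarrow> (nat \<Rightarrow> complex) \<Rightarrow> complex" where
  "mzeta r z = (THE v. \<exists>D F.
     meromorphic_several r D F \<and>
     mzeta_region r \<subseteq> D \<and> (\<forall>s\<in>mzeta_region r. F s = mzeta_series r s) \<and>
     z \<in> D \<and> F z = v)"

(* iterated_Lim j a f s is the limit, for s_j to a_j, ..., of the limit, for s_1 to a_1, of f,
   with the coordinates of s beyond j held fixed. *)
fun iterated_Lim ::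
    "nat \<Rightarrow> (nat \<Rightarrow> complex) \<Rightarrow> ((nat \<Rightarrow> complex) \<Rightarrow> complex) \<Rightarrow> (nat \<Rightarrow> complex) \<Rightarrow> complex" where
  "iterated_Lim 0 a f s = f s"
| "iterated_Lim (Suc j) a f s =
     Lim (at (a (Suc j))) (\<lambda>w. iterated_Lim j a f (s(Suc j := w)))"

(* zeta_rev r l is the reverse value at (-l_1, ..., -l_r). All coordinates of the starting point
   in {1..r} are overwritten; undefined outside makes the evaluation points extensional. *)
definition zeta_rev :: "nat \<Rightarrow> (nat \<Rightarrow> nat) \<Rightarrow> complex" where
  "zeta_rev r l = iterated_Lim r (\<lambda>i. - of_nat (l i)) (mzeta r) (\<lambda>_. undefined)"

definition falling_factorial :: "'a::comm_ring_1 \<Rightarrow> nat \<Rightarrow> 'a" where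
  "falling_factorial x m = (\<Prod>i<m. x - of_nat i)"

(* The defining identity lives in Z[Y][X], i.e. in int poly poly, where X is [:0, 1:] and
   Y is [:[:0, 1:]:]. *)
definition stirling2_poly :: "nat \<Rightarrow> nat \<Rightarrow> int poly" where
  "stirling2_poly = (THE S.
     (\<forall>n. ([:0, 1:] + [:[:0, 1:]:]) ^ n
            = (\<Sum>m\<le>n. smult (S n m) (falling_factorial [:0, 1:] m))) \<and>
     (\<forall>n m. n < m \<longrightarrow> S n m = 0))"

(* K_j = k_1 + ... + k_j.

   In the theorem the Stirling polynomials are evaluated at Y = K_{j-1} + j. The source prints
   Y = L_{j-1} + j with L_j = l_1 + ... + l_j, which is a misprint: for r = 2 and l = (1, 1) the
   left-hand side is zeta(-3)/2 = 1/240, while the right-hand side is 1/240 for K and 101/240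
   for L. *)
definition psum :: "(nat \<Rightarrow> nat) \<Rightarrow> nat \<Rightarrow> nat" where
  "psum k j = (\<Sum>i=1..j. k i)"

end

theory Submission
  imports Defs "HOL-Complex_Analysis.Complex_Analysis"
begin

text \<open>When \<open>s\<^sub>1 = -l\<close>, the innermost sum \<open>\<Sum>\<^bsub>0 < n < N\<^esub> n\<^sup>l\<close> is a polynomial in \<open>N\<close>, so \<open>\<zeta>\<^sub>r(-l, s\<^sub>2, \<dots>)\<close> is a
  linear combination of values \<open>\<zeta>\<^bsub>r-1\<^esub>(s\<^sub>2 - m, s\<^sub>3, \<dots>)\<close>; this holds for the series and hence for the
  continuations. Iterating, the reverse value at \<open>(-l\<^sub>1, \<dots>, -l\<^sub>r)\<close> is the image of the polynomial
  \<open>R(N) = N\<^bsup>l\<^sub>r\<^esup> \<Sum>\<^bsub>0 < n\<^sub>1 < \<dots> < n\<^bsub>r-1\<^esub> < N\<^esub> n\<^sub>1\<^bsup>l\<^sub>1\<^esup> \<dots> n\<^bsub>r-1\<^esub>\<^bsup>l\<^bsub>r-1\<^esub>\<^esup>\<close> under the linear functional \<open>N\<^sup>m \<mapsto> \<zeta>(-m)\<close>. For \<open>l = 0\<close> the polynomial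
  is \<open>binomial(N - 1, r - 1)\<close>, and the Stirling polynomials expand a general \<open>R\<close> in these binomials.

  The continuation comes from expanding the telescoping series
  \<open>\<Sum>\<^bsub>n > N\<^esub> ((n - 1)\<^bsup>1 - s\<^esup> - n\<^bsup>1 - s\<^esup>) = N\<^bsup>1 - s\<^esup>\<close> binomially, which expresses \<open>(s\<^sub>r - 1) \<zeta>\<^sub>r(s)\<close> through \<open>\<zeta>\<^bsub>r-1\<^esub>\<close>,
  \<open>\<zeta>\<^sub>r\<close> with last argument raised, and a remainder series converging in a larger region.\<close>

section \<open>Holomorphic functions of several variables\<close>

text \<open>The constant \<open>mzeta\<close> is a definite description over all meromorphic
  continuations \<open>F\<close> with all admissible domains \<open>D\<close>. So one continuation
  with an explicit dense domain is built (\<open>mzeta_cont\<close> on \<open>mzeta_domain\<close>),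
  and an identity theorem shows that every competitor takes the same values there. The point (-l_1,
  ..., -l_r) may lie on singular hyperplanes, so the limits cannot be replaced by evaluation. After
  the limits in s_1, ..., s_j the remaining coordinates are kept generic: all tail sums s_i + ... +
  s_r with i > j are non-integral, a condition that survives integral shifts of the arguments.
  Genericity is lost only in the last limit, where depth one remains and zeta is regular at each -m.
  The argument K_(j-1) + j of the Stirling polynomials comes from writing n = (n - 1 - a) + (a + 1),
  where a = K_(j-1) + j - 1 is the lower index of the binomial coefficient reached after j - 1
  summations: n^l binomial(n - 1, a) becomes a combination of the binomial(n - 1, a + k) with
  factors (a + k)!/a!.\<close>

abbreviation Cspace :: "nat \<Rightarrow> (nat \<Rightarrow> complex) set" where
  "Cspace r \<equiv> PiE {1..r} (\<lambda>_. UNIV)"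

lemma topspace_Cpow [simp]: "topspace (Cpow r) = Cspace r"
  by (simp add: Cpow_def)

text \<open>Coordinates outside \<open>{1..r}\<close> are constantly \<open>undefined\<close> on
  \<open>Cspace r\<close>, so they contribute nothing to the topology. This gives access to
  \<open>continuous_on\<close> and the type class topology on functions.\<close>

lemma Cpow_eq_top_of_set: "Cpow r = top_of_set (Cspace r)"
proof -
  have 1: "continuous_map (Cpow r) (top_of_set (Cspace r)) (\<lambda>x. x)"
  proof (subst continuous_map_in_subtopology, intro conjI)
    show "continuous_map (Cpow r) euclidean (\<lambda>x. x)"
    proof (subst euclidean_product_topology[symmetric], subst continuous_map_componentwise_UNIV, rule allI)
      fix k show "continuous_map (Cpow r) euclidean (\<lambda>x. x k)"
      proof (cases "k \<in> {1..r}")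
        case True then show ?thesis unfolding Cpow_def
          by (rule continuous_map_product_projection)
      next
        case False
        have "continuous_map (Cpow r) euclidean (\<lambda>x. undefined :: complex)" by simp
        then show ?thesis
          by (rule continuous_map_eq) (use False in \<open>auto simp: PiE_def extensional_def\<close>)
      qed
    qed
  qed auto
  have 2: "continuous_map (top_of_set (Cspace r)) (Cpow r) (\<lambda>x. x)"
    unfolding Cpow_def
    by (subst continuous_map_componentwise)
       (auto simp: PiE_iff intro!: continuous_on_subset[OF continuous_on_product_coordinates])
  show ?thesis
  proof (rule topology_eq[THEN iffD2], rule allI)
    fix S
    show "openin (Cpow r) S = openin (top_of_set (Cspace r)) S"
    proof
      assume S: "openin (Cpow r) S"
      from openin_continuous_map_preimage[OF 2 S] openin_subset[OF S]
      show "openin (top_of_set (Cspace r)) S" by (auto simp: Int_def subset_eq elim!: back_subst[of "openin _"])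
    next
      assume S: "openin (top_of_set (Cspace r)) S"
      from openin_continuous_map_preimage[OF 1 S] openin_subset[OF S]
      show "openin (Cpow r) S" by (auto simp: Int_def subset_eq elim!: back_subst[of "openin _"])
    qed
  qed
qed

definition polydisc :: "nat \<Rightarrow> (nat \<Rightarrow> complex) \<Rightarrow> real \<Rightarrow> (nat \<Rightarrow> complex) set" where
  "polydisc r p e = PiE {1..r} (\<lambda>i. ball (p i) e)"

lemma openin_polydisc [simp]: "openin (Cpow r) (polydisc r p e)"
  unfolding polydisc_def Cpow_def by (rule openin_PiE_gen[THEN iffD2]) auto

lemma polydisc_subset: "polydisc r p e \<subseteq> Cspace r"
  by (auto simp: polydisc_def)

lemma centre_in_polydisc: "p \<in> Cspace r \<Longrightarrow> e > 0 \<Longrightarrow> p \<in> polydisc r p e"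
  by (auto simp: polydisc_def PiE_def Pi_def)

lemma polydisc_mono: "d \<le> e \<Longrightarrow> polydisc r p d \<subseteq> polydisc r p e"
  unfolding polydisc_def by (intro PiE_mono subset_ball)

lemma openin_Cpow_contains_polydisc:
  assumes "openin (Cpow r) U" "p \<in> U"
  obtains e where "e > 0" "polydisc r p e \<subseteq> U"
proof -
  obtain B where B: "\<forall>i\<in>{1..r}. open (B i)" "p \<in> PiE {1..r} B" "PiE {1..r} B \<subseteq> U"
    using bspec[OF openin_product_topology_alt[THEN iffD1, OF assms(1)[unfolded Cpow_def]] assms(2)]
    unfolding open_openin[symmetric] by metis
  have "\<forall>i\<in>{1..r}. \<exists>e>0. ball (p i) e \<subseteq> B i"
  proof
    fix i assume i: "i \<in> {1..r}"
    with B(1,2) have "open (B i)" "p i \<in> B i" by (auto simp: PiE_iff)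
    then show "\<exists>e>0. ball (p i) e \<subseteq> B i" using openE by blast
  qed
  then obtain e where e: "\<forall>i\<in>{1..r}. e i > 0 \<and> ball (p i) (e i) \<subseteq> B i" by metis
  define d where "d = Min (insert 1 (e ` {1..r}))"
  have "d > 0" using e unfolding d_def by (subst Min_gr_iff) auto
  moreover have "d \<le> e i" if "i \<in> {1..r}" for i using that unfolding d_def by (intro Min_le) auto
  then have "polydisc r p d \<subseteq> PiE {1..r} B"
    unfolding polydisc_def using e by (intro PiE_mono) (meson order_trans subset_ball)
  ultimately show thesis using that B(3) by blast
qed

lemma fun_upd_in_Cspace [simp]: "z \<in> Cspace r \<Longrightarrow> i \<in> {1..r} \<Longrightarrow> z(i := w) \<in> Cspace r"
  by (auto simp: PiE_def extensional_def)

section \<open>Separate holomorphy and its closure properties\<close>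

lemma continuous_on_coord [continuous_intros]:
  fixes S :: "('a \<Rightarrow> 'b::topological_space) set"
  shows "continuous_on S (\<lambda>z. z i)"
  by (rule continuous_on_subset[OF continuous_on_product_coordinates]) auto

lemma continuous_on_fun_upd_left [continuous_intros]:
  fixes g :: "'c::topological_space \<Rightarrow> 'b::topological_space"
  assumes "continuous_on S f" "continuous_on S g"
  shows "continuous_on S (\<lambda>x. (f x)(i := g x))"
proof (rule continuous_on_coordinatewise_then_product)
  show "continuous_on S (\<lambda>x. ((f x)(i := g x)) j)" for j
    using assms continuous_on_product_then_coordinatewise[OF assms(1), of j] by (cases "j = i") auto
qed

lemma holomorphic_several_iff:
  "holomorphic_several r f U \<longleftrightarrow> openin (Cpow r) U \<and> continuous_on U f \<and>
     (\<forall>z\<in>U. \<forall>i\<in>{1..r}. (\<lambda>w. f (z(i := w))) field_differentiable at (z i))"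
proof -
  have "subtopology (Cpow r) U = top_of_set U" if "openin (Cpow r) U"
    using openin_subset[OF that] unfolding Cpow_eq_top_of_set
    by (simp add: subtopology_subtopology Int_absorb1)
  then show ?thesis unfolding holomorphic_several_def by auto
qed

lemma holomorphic_severalD:
  assumes "holomorphic_several r f U"
  shows "openin (Cpow r) U" "continuous_on U f" "U \<subseteq> Cspace r"
    "z \<in> U \<Longrightarrow> i \<in> {1..r} \<Longrightarrow> (\<lambda>w. f (z(i := w))) field_differentiable at (z i)"
  using assms openin_subset[of "Cpow r" U] unfolding holomorphic_several_iff by auto

lemma open_slice:
  assumes "openin (Cpow r) U" "U \<subseteq> Cspace r" "z \<in> Cspace r" "i \<in> {1..r}"
  shows "open {w. z(i := w) \<in> U}"
proof -
  have "continuous_on UNIV (\<lambda>w. z(i := w))" by (intro continuous_intros)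
  moreover obtain W where "open W" "U = Cspace r \<inter> W"
    using assms(1) unfolding Cpow_eq_top_of_set openin_open by auto
  moreover have "{w. z(i := w) \<in> U} = (\<lambda>w. z(i := w)) -` W"
    using \<open>U = _\<close> assms by auto
  ultimately show ?thesis by (metis open_vimage)
qed

lemma holomorphic_several_slice:
  assumes "holomorphic_several r f U" "z \<in> Cspace r" "i \<in> {1..r}"
  shows "(\<lambda>w. f (z(i := w))) holomorphic_on {w. z(i := w) \<in> U}"
proof (rule holomorphic_onI, clarsimp)
  fix w assume "z(i := w) \<in> U"
  from holomorphic_severalD(4)[OF assms(1) this assms(3)]
  show "(\<lambda>w. f (z(i := w))) field_differentiable at w within {w. z(i := w) \<in> U}"
    by (simp add: field_differentiable_at_within)
qed

lemma continuous_on_local: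
  fixes f :: "'a::t2_space \<Rightarrow> 'b::topological_space"
  assumes "\<And>p. p \<in> U \<Longrightarrow> \<exists>V. openin (top_of_set U) V \<and> p \<in> V \<and> continuous_on V f"
  shows "continuous_on U f"
  unfolding continuous_on_eq_continuous_within
proof
  fix p assume "p \<in> U"
  then obtain V where V: "openin (top_of_set U) V" "p \<in> V" "continuous_on V f" using assms by blast
  then obtain W where W: "open W" "V = U \<inter> W" by (auto simp: openin_open)
  have "at p within U = at p within V" using V W by (intro at_within_nhd[of p W]) auto
  then show "continuous (at p within U) f" using V by (simp add: continuous_on_eq_continuous_within)
qed

lemma holomorphic_several_local:
  assumes "\<And>p. p \<in> U \<Longrightarrow> \<exists>V. V \<subseteq> U \<and> p \<in> V \<and> holomorphic_several r f V"
  shows "holomorphic_several r f U"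
proof -
  have o: "openin (Cpow r) U"
    by (subst openin_subopen) (metis assms holomorphic_severalD(1))
  have "\<exists>V. openin (top_of_set U) V \<and> p \<in> V \<and> continuous_on V f" if p: "p \<in> U" for p
  proof -
    obtain V where V: "V \<subseteq> U" "p \<in> V" "holomorphic_several r f V" using assms[OF p] by blast
    then have "openin (top_of_set U) V"
      using holomorphic_severalD(1)[OF V(3)] openin_subset[OF o]
      unfolding Cpow_eq_top_of_set by (auto intro: openin_subset_trans)
    then show ?thesis using V holomorphic_severalD(2) by blast
  qed
  then have "continuous_on U f" by (rule continuous_on_local)
  moreover have "(\<lambda>w. f (z(i := w))) field_differentiable at (z i)" if zi: "z \<in> U" "i \<in> {1..r}" for z i
    using assms[OF zi(1)] holomorphic_severalD(4) zi(2) by blast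
  ultimately show ?thesis unfolding holomorphic_several_iff using o by blast
qed

lemma holomorphic_several_subset:
  "holomorphic_several r f U \<Longrightarrow> openin (Cpow r) V \<Longrightarrow> V \<subseteq> U \<Longrightarrow> holomorphic_several r f V"
  unfolding holomorphic_several_iff by (auto intro: continuous_on_subset)

lemma holomorphic_several_cong:
  assumes "holomorphic_several r f U" "\<And>z. z \<in> U \<Longrightarrow> f z = g z"
  shows "holomorphic_several r g U"
proof -
  have "(\<lambda>w. g (z(i := w))) field_differentiable at (z i)" if "z \<in> U" "i \<in> {1..r}" for z i
  proof -
    note h = holomorphic_severalD[OF assms(1)]
    have "open {w. z(i := w) \<in> U}" using h that by (intro open_slice) auto
    moreover have "z i \<in> {w. z(i := w) \<in> U}" using that by simp
    ultimately show ?thesis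
      using h(4)[OF that] assms(2) unfolding field_differentiable_def mem_Collect_eq
      by (elim exE) (rule exI, erule has_field_derivative_transform_within_open, auto)
  qed
  moreover have "continuous_on U g"
    using holomorphic_severalD(2)[OF assms(1)] assms(2) by (rule continuous_on_eq)
  ultimately show ?thesis using holomorphic_severalD(1)[OF assms(1)] unfolding holomorphic_several_iff by blast
qed

lemma holomorphic_several_const:
  "openin (Cpow r) U \<Longrightarrow> holomorphic_several r (\<lambda>_. c) U"
  unfolding holomorphic_several_iff by auto

lemma holomorphic_several_coord:
  "openin (Cpow r) U \<Longrightarrow> holomorphic_several r (\<lambda>z. z i) U"
  unfolding holomorphic_several_iff
proof (intro conjI ballI)
  fix z j show "(\<lambda>w. (z(j := w)) i) field_differentiable at (z j)"
    by (cases "i = j") auto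
qed (auto intro: continuous_intros)

lemma holomorphic_several_add:
  "holomorphic_several r f U \<Longrightarrow> holomorphic_several r g U \<Longrightarrow> holomorphic_several r (\<lambda>z. f z + g z) U"
  unfolding holomorphic_several_iff by (auto intro!: continuous_intros field_differentiable_add)

lemma holomorphic_several_diff:
  "holomorphic_several r f U \<Longrightarrow> holomorphic_several r g U \<Longrightarrow> holomorphic_several r (\<lambda>z. f z - g z) U"
  unfolding holomorphic_several_iff by (auto intro!: continuous_intros field_differentiable_diff)

lemma holomorphic_several_mult:
  "holomorphic_several r f U \<Longrightarrow> holomorphic_several r g U \<Longrightarrow> holomorphic_several r (\<lambda>z. f z * g z) U"
  unfolding holomorphic_several_iff by (auto intro!: continuous_intros field_differentiable_mult)

lemma holomorphic_several_divide:
  assumes "holomorphic_several r f U" "holomorphic_several r g U" "\<And>z. z \<in> U \<Longrightarrow> g z \<noteq> 0"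
  shows "holomorphic_several r (\<lambda>z. f z / g z) U"
  using assms unfolding holomorphic_several_iff
  by (auto intro!: continuous_intros field_differentiable_divide)

lemma holomorphic_several_sum:
  assumes "openin (Cpow r) U" "\<And>x. x \<in> A \<Longrightarrow> holomorphic_several r (f x) U"
  shows "holomorphic_several r (\<lambda>z. \<Sum>x\<in>A. f x z) U"
  using assms(2) by (induction A rule: infinite_finite_induct)
    (auto intro: holomorphic_several_const holomorphic_several_add assms(1))

lemma holomorphic_several_prod:
  assumes "openin (Cpow r) U" "\<And>x. x \<in> A \<Longrightarrow> holomorphic_several r (f x) U"
  shows "holomorphic_several r (\<lambda>z. \<Prod>x\<in>A. f x z) U"
  using assms(2) by (induction A rule: infinite_finite_induct)
    (auto intro: holomorphic_several_const holomorphic_several_mult assms(1))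

lemma holomorphic_several_compose:
  assumes "holomorphic_several r f U" "h holomorphic_on UNIV"
  shows "holomorphic_several r (\<lambda>z. h (f z)) U"
proof -
  note a = holomorphic_severalD[OF assms(1)]
  have "continuous_on U (\<lambda>z. h (f z))"
    using continuous_on_compose2[OF holomorphic_on_imp_continuous_on[OF assms(2)] a(2)] by auto
  moreover have "(\<lambda>w. h (f (z(i := w)))) field_differentiable at (z i)" if "z \<in> U" "i \<in> {1..r}" for z i
    using field_differentiable_compose[OF a(4)[OF that], of h] assms(2)
    by (auto simp: o_def holomorphic_on_def)
  ultimately show ?thesis unfolding holomorphic_several_iff using a(1) by auto
qed

section \<open>Identity theorem and uniqueness of meromorphic functions\<close>

lemma openin_nonzero:
  assumes "holomorphic_several r f U"
  shows "openin (Cpow r) {z \<in> U. f z \<noteq> 0}"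
proof -
  have "openin (top_of_set U) (U \<inter> f -` (-{0}))"
    by (rule continuous_openin_preimage_gen[OF holomorphic_severalD(2)[OF assms]]) auto
  moreover have "U \<inter> f -` (-{0}) = {z \<in> U. f z \<noteq> 0}" by auto
  ultimately show ?thesis using openin_trans holomorphic_severalD(1)[OF assms] unfolding Cpow_eq_top_of_set by fastforce
qed

text \<open>Separate holomorphy makes the several-variable identity theorem on a polydisc a matter of
  enlarging the set of zeros one coordinate at a time.\<close>

lemma holomorphic_several_zero_polydisc:
  assumes f: "holomorphic_several r f (polydisc r p e)"
    and W: "openin (Cpow r) W" "W \<noteq> {}" "W \<subseteq> polydisc r p e" and z0: "\<And>z. z \<in> W \<Longrightarrow> f z = 0"
    and z: "z \<in> polydisc r p e"
  shows "f z = 0"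
proof -
  obtain q where q: "q \<in> W" using W by blast
  obtain d where d: "d > 0" "polydisc r q d \<subseteq> W" using openin_Cpow_contains_polydisc[OF W(1) q] .
  \<comment> \<open>In \<open>B k\<close> the first \<open>k\<close> coordinates already range over
    the full discs, the others still over small discs about \<open>q\<close>. Thus
    \<open>B 0\<close> lies in \<open>W\<close> and \<open>B r\<close> is the whole
    polydisc.\<close>
  define B where "B k = PiE {1..r} (\<lambda>i. if i \<le> k then ball (p i) e else ball (q i) d)" for k
  have qC: "q \<in> Cspace r" using q W polydisc_subset by blast
  have sub: "ball (q i) d \<subseteq> ball (p i) e" if "i \<in> {1..r}" for i
  proof
    fix w assume "w \<in> ball (q i) d"
    then have "q(i := w) \<in> polydisc r q d" using qC that d unfolding polydisc_def by (auto simp: PiE_def extensional_def Pi_def)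
    then have "q(i := w) \<in> polydisc r p e" using d W by blast
    then show "w \<in> ball (p i) e" using that by (auto simp: polydisc_def PiE_def Pi_def dest!: bspec[of _ _ i])
  qed
  have "\<forall>z\<in>B k. f z = 0" if "k \<le> r" for k using that
  proof (induction k)
    case 0
    have "B 0 = polydisc r q d" unfolding B_def polydisc_def by (rule PiE_cong) auto
    then show ?case using d z0 by blast
  next
    case (Suc k)
    show ?case
    proof
      fix z assume zB: "z \<in> B (Suc k)"
      let ?i = "Suc k"
      have i: "?i \<in> {1..r}" using Suc.prems by auto
      have zC: "z \<in> Cspace r" using zB by (auto simp: B_def)
      have inP: "z(?i := w) \<in> polydisc r p e" if "w \<in> ball (p ?i) e" for w
      proof -
        have "(z(?i := w)) j \<in> ball (p j) e" if j: "j \<in> {1..r}" for j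
          using zB sub[OF j] \<open>w \<in> _\<close> j
          by (cases "j = ?i") (fastforce simp: B_def PiE_def Pi_def split: if_splits dest!: bspec[of _ _ j])+
        then show ?thesis using zC i by (auto simp: polydisc_def PiE_def extensional_def)
      qed
      have inB: "z(?i := w) \<in> B k" if "w \<in> ball (q ?i) d" for w
      proof -
        have "(z(?i := w)) j \<in> (if j \<le> k then ball (p j) e else ball (q j) d)" if j: "j \<in> {1..r}" for j
          using zB \<open>w \<in> _\<close> j
          by (cases "j = ?i") (auto simp: B_def PiE_def Pi_def le_Suc_eq dest!: bspec[of _ _ j])
        then show ?thesis using zC i by (auto simp: B_def PiE_def extensional_def)
      qed
      have h: "(\<lambda>w. f (z(?i := w))) holomorphic_on ball (p ?i) e"
        using holomorphic_on_subset[OF holomorphic_several_slice[OF f zC i], of "ball (p ?i) e"] inP by blast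
      have "f (z(?i := z ?i)) = 0"
      proof (rule analytic_continuation_open[where s = "ball (q ?i) d" and s' = "ball (p ?i) e" and g = "\<lambda>_. 0" and f = "\<lambda>w. f (z(?i := w))"])
        show "f (z(?i := w)) = 0" if "w \<in> ball (q ?i) d" for w using inB[OF that] Suc by auto
        show "z ?i \<in> ball (p ?i) e" using zB i by (auto simp: B_def PiE_def Pi_def dest!: bspec[of _ _ ?i])
      qed (use h sub[OF i] d in \<open>auto\<close>)
      then show "f z = 0" by simp
    qed
  qed
  moreover have "B r = polydisc r p e" unfolding B_def polydisc_def by (rule PiE_cong) auto
  ultimately show ?thesis using z by blast
qed

text \<open>The points of \<open>W\<close> with \<open>h1\<close> nonzero form a nonempty open set,
  to which the density hypothesis on \<open>h2\<close> applies. It yields points where two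
  denominators can be divided by at once.\<close>

lemma dense_nonzero_times:
  assumes h1: "holomorphic_several r h1 V" "\<And>W. openin (Cpow r) W \<Longrightarrow> W \<subseteq> V \<Longrightarrow> W \<noteq> {} \<Longrightarrow> \<exists>z\<in>W. h1 z \<noteq> 0"
    and h2: "\<And>W. openin (Cpow r) W \<Longrightarrow> W \<subseteq> V \<Longrightarrow> W \<noteq> {} \<Longrightarrow> \<exists>z\<in>W. h2 z \<noteq> 0"
    and W: "openin (Cpow r) W" "W \<subseteq> V" "W \<noteq> {}"
  shows "\<exists>z\<in>W. h1 z \<noteq> 0 \<and> h2 z \<noteq> 0"
proof -
  define W' where "W' = {z \<in> W. h1 z \<noteq> 0}"
  have "openin (Cpow r) W'"
    unfolding W'_def by (rule openin_nonzero[OF holomorphic_several_subset[OF h1(1) W(1,2)]])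
  moreover have "W' \<noteq> {}" using h1(2)[OF W] by (auto simp: W'_def)
  ultimately show ?thesis using h2[of W'] W by (auto simp: W'_def)
qed

text \<open>The set of points near which \<open>F\<close> and \<open>F'\<close> agree is nonempty,
  open and closed in the connected space \<open>Cpow r\<close>.\<close>

lemma meromorphic_several_unique:
  assumes F: "meromorphic_several r D F" and F': "meromorphic_several r D' F'"
    and R: "openin (Cpow r) R" "R \<noteq> {}" "R \<subseteq> D" "R \<subseteq> D'" "\<And>z. z \<in> R \<Longrightarrow> F z = F' z"
    and z: "z \<in> D" "z \<in> D'"
  shows "F z = F' z"
proof -
  \<comment> \<open>Agreement is asked only on \<open>D\<close> and \<open>D'\<close> together,
    since the values elsewhere are arbitrary.\<close>
  define A where "A = \<Union>{W. openin (Cpow r) W \<and> (\<forall>z\<in>W \<inter> D \<inter> D'. F z = F' z)}"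
  have hol: "holomorphic_several r F D" "holomorphic_several r F' D'"
    using F F' by (auto simp: meromorphic_several_def)
  \<comment> \<open>Near an accumulation point of \<open>A\<close>, clearing denominators turns F =
    F' into the vanishing of the holomorphic function g h' - g' h on a polydisc, where the identity
    theorem for polydiscs applies.\<close>
  have step: "\<exists>e>0. \<forall>z\<in>polydisc r p e \<inter> D \<inter> D'. F z = F' z"
    if p: "p \<in> Cspace r" and acc: "\<And>e. e > 0 \<Longrightarrow> polydisc r p e \<inter> A \<noteq> {}" for p
  proof -
    from F p obtain V g h where V: "p \<in> V" "holomorphic_several r g V" "holomorphic_several r h V"
       "\<And>W. openin (Cpow r) W \<Longrightarrow> W \<subseteq> V \<Longrightarrow> W \<noteq> {} \<Longrightarrow> \<exists>z\<in>W. h z \<noteq> 0"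
       "\<And>z. z \<in> V \<Longrightarrow> h z \<noteq> 0 \<Longrightarrow> z \<in> D \<and> F z = g z / h z"
      unfolding meromorphic_several_def by (metis topspace_Cpow)
    from F' p obtain V' g' h' where V': "p \<in> V'" "holomorphic_several r g' V'" "holomorphic_several r h' V'"
       "\<And>W. openin (Cpow r) W \<Longrightarrow> W \<subseteq> V' \<Longrightarrow> W \<noteq> {} \<Longrightarrow> \<exists>z\<in>W. h' z \<noteq> 0"
       "\<And>z. z \<in> V' \<Longrightarrow> h' z \<noteq> 0 \<Longrightarrow> z \<in> D' \<and> F' z = g' z / h' z"
      unfolding meromorphic_several_def by (metis topspace_Cpow)
    have "openin (Cpow r) (V \<inter> V')"
      using holomorphic_severalD(1)[OF V(2)] holomorphic_severalD(1)[OF V'(2)] by (rule openin_Int)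
    then obtain e where e: "e > 0" "polydisc r p e \<subseteq> V \<inter> V'"
      using V(1) V'(1) by (auto elim: openin_Cpow_contains_polydisc)
    let ?P = "polydisc r p e"
    have on_P: "holomorphic_several r g ?P" "holomorphic_several r h ?P" "holomorphic_several r g' ?P" "holomorphic_several r h' ?P"
      using e(2) by (auto intro!: holomorphic_several_subset[OF V(2) openin_polydisc] holomorphic_several_subset[OF V(3) openin_polydisc]
          holomorphic_several_subset[OF V'(2) openin_polydisc] holomorphic_several_subset[OF V'(3) openin_polydisc])
    have dense: "\<exists>z\<in>W. h z \<noteq> 0 \<and> h' z \<noteq> 0" if "openin (Cpow r) W" "W \<subseteq> ?P" "W \<noteq> {}" for W
    proof (rule dense_nonzero_times[OF on_P(2) _ _ that])
      show "\<exists>z\<in>W. h z \<noteq> 0" if "openin (Cpow r) W" "W \<subseteq> ?P" "W \<noteq> {}" for W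
        using V(4)[of W] that e(2) by auto
      show "\<exists>z\<in>W. h' z \<noteq> 0" if "openin (Cpow r) W" "W \<subseteq> ?P" "W \<noteq> {}" for W
        using V'(4)[of W] that e(2) by auto
    qed
    define f where "f z = g z * h' z - g' z * h z" for z
    have f: "holomorphic_several r f ?P" unfolding f_def
      by (intro holomorphic_several_diff holomorphic_several_mult on_P)
    obtain W where W: "openin (Cpow r) W" "\<And>z. z \<in> W \<inter> D \<inter> D' \<Longrightarrow> F z = F' z" "W \<inter> ?P \<noteq> {}"
      using acc[OF e(1)] unfolding A_def by blast
    let ?W = "W \<inter> ?P"
    have oW: "openin (Cpow r) ?W" using W by auto
    \<comment> \<open>A nonzero value of \<open>f\<close> would persist on an open set; this set
      contains a point where neither denominator vanishes, and there F = F' forces f = 0.\<close>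
    have f0: "f z = 0" if "z \<in> ?W" for z
    proof (rule ccontr)
      assume nz: "f z \<noteq> 0"
      define X where "X = {z \<in> ?W. f z \<noteq> 0}"
      have "openin (Cpow r) X"
        unfolding X_def by (rule openin_nonzero[OF holomorphic_several_subset[OF f oW]]) simp
      moreover have "X \<noteq> {}" "X \<subseteq> ?P" using that nz by (auto simp: X_def)
      ultimately obtain y where y: "y \<in> X" "h y \<noteq> 0" "h' y \<noteq> 0" using dense by blast
      then have "y \<in> W" "y \<in> V" "y \<in> V'" "f y \<noteq> 0" using e by (auto simp: X_def)
      have "y \<in> D" "y \<in> D'" "F y = g y / h y" "F' y = g' y / h' y"
        using V(5) V'(5) y \<open>y \<in> V\<close> \<open>y \<in> V'\<close> by blast+
      moreover have "F y = F' y" using W(2)[of y] \<open>y \<in> W\<close> calculation by blast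
      moreover have "g y = (g y / h y) * h y" "g' y = (g' y / h' y) * h' y" using y by simp_all
      ultimately have "g y = F' y * h y" "g' y = F' y * h' y" by metis+
      with \<open>f y \<noteq> 0\<close> show False by (simp add: f_def)
    qed
    have zero: "f z = 0" if "z \<in> ?P" for z
      by (rule holomorphic_several_zero_polydisc[OF f oW]) (use W f0 that in auto)
    \<comment> \<open>At \<open>z\<close> itself a denominator may vanish, so the cross-multiplied
      identity cannot be divided there. But a disagreement at \<open>z\<close> would spread to an
      open set, hence to a point where both denominators are nonzero.\<close>
    have "F z = F' z" if z: "z \<in> ?P \<inter> D \<inter> D'" for z
    proof (rule ccontr)
      assume nz: "F z \<noteq> F' z"
      let ?U = "?P \<inter> D \<inter> D'"
      have oU: "openin (Cpow r) ?U"
        by (intro openin_Int openin_polydisc holomorphic_severalD(1)[OF hol(1)] holomorphic_severalD(1)[OF hol(2)])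
      define X where "X = {z \<in> ?U. F z - F' z \<noteq> 0}"
      have "holomorphic_several r (\<lambda>z. F z - F' z) ?U"
        by (intro holomorphic_several_diff holomorphic_several_subset[OF hol(1) oU] holomorphic_several_subset[OF hol(2) oU]) auto
      then have "openin (Cpow r) X" unfolding X_def by (rule openin_nonzero)
      moreover have "X \<noteq> {}" "X \<subseteq> ?P" using z nz by (auto simp: X_def)
      ultimately obtain y where y: "y \<in> X" "h y \<noteq> 0" "h' y \<noteq> 0" using dense by blast
      then have "y \<in> V" "y \<in> V'" "y \<in> ?P" "F y \<noteq> F' y" using e by (auto simp: X_def)
      moreover have "F y = g y / h y" "F' y = g' y / h' y" using V(5) V'(5) y calculation by blast+
      ultimately show False using zero[of y] y(2,3) by (simp add: f_def frac_eq_eq)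
    qed
    then show ?thesis using e by blast
  qed
  have oA: "openin (Cpow r) A" unfolding A_def by blast
  have AC: "A \<subseteq> Cspace r" using openin_subset[OF oA] by simp
  have "closedin (Cpow r) A"
    unfolding closedin_def
  proof (intro conjI)
    show "openin (Cpow r) (topspace (Cpow r) - A)"
    proof (subst openin_subopen, intro ballI)
      fix p assume p: "p \<in> topspace (Cpow r) - A"
      have "\<exists>e>0. polydisc r p e \<inter> A = {}"
      proof (rule ccontr)
        assume "\<not> ?thesis"
        then obtain e where "e > 0" "\<forall>z\<in>polydisc r p e \<inter> D \<inter> D'. F z = F' z" using step[of p] p by auto
        then have "polydisc r p e \<subseteq> A" unfolding A_def using openin_polydisc by blast
        moreover have "p \<in> polydisc r p e" using p \<open>e > 0\<close> unfolding topspace_Cpow by (blast intro: centre_in_polydisc)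
        ultimately show False using p by blast
      qed
      then obtain e where e: "e > 0" "polydisc r p e \<inter> A = {}" by blast
      have "p \<in> polydisc r p e" using p e(1) unfolding topspace_Cpow by (blast intro: centre_in_polydisc)
      moreover have "polydisc r p e \<subseteq> topspace (Cpow r) - A" using e polydisc_subset[of r p e] by auto
      ultimately show "\<exists>T. openin (Cpow r) T \<and> p \<in> T \<and> T \<subseteq> topspace (Cpow r) - A"
        by (intro exI[of _ "polydisc r p e"] conjI openin_polydisc)
    qed
  qed (use AC in simp)
  moreover have "R \<subseteq> A" using R(1,5) unfolding A_def by blast
  then have "A \<noteq> {}" using R(2) by blast
  moreover have "connected_space (Cpow r)"
    unfolding Cpow_def connected_space_product_topology
    using connected_UNIV[where 'a = complex] by (simp flip: connectedin_topspace)
  ultimately have "A = Cspace r" using oA unfolding connected_space_clopen_in topspace_Cpow by blast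
  then have "z \<in> A" using z(1) holomorphic_severalD(3)[OF hol(1)] by blast
  then obtain W where "openin (Cpow r) W" "z \<in> W" "\<forall>z\<in>W \<inter> D \<inter> D'. F z = F' z" unfolding A_def by blast
  then show ?thesis using z by blast
qed

text \<open>Local majorants give uniform convergence on polydiscs. Continuity then passes to the
  limit, and holomorphy in each variable is Weierstrass' theorem on one-dimensional slices.\<close>

lemma holomorphic_several_suminf:
  fixes f :: "nat \<Rightarrow> (nat \<Rightarrow> complex) \<Rightarrow> complex"
  assumes f: "\<And>n. holomorphic_several r (f n) U"
    and b: "\<And>p. p \<in> U \<Longrightarrow> \<exists>e b. e > 0 \<and> summable b \<and> polydisc r p e \<subseteq> U \<and> (\<forall>n. \<forall>z\<in>polydisc r p e. norm (f n z) \<le> b n)"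
  shows "holomorphic_several r (\<lambda>z. \<Sum>n. f n z) U"
proof (rule holomorphic_several_local)
  fix p assume p: "p \<in> U"
  then obtain e b where e: "e > 0" "summable b" "polydisc r p e \<subseteq> U"
    "\<And>n z. z \<in> polydisc r p e \<Longrightarrow> norm (f n z) \<le> b n" using b[OF p] by blast
  let ?P = "polydisc r p e"
  have pC: "p \<in> Cspace r" using holomorphic_severalD(3)[OF f] p by blast
  have fP: "holomorphic_several r (f n) ?P" for n by (rule holomorphic_several_subset[OF f openin_polydisc e(3)])
  have ul: "uniform_limit ?P (\<lambda>n z. \<Sum>i<n. f i z) (\<lambda>z. \<Sum>i. f i z) sequentially"
    by (rule Weierstrass_m_test[OF e(4) e(2)])
  have "\<forall>\<^sub>F n in sequentially. continuous_on ?P (\<lambda>z. \<Sum>i<n. f i z)"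
    by (intro always_eventually allI continuous_on_sum holomorphic_severalD(2)[OF fP])
  then have cont: "continuous_on ?P (\<lambda>z. \<Sum>i. f i z)"
    by (rule uniform_limit_theorem[OF _ ul]) simp
  have "(\<lambda>w. \<Sum>n. f n (z(i := w))) field_differentiable at (z i)" if zi: "z \<in> ?P" "i \<in> {1..r}" for z i
  proof -
    have zC: "z \<in> Cspace r" using zi(1) polydisc_subset by blast
    define S where "S = {w. z(i := w) \<in> ?P}"
    have oS: "open S" unfolding S_def by (rule open_slice[OF openin_polydisc polydisc_subset zC zi(2)])
    have "(\<lambda>w. \<Sum>n. f n (z(i := w))) holomorphic_on S"
    proof (rule holomorphic_uniform_sequence[OF oS])
      show "(\<lambda>w. \<Sum>k<n. f k (z(i := w))) holomorphic_on S" for n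
        unfolding S_def by (intro holomorphic_on_sum holomorphic_several_slice[OF fP zC zi(2)])
      fix x assume "x \<in> S"
      then obtain d where d: "d > 0" "cball x d \<subseteq> S" using oS open_contains_cball by blast
      have "uniform_limit (cball x d) (\<lambda>n w. \<Sum>k<n. f k (z(i := w))) (\<lambda>w. \<Sum>k. f k (z(i := w))) sequentially"
        by (rule Weierstrass_m_test[OF _ e(2)]) (use d e(4) in \<open>auto simp: S_def\<close>)
      with d show "\<exists>d>0. cball x d \<subseteq> S \<and> uniform_limit (cball x d) (\<lambda>n w. \<Sum>k<n. f k (z(i := w))) (\<lambda>w. \<Sum>k. f k (z(i := w))) sequentially"
        by blast
    qed
    moreover have "z i \<in> S" using zi by (simp add: S_def)
    ultimately show ?thesis using oS holomorphic_on_imp_differentiable_at by blast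
  qed
  then have "holomorphic_several r (\<lambda>z. \<Sum>n. f n z) ?P"
    unfolding holomorphic_several_iff using cont openin_polydisc by blast
  then show "\<exists>V\<subseteq>U. p \<in> V \<and> holomorphic_several r (\<lambda>z. \<Sum>n. f n z) V"
    using e centre_in_polydisc[OF pC e(1)] by blast
qed

text \<open>Moving one coordinate of the argument moves exactly one coordinate of the image, by the
  same amount. Separate differentiability is preserved under such maps by the one-variable chain
  rule alone.\<close>

definition translates_coords :: "nat \<Rightarrow> nat \<Rightarrow> ((nat \<Rightarrow> complex) \<Rightarrow> nat \<Rightarrow> complex) \<Rightarrow> bool" where
  "translates_coords r' r \<phi> \<longleftrightarrow> (\<forall>i\<in>{1..r'}. \<exists>i'\<in>{1..r}. \<forall>z w. \<phi> (z(i := w)) = (\<phi> z)(i' := \<phi> z i' + (w - z i)))"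

lemma holomorphic_several_translate:
  assumes f: "holomorphic_several r f V" and U: "openin (Cpow r') U" "\<And>z. z \<in> U \<Longrightarrow> \<phi> z \<in> V"
    and c: "continuous_on UNIV \<phi>" and tr: "translates_coords r' r \<phi>"
  shows "holomorphic_several r' (\<lambda>z. f (\<phi> z)) U"
  unfolding holomorphic_several_iff
proof (intro conjI ballI)
  show "continuous_on U (\<lambda>z. f (\<phi> z))"
    by (rule continuous_on_compose2[OF holomorphic_severalD(2)[OF f]]) (use c U in \<open>auto intro: continuous_on_subset\<close>)
  fix z i assume z: "z \<in> U" "i \<in> {1..r'}"
  obtain i' where i': "i' \<in> {1..r}" "\<And>w. \<phi> (z(i := w)) = (\<phi> z)(i' := \<phi> z i' + (w - z i))"
    using tr z(2) unfolding translates_coords_def by blast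
  have "(\<lambda>w. f ((\<phi> z)(i' := w))) field_differentiable at (\<phi> z i' + (z i - z i))"
    using holomorphic_severalD(4)[OF f U(2)[OF z(1)] i'(1)] by simp
  then have "(\<lambda>w. f ((\<phi> z)(i' := w))) \<circ> (\<lambda>w. \<phi> z i' + (w - z i)) field_differentiable at (z i)"
    by (intro field_differentiable_compose) (auto intro!: derivative_intros)
  then show "(\<lambda>w. f (\<phi> (z(i := w)))) field_differentiable at (z i)"
    unfolding i'(2) by (simp add: o_def)
qed (use U in auto)

text \<open>Prescribing the zero set of the denominator exactly, rather than only its density, keeps this class
  closed under sums and products without tracking denominators.\<close>

definition quotient_on ::
    "nat \<Rightarrow> (nat \<Rightarrow> complex) set \<Rightarrow> (nat \<Rightarrow> complex) set \<Rightarrow> ((nat \<Rightarrow> complex) \<Rightarrow> complex) \<Rightarrow> bool" where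
  "quotient_on r U D f \<longleftrightarrow> (\<exists>g h. holomorphic_several r g U \<and> holomorphic_several r h U \<and>
     (\<forall>z\<in>U. h z \<noteq> 0 \<longleftrightarrow> z \<in> D) \<and> (\<forall>z\<in>U \<inter> D. f z = g z / h z))"

lemma quotient_onI:
  assumes "holomorphic_several r g U" "holomorphic_several r h U"
     "\<And>z. z \<in> U \<Longrightarrow> h z \<noteq> 0 \<longleftrightarrow> z \<in> D" "\<And>z. z \<in> U \<Longrightarrow> z \<in> D \<Longrightarrow> f z = g z / h z"
  shows "quotient_on r U D f"
  using assms unfolding quotient_on_def by blast

lemma quotient_onE:
  assumes "quotient_on r U D f"
  obtains g h where "holomorphic_several r g U" "holomorphic_several r h U"
     "\<And>z. z \<in> U \<Longrightarrow> h z \<noteq> 0 \<longleftrightarrow> z \<in> D" "\<And>z. z \<in> U \<Longrightarrow> z \<in> D \<Longrightarrow> f z = g z / h z"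
  using assms unfolding quotient_on_def by blast

lemma quotient_on_cong:
  assumes "quotient_on r U D f" "\<And>z. z \<in> U \<Longrightarrow> z \<in> D \<Longrightarrow> f z = f' z"
  shows "quotient_on r U D f'"
  using assms unfolding quotient_on_def by (metis IntD1 IntD2)

text \<open>The function \<open>f0\<close> serves only as a witness that \<open>D'\<close> is, on
  \<open>U\<close>, the nonvanishing set of a holomorphic h'; expanding g/h by h' shrinks the domain
  to \<open>D'\<close>. In \<open>quotient_on_holomorphic\<close> it has the same purpose.\<close>

lemma quotient_on_weaken:
  assumes "quotient_on r U D f" "quotient_on r U D' f0" "U \<inter> D' \<subseteq> D"
  shows "quotient_on r U D' f"
proof -
  obtain g h where 1: "holomorphic_several r g U" "holomorphic_several r h U"
     "\<And>z. z \<in> U \<Longrightarrow> h z \<noteq> 0 \<longleftrightarrow> z \<in> D" "\<And>z. z \<in> U \<Longrightarrow> z \<in> D \<Longrightarrow> f z = g z / h z"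
    using assms(1) by (rule quotient_onE) (rule that)
  obtain h' where 2: "holomorphic_several r h' U" "\<And>z. z \<in> U \<Longrightarrow> h' z \<noteq> 0 \<longleftrightarrow> z \<in> D'"
    using assms(2) by (rule quotient_onE) (rule that)
  show ?thesis
  proof (rule quotient_onI)
    show "holomorphic_several r (\<lambda>z. g z * h' z) U" "holomorphic_several r (\<lambda>z. h z * h' z) U"
      by (intro holomorphic_several_mult 1 2)+
    show "h z * h' z \<noteq> 0 \<longleftrightarrow> z \<in> D'" if "z \<in> U" for z
      using 1(3)[OF that] 2(2)[OF that] that assms(3) unfolding mult_eq_0_iff by blast
    show "f z = g z * h' z / (h z * h' z)" if "z \<in> U" "z \<in> D'" for z
    proof -
      have "z \<in> D" using that assms(3) by blast
      then show ?thesis using 1(4) 2(2)[of z] that by simp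
    qed
  qed
qed

lemma quotient_on_holomorphic:
  assumes "quotient_on r U D f0" "holomorphic_several r f U"
  shows "quotient_on r U D f"
proof -
  obtain h where 1: "holomorphic_several r h U" "\<And>z. z \<in> U \<Longrightarrow> h z \<noteq> 0 \<longleftrightarrow> z \<in> D"
    using assms(1) by (rule quotient_onE) (rule that)
  show ?thesis
    by (rule quotient_onI[OF holomorphic_several_mult[OF assms(2) 1(1)] 1]) (simp_all flip: 1(2))
qed

lemma quotient_on_add:
  assumes "quotient_on r U D f1" "quotient_on r U D f2"
  shows "quotient_on r U D (\<lambda>z. f1 z + f2 z)"
proof -
  obtain g h where 1: "holomorphic_several r g U" "holomorphic_several r h U"
     "\<And>z. z \<in> U \<Longrightarrow> h z \<noteq> 0 \<longleftrightarrow> z \<in> D" "\<And>z. z \<in> U \<Longrightarrow> z \<in> D \<Longrightarrow> f1 z = g z / h z"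
    using assms(1) by (rule quotient_onE) (rule that)
  obtain g' h' where 2: "holomorphic_several r g' U" "holomorphic_several r h' U"
     "\<And>z. z \<in> U \<Longrightarrow> h' z \<noteq> 0 \<longleftrightarrow> z \<in> D" "\<And>z. z \<in> U \<Longrightarrow> z \<in> D \<Longrightarrow> f2 z = g' z / h' z"
    using assms(2) by (rule quotient_onE) (rule that)
  show ?thesis
  proof (rule quotient_onI)
    show "holomorphic_several r (\<lambda>z. g z * h' z + g' z * h z) U" "holomorphic_several r (\<lambda>z. h z * h' z) U"
      by (intro holomorphic_several_mult holomorphic_several_add 1 2)+
    show "h z * h' z \<noteq> 0 \<longleftrightarrow> z \<in> D" if "z \<in> U" for z
      using 1(3)[OF that] 2(3)[OF that] by simp
    show "f1 z + f2 z = (g z * h' z + g' z * h z) / (h z * h' z)" if "z \<in> U" "z \<in> D" for z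
      using 1(3,4)[of z] 2(3,4)[of z] that by (simp add: add_frac_eq)
  qed
qed

lemma quotient_on_mult:
  assumes "quotient_on r U D f1" "quotient_on r U D f2"
  shows "quotient_on r U D (\<lambda>z. f1 z * f2 z)"
proof -
  obtain g h where 1: "holomorphic_several r g U" "holomorphic_several r h U"
     "\<And>z. z \<in> U \<Longrightarrow> h z \<noteq> 0 \<longleftrightarrow> z \<in> D" "\<And>z. z \<in> U \<Longrightarrow> z \<in> D \<Longrightarrow> f1 z = g z / h z"
    using assms(1) by (rule quotient_onE) (rule that)
  obtain g' h' where 2: "holomorphic_several r g' U" "holomorphic_several r h' U"
     "\<And>z. z \<in> U \<Longrightarrow> h' z \<noteq> 0 \<longleftrightarrow> z \<in> D" "\<And>z. z \<in> U \<Longrightarrow> z \<in> D \<Longrightarrow> f2 z = g' z / h' z"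
    using assms(2) by (rule quotient_onE) (rule that)
  show ?thesis
  proof (rule quotient_onI)
    show "holomorphic_several r (\<lambda>z. g z * g' z) U" "holomorphic_several r (\<lambda>z. h z * h' z) U"
      by (intro holomorphic_several_mult 1 2)+
    show "h z * h' z \<noteq> 0 \<longleftrightarrow> z \<in> D" if "z \<in> U" for z
      using 1(3)[OF that] 2(3)[OF that] by simp
    show "f1 z * f2 z = (g z * g' z) / (h z * h' z)" if "z \<in> U" "z \<in> D" for z
      using 1(3,4)[of z] 2(3,4)[of z] that by simp
  qed
qed

lemma quotient_on_sum:
  assumes "quotient_on r U D f0" "\<And>x. x \<in> A \<Longrightarrow> quotient_on r U D (f x)"
  shows "quotient_on r U D (\<lambda>z. \<Sum>x\<in>A. f x z)"
proof -
  have o: "openin (Cpow r) U" using assms(1) by (rule quotient_onE) (rule holomorphic_severalD(1))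
  show ?thesis using assms(2)
    by (induction A rule: infinite_finite_induct)
       (auto intro: quotient_on_holomorphic[OF assms(1) holomorphic_several_const[OF o]] quotient_on_add)
qed

lemma quotient_on_translate:
  assumes f: "quotient_on r V D f" and U: "openin (Cpow r') U" "\<And>z. z \<in> U \<Longrightarrow> \<phi> z \<in> V"
    and c: "continuous_on UNIV \<phi>" and tr: "translates_coords r' r \<phi>"
  shows "quotient_on r' U (\<phi> -` D) (\<lambda>z. f (\<phi> z))"
proof -
  obtain g h where 1: "holomorphic_several r g V" "holomorphic_several r h V"
     "\<And>z. z \<in> V \<Longrightarrow> h z \<noteq> 0 \<longleftrightarrow> z \<in> D" "\<And>z. z \<in> V \<Longrightarrow> z \<in> D \<Longrightarrow> f z = g z / h z"
    using f by (rule quotient_onE) (rule that)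
  show ?thesis
    by (rule quotient_onI[OF holomorphic_several_translate[OF 1(1) U c tr] holomorphic_several_translate[OF 1(2) U c tr]])
       (use 1 U in auto)
qed

lemma quotient_on_imp_holomorphic:
  assumes "quotient_on r U D f"
  shows "holomorphic_several r f (U \<inter> D)"
proof -
  obtain g h where 1: "holomorphic_several r g U" "holomorphic_several r h U"
     "\<And>z. z \<in> U \<Longrightarrow> h z \<noteq> 0 \<longleftrightarrow> z \<in> D" "\<And>z. z \<in> U \<Longrightarrow> z \<in> D \<Longrightarrow> f z = g z / h z"
    using assms(1) by (rule quotient_onE) (rule that)
  have "{z \<in> U. h z \<noteq> 0} = U \<inter> D" using 1(3) by auto
  with openin_nonzero[OF 1(2)] have o: "openin (Cpow r) (U \<inter> D)" by simp
  have "holomorphic_several r (\<lambda>z. g z / h z) (U \<inter> D)"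
    by (rule holomorphic_several_divide) (use 1 o in \<open>auto intro: holomorphic_several_subset\<close>)
  then show ?thesis by (rule holomorphic_several_cong) (use 1(4) in auto)
qed

lemma meromorphic_severalI:
  assumes D: "D \<subseteq> Cspace r" and dense: "\<And>W. openin (Cpow r) W \<Longrightarrow> W \<noteq> {} \<Longrightarrow> W \<inter> D \<noteq> {}"
    and q: "\<And>p. p \<in> Cspace r \<Longrightarrow> \<exists>U. p \<in> U \<and> quotient_on r U D F"
  shows "meromorphic_several r D F"
  unfolding meromorphic_several_def
proof (intro conjI ballI)
  show "holomorphic_several r F D"
  proof (rule holomorphic_several_local)
    fix p assume "p \<in> D"
    then obtain U where "p \<in> U" "quotient_on r U D F" using q[OF subsetD[OF D]] by blast
    with \<open>p \<in> D\<close> show "\<exists>V\<subseteq>D. p \<in> V \<and> holomorphic_several r F V"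
      by (intro exI[of _ "U \<inter> D"]) (auto intro: quotient_on_imp_holomorphic)
  qed
  fix p assume "p \<in> topspace (Cpow r)"
  then obtain U where U: "p \<in> U" "quotient_on r U D F" using q by auto
  from U(2) obtain g h where 1: "holomorphic_several r g U" "holomorphic_several r h U"
     "\<And>z. z \<in> U \<Longrightarrow> h z \<noteq> 0 \<longleftrightarrow> z \<in> D" "\<And>z. z \<in> U \<Longrightarrow> z \<in> D \<Longrightarrow> F z = g z / h z"
    by (rule quotient_onE) (rule that)
  have "\<exists>z\<in>W. h z \<noteq> 0" if "openin (Cpow r) W" "W \<subseteq> U" "W \<noteq> {}" for W
    using dense[OF that(1,3)] 1(3) that(2) by blast
  then show "\<exists>V g h. p \<in> V \<and> holomorphic_several r g V \<and> holomorphic_several r h V \<and>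
        (\<forall>W. openin (Cpow r) W \<and> W \<subseteq> V \<and> W \<noteq> {} \<longrightarrow> (\<exists>z\<in>W. h z \<noteq> 0)) \<and>
        (\<forall>z\<in>V. h z \<noteq> 0 \<longrightarrow> z \<in> D \<and> F z = g z / h z)"
    using U(1) 1 by blast
qed

section \<open>Truncated multiple zeta sums\<close>

primrec truncated_mzeta :: "(nat \<Rightarrow> complex) \<Rightarrow> nat \<Rightarrow> nat \<Rightarrow> complex" where
  "truncated_mzeta s 0 n = 1"
| "truncated_mzeta s (Suc j) n = (\<Sum>m\<in>{1..<n}. of_nat m powr (- s (Suc j)) * truncated_mzeta s j m)"

primrec truncated_mzeta_real :: "(nat \<Rightarrow> real) \<Rightarrow> nat \<Rightarrow> nat \<Rightarrow> real" where
  "truncated_mzeta_real s 0 n = 1"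
| "truncated_mzeta_real s (Suc j) n = (\<Sum>m\<in>{1..<n}. of_nat m powr (- s (Suc j)) * truncated_mzeta_real s j m)"

lemma truncated_mzeta_cong:
  "(\<And>i. i \<in> {1..j} \<Longrightarrow> s i = s' i) \<Longrightarrow> truncated_mzeta s j n = truncated_mzeta s' j n"
  by (induction j arbitrary: n) (auto intro!: sum.cong)

lemma truncated_mzeta_real_cong:
  "(\<And>i. i \<in> {1..j} \<Longrightarrow> s i = s' i) \<Longrightarrow> truncated_mzeta_real s j n = truncated_mzeta_real s' j n"
  by (induction j arbitrary: n) (auto intro!: sum.cong)

lemma truncated_mzeta_real_nonneg: "truncated_mzeta_real s j n \<ge> 0"
  by (induction j arbitrary: n) (auto intro!: sum_nonneg)

lemma norm_of_nat_powr: "m \<ge> 1 \<Longrightarrow> norm (of_nat m powr (z :: complex)) = real m powr Re z"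
  by (simp add: norm_powr_real_powr)

lemma norm_truncated_mzeta_le:
  assumes "\<And>i. i \<in> {1..j} \<Longrightarrow> Re (s i) \<ge> \<sigma> i"
  shows "norm (truncated_mzeta s j n) \<le> truncated_mzeta_real \<sigma> j n"
  using assms
proof (induction j arbitrary: n)
  case (Suc j)
  have "norm (of_nat m powr - s (Suc j) * truncated_mzeta s j m)
      \<le> real m powr - \<sigma> (Suc j) * truncated_mzeta_real \<sigma> j m" if "m \<in> {1..<n}" for m
    unfolding norm_mult
  proof (rule mult_mono)
    show "norm (of_nat m powr - s (Suc j)) \<le> real m powr - \<sigma> (Suc j)"
      using that Suc.prems[of "Suc j"] by (subst norm_of_nat_powr) (auto intro!: powr_mono)
    show "norm (truncated_mzeta s j m) \<le> truncated_mzeta_real \<sigma> j m"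
      using Suc by auto
  qed auto
  then show ?case by (auto intro!: order_trans[OF norm_sum] sum_mono)
qed auto

text \<open>The region of absolute convergence in terms of real parts, indexed by the first index of
  a tail instead of its length.\<close>

definition real_region :: "nat \<Rightarrow> (nat \<Rightarrow> real) \<Rightarrow> bool" where
  "real_region r \<sigma> \<longleftrightarrow> (\<forall>j\<in>{1..r}. (\<Sum>i\<in>{j..r}. \<sigma> i) > real (r - j + 1))"

lemma summable_Suc_powr: "d > 0 \<Longrightarrow> summable (\<lambda>n. real (Suc n) powr (- 1 - d))"
  using summable_real_powr_iff[of "-1-d"] summable_Suc_iff[of "\<lambda>n. real n powr (-1-d)"] by simp

text \<open>The induction works because \<open>\<sigma>\<^sub>r - 1 - \<delta>\<close> can be added to the last exponent of the
  truncated sum without leaving the region of convergence of depth one less.\<close>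

lemma truncated_mzeta_real_bound:
  assumes "real_region (Suc r) \<sigma>"
  shows "\<exists>\<delta> C. \<delta> > 0 \<and> C \<ge> 0 \<and> (\<forall>n\<ge>1. truncated_mzeta_real \<sigma> r n \<le> C * real n powr (\<sigma> (Suc r) - 1 - \<delta>))"
  using assms
proof (induction r arbitrary: \<sigma>)
  case 0
  have s: "\<sigma> 1 > 1" using 0 by (auto simp: real_region_def)
  \<comment> \<open>With this choice of the saving, the exponent of \<open>n\<close> is 0.\<close>
  then have "\<forall>n\<ge>1. truncated_mzeta_real \<sigma> 0 n \<le> 1 * real n powr (\<sigma> (Suc 0) - 1 - (\<sigma> 1 - 1))" by simp
  with s show ?case by (intro exI[of _ "\<sigma> 1 - 1"] exI[of _ 1]) auto
next
  case (Suc r)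
  \<comment> \<open>Half of the smallest excess over the convergence bounds, so every tail still has
    excess greater than \<open>\<delta>\<close>. For the last coordinate alone this says that the
    growth exponent \<open>E\<close> is positive, which permits m^E to be replaced by n^E for m <
    n.\<close>
  define \<delta> where "\<delta> = Min ((\<lambda>j. ((\<Sum>i\<in>{j..Suc (Suc r)}. \<sigma> i) - real (Suc (Suc r) - j + 1))) ` {1..Suc (Suc r)}) / 2"
  define E where "E = \<sigma> (Suc (Suc r)) - 1 - \<delta>"
  have d0: "\<delta> > 0" using Suc.prems unfolding \<delta>_def real_region_def
    by (simp add: Min_gr_iff)
  have d: "(\<Sum>i\<in>{j..Suc (Suc r)}. \<sigma> i) - real (Suc (Suc r) - j + 1) > \<delta>" if "j \<in> {1..Suc (Suc r)}" for j
  proof -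
    have "2 * \<delta> \<le> (\<Sum>i\<in>{j..Suc (Suc r)}. \<sigma> i) - real (Suc (Suc r) - j + 1)"
      unfolding \<delta>_def using that by (simp add: Min_le)
    then show ?thesis using d0 by linarith
  qed
  have E0: "E > 0" using d[of "Suc (Suc r)"] by (simp add: E_def)
  define \<tau> where "\<tau> = \<sigma>(Suc r := \<sigma> (Suc r) + E)"
  have "real_region (Suc r) \<tau>" unfolding real_region_def
  proof
    fix j assume j: "j \<in> {1..Suc r}"
    have "(\<Sum>i\<in>{j..Suc r}. \<tau> i) = (\<Sum>i\<in>{j..Suc r}. \<sigma> i) + E"
      using j by (simp add: \<tau>_def)
    moreover have "(\<Sum>i\<in>{j..Suc (Suc r)}. \<sigma> i) = (\<Sum>i\<in>{j..Suc r}. \<sigma> i) + \<sigma> (Suc (Suc r))" using j by simp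
    ultimately show "real (Suc r - j + 1) < (\<Sum>i\<in>{j..Suc r}. \<tau> i)"
      using d[of j] j by (simp add: E_def Suc_diff_le)
  qed
  from Suc.IH[OF this] obtain \<epsilon> C where eC: "\<epsilon> > 0" "C \<ge> 0"
    "\<And>n. n \<ge> 1 \<Longrightarrow> truncated_mzeta_real \<tau> r n \<le> C * real n powr (\<tau> (Suc r) - 1 - \<epsilon>)" by blast
  have tr: "truncated_mzeta_real \<tau> r n = truncated_mzeta_real \<sigma> r n" for n
    by (rule truncated_mzeta_real_cong) (auto simp: \<tau>_def)
  define K where "K = (\<Sum>m. C * real (Suc m) powr (- 1 - \<epsilon>))"
  have K: "(\<Sum>m\<in>{1..<n}. C * real m powr (-1-\<epsilon>)) \<le> K" for n
  proof -
    have "(\<Sum>m\<in>{1..<n}. C * real m powr (-1-\<epsilon>)) = (\<Sum>m\<in>{..<n-1}. C * real (Suc m) powr (-1-\<epsilon>))"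
      by (rule sum.reindex_bij_witness[of _ Suc "\<lambda>m. m - 1"]) auto
    also have "\<dots> \<le> K" unfolding K_def
      using eC by (intro sum_le_suminf summable_mult summable_Suc_powr) auto
    finally show ?thesis .
  qed
  have "truncated_mzeta_real \<sigma> (Suc r) n \<le> K * real n powr E" if n: "n \<ge> 1" for n
  proof -
    have "truncated_mzeta_real \<sigma> (Suc r) n \<le> (\<Sum>m\<in>{1..<n}. real n powr E * (C * real m powr (-1-\<epsilon>)))"
      unfolding truncated_mzeta_real.simps
    proof (rule sum_mono)
      fix m assume m: "m \<in> {1..<n}"
      have "real m powr - \<sigma> (Suc r) * truncated_mzeta_real \<sigma> r m \<le> real m powr - \<sigma> (Suc r) * (C * real m powr (\<tau> (Suc r) - 1 - \<epsilon>))"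
        using eC(3)[of m] m unfolding tr by (intro mult_left_mono) auto
      also have "\<dots> = real m powr E * (C * real m powr (-1-\<epsilon>))"
        using m by (simp add: \<tau>_def mult_ac algebra_simps flip: powr_add)
      also have "\<dots> \<le> real n powr E * (C * real m powr (-1-\<epsilon>))"
        using m E0 eC by (intro mult_right_mono powr_mono2) auto
      finally show "real m powr - \<sigma> (Suc r) * truncated_mzeta_real \<sigma> r m \<le> real n powr E * (C * real m powr (-1-\<epsilon>))" .
    qed
    also have "\<dots> = real n powr E * (\<Sum>m\<in>{1..<n}. C * real m powr (-1-\<epsilon>))" by (simp add: sum_distrib_left)
    also have "\<dots> \<le> real n powr E * K" using K by (intro mult_left_mono) auto
    finally show ?thesis by (simp add: mult.commute)
  qed
  moreover have "K \<ge> 0" using K[of 0] by simp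
  ultimately show ?case using d0 unfolding E_def by blast
qed

lemma truncated_mzeta_real_summable:
  assumes "real_region (Suc r) \<sigma>"
  shows "summable (\<lambda>n. real (Suc n) powr (- \<sigma> (Suc r)) * truncated_mzeta_real \<sigma> r (Suc n))"
proof -
  obtain \<delta> C where dC: "\<delta> > 0" "C \<ge> 0" "\<And>n. n \<ge> 1 \<Longrightarrow> truncated_mzeta_real \<sigma> r n \<le> C * real n powr (\<sigma> (Suc r) - 1 - \<delta>)"
    using truncated_mzeta_real_bound[OF assms] by blast
  show ?thesis
  proof (rule summable_comparison_test'[of "\<lambda>n. C * real (Suc n) powr (-1-\<delta>)" 0])
    show "summable (\<lambda>n. C * real (Suc n) powr (-1-\<delta>))" using dC by (intro summable_mult summable_Suc_powr)
    fix n
    have "real (Suc n) powr (- \<sigma> (Suc r)) * truncated_mzeta_real \<sigma> r (Suc n)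
       \<le> real (Suc n) powr (- \<sigma> (Suc r)) * (C * real (Suc n) powr (\<sigma> (Suc r) - 1 - \<delta>))"
      using dC(3)[of "Suc n"] by (intro mult_left_mono) auto
    also have "\<dots> = C * real (Suc n) powr (-1-\<delta>)"
      by (simp add: mult_ac flip: powr_add)
    finally show "norm (real (Suc n) powr (- \<sigma> (Suc r)) * truncated_mzeta_real \<sigma> r (Suc n)) \<le> C * real (Suc n) powr (-1-\<delta>)"
      using truncated_mzeta_real_nonneg[of \<sigma> r "Suc n"] by simp
  qed
qed

section \<open>Remainder of the binomial expansion\<close>

text \<open>The error of the binomial expansion of \<open>n\<^bsup>1 - s\<^esup> = (n + 1)\<^bsup>1 - s\<^esup> (1 - 1/(n + 1))\<^bsup>1 - s\<^esup>\<close>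
  to order \<open>M\<close>. At \<open>n = 0\<close> the first term is \<open>0\<close>, as \<open>0 powr z = 0\<close>.\<close>

definition powr_remainder :: "nat \<Rightarrow> complex \<Rightarrow> nat \<Rightarrow> complex" where
  "powr_remainder M s n = of_nat n powr (1 - s) -
     (\<Sum>k\<le>M. pochhammer (s - 1) k / fact k * of_nat (Suc n) powr (1 - s - of_nat k))"

lemma norm_pochhammer_le:
  fixes a :: complex
  shows "norm a \<le> b \<Longrightarrow> norm (pochhammer a k) \<le> pochhammer b k"
  unfolding pochhammer_prod prod_norm[symmetric]
  by (intro prod_mono) (auto intro: order_trans[OF norm_triangle_ineq])

lemma summable_pochhammer_half:
  fixes b :: real
  shows "summable (\<lambda>k. pochhammer b k / fact k * (1 / 2) ^ k)"
proof -
  have "(\<lambda>k. ((-b) gchoose k) * (-1/2) ^ k) sums (1 + (-1/2)) powr (-b)"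
    by (rule gen_binomial_real) auto
  moreover have "((-b) gchoose k) * (-1/2) ^ k = pochhammer b k / fact k * (1/2)^k" for k
  proof -
    have "(-1) ^ k * (-1/2 :: real) ^ k = (1/2) ^ k" by (subst power_mult_distrib[symmetric]) simp
    then show ?thesis by (simp add: gbinomial_pochhammer mult_ac)
  qed
  ultimately show ?thesis by (auto simp: sums_iff)
qed

text \<open>With x = 1/(n + 1) the remainder is (n + 1)^(1 - s) times the tail of a binomial series
  starting at x^(M + 1). The constant is uniform for bounded \<open>s\<close>, as needed for
  majorants on polydiscs.\<close>

lemma powr_remainder_bound:
  assumes "A \<ge> 0"
  shows "\<exists>C\<ge>0. \<forall>s n. norm s \<le> A \<longrightarrow> norm (powr_remainder M s n) \<le> C * real (Suc n) powr (- Re s - real M)"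
proof -
  \<comment> \<open>\<open>b\<close> bounds the norm of s - 1, \<open>H\<close> is the majorant
    series at 1/2 and controls the tail when x is at most 1/2, and \<open>C0\<close> takes care of n
    = 0, where x = 1.\<close>
  define b where "b = A + 1"
  define H where "H = (\<Sum>k. pochhammer b k / fact k * (1 / 2 :: real) ^ k)"
  define C0 where "C0 = (\<Sum>k\<le>M. pochhammer b k / fact k)"
  define C where "C = C0 + 2 ^ Suc M * H"
  have bpos: "pochhammer b k \<ge> 0" for k using assms unfolding b_def
    by (intro less_imp_le pochhammer_pos) auto
  have H0: "H \<ge> 0" unfolding H_def using bpos
    by (intro suminf_nonneg summable_pochhammer_half) auto
  have C00: "C0 \<ge> 0" unfolding C0_def using bpos by (intro sum_nonneg) auto
  have pb: "norm (pochhammer (s - 1) k) \<le> pochhammer b k" if "norm s \<le> A" for s :: complex and k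
  proof (rule norm_pochhammer_le)
    show "norm (s - 1) \<le> b" using norm_triangle_ineq4[of s 1] that by (auto simp: b_def)
  qed
  have "norm (powr_remainder M s n) \<le> C * real (Suc n) powr (- Re s - real M)" if s: "norm s \<le> A" for s n
  proof (cases "n = 0")
    case True
    have "norm (powr_remainder M s n) = norm (\<Sum>k\<le>M. pochhammer (s - 1) k / fact k)"
      using True by (simp add: powr_remainder_def)
    also have "\<dots> \<le> C0" unfolding C0_def
      by (rule order_trans[OF norm_sum]) (auto intro!: sum_mono divide_right_mono pb[OF s] simp: norm_divide)
    also have "\<dots> \<le> C" using H0 by (simp add: C_def)
    finally show ?thesis using True by simp
  next
    case False
    define x where "x = 1 / real (Suc n)"
    have x: "0 < x" "2 * x \<le> 1" "x < 1" using False by (auto simp: x_def field_simps)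
    let ?N = "of_nat (Suc n) :: complex"
    have "1 - x = real n / real (Suc n)" by (simp add: x_def field_simps)
    then have nx: "of_nat n = ?N * of_real (1 - x)" by (simp del: of_nat_Suc)
    define t where "t k = pochhammer (s - 1) k / fact k * of_real x ^ k" for k
    have "(\<lambda>k. ((1 - s) gchoose k) * (- of_real x) ^ k) sums (1 + (- of_real x)) powr (1 - s)"
      by (rule gen_binomial_complex) (use x in auto)
    moreover have "((1 - s) gchoose k) * (- of_real x) ^ k = t k" for k
    proof -
      have "(-1) ^ k * (- of_real x :: complex) ^ k = of_real x ^ k" by (subst power_mult_distrib[symmetric]) simp
      then show ?thesis by (simp add: gbinomial_pochhammer t_def mult_ac)
    qed
    ultimately have "t sums of_real (1 - x) powr (1 - s)" by simp
    then have tail: "(\<lambda>k. t (k + Suc M)) sums (of_real (1 - x) powr (1 - s) - (\<Sum>k<Suc M. t k))"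
      by (rule sums_split_initial_segment)
    have tn: "norm (t m) \<le> pochhammer b m / fact m * x ^ m" for m
    proof -
      have "norm (t m) = norm (pochhammer (s - 1) m) / fact m * x ^ m"
        using x by (simp add: t_def norm_mult norm_divide norm_power)
      then show ?thesis using x pb[OF s, of m] by (auto intro!: mult_right_mono divide_right_mono)
    qed
    \<comment> \<open>Write x^i = (2x)^i (1/2)^i and bound only (2x)^k by 1: the factor (2x)^(M + 1)
      carries the decay and the powers of 1/2 the convergence.\<close>
    have tb: "norm (t (k + Suc M)) \<le> (2 * x) ^ Suc M * (pochhammer b (k + Suc M) / fact (k + Suc M) * (1/2) ^ (k + Suc M))" for k
    proof -
      have "norm (t (k + Suc M)) \<le> pochhammer b (k + Suc M) / fact (k + Suc M) * x ^ (k + Suc M)"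
        by (rule tn)
      also have "x ^ (k + Suc M) = (2 * x) ^ k * (2 * x) ^ Suc M * (1/2) ^ (k + Suc M)"
        by (simp add: power_mult_distrib power_add power_one_over)
      also have "pochhammer b (k + Suc M) / fact (k + Suc M) * \<dots> \<le>
         pochhammer b (k + Suc M) / fact (k + Suc M) * (1 * (2 * x) ^ Suc M * (1/2) ^ (k + Suc M))"
        using x bpos by (intro mult_left_mono mult_right_mono power_le_one) auto
      finally show ?thesis by (simp add: mult_ac)
    qed
    have sm: "summable (\<lambda>k. pochhammer b (k + Suc M) / fact (k + Suc M) * (1/2 :: real) ^ (k + Suc M))"
      by (subst summable_iff_shift) (rule summable_pochhammer_half)
    have "norm (of_real (1 - x) powr (1 - s) - (\<Sum>k<Suc M. t k)) = norm (\<Sum>k. t (k + Suc M))"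
      using tail by (simp add: sums_iff)
    also have "\<dots> \<le> (\<Sum>k. (2 * x) ^ Suc M * (pochhammer b (k + Suc M) / fact (k + Suc M) * (1/2) ^ (k + Suc M)))"
      by (rule norm_suminf_le[OF tb]) (intro summable_mult sm)
    also have "\<dots> = (2 * x) ^ Suc M * (\<Sum>k. pochhammer b (k + Suc M) / fact (k + Suc M) * (1/2) ^ (k + Suc M))"
      by (rule suminf_mult[OF sm])
    also have "\<dots> \<le> (2 * x) ^ Suc M * H"
    proof (rule mult_left_mono)
      have "H = (\<Sum>k. pochhammer b (k + Suc M) / fact (k + Suc M) * (1/2) ^ (k + Suc M)) + (\<Sum>k<Suc M. pochhammer b k / fact k * (1/2) ^ k)"
        unfolding H_def by (rule suminf_split_initial_segment[OF summable_pochhammer_half])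
      moreover have "(\<Sum>k<Suc M. pochhammer b k / fact k * (1/2 :: real) ^ k) \<ge> 0" using bpos by (intro sum_nonneg) auto
      ultimately show "(\<Sum>k. pochhammer b (k + Suc M) / fact (k + Suc M) * (1/2) ^ (k + Suc M)) \<le> H" by linarith
    qed (use x in auto)
    also have "\<dots> = 2 ^ Suc M * H * real (Suc n) powr (- real (Suc M))"
      by (simp add: x_def power_mult_distrib powr_minus powr_realpow divide_simps del: of_nat_Suc power_Suc)
    finally have est: "norm (of_real (1 - x) powr (1 - s) - (\<Sum>k<Suc M. t k)) \<le> 2 ^ Suc M * H * real (Suc n) powr (- real (Suc M))" .
    have "powr_remainder M s n = ?N powr (1 - s) * (of_real (1 - x) powr (1 - s) - (\<Sum>k<Suc M. t k))"
    proof -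
      have "of_nat n powr (1 - s) = ?N powr (1 - s) * of_real (1 - x) powr (1 - s)"
        unfolding nx using x by (intro powr_times_real) auto
      moreover have "pochhammer (s - 1) k / fact k * ?N powr (1 - s - of_nat k) = ?N powr (1 - s) * t k" for k
      proof -
        have "?N powr (1 - s - of_nat k) = ?N powr (1 - s) * of_real x ^ k"
          by (simp add: powr_diff powr_nat x_def power_one_over divide_simps of_real_divide del: of_nat_Suc)
        then show ?thesis by (simp add: t_def)
      qed
      ultimately show ?thesis
        by (simp only: powr_remainder_def right_diff_distrib sum_distrib_left lessThan_Suc_atMost)
    qed
    then have "norm (powr_remainder M s n) = real (Suc n) powr (1 - Re s) * norm (of_real (1 - x) powr (1 - s) - (\<Sum>k<Suc M. t k))"
      by (simp add: norm_mult norm_of_nat_powr del: of_nat_Suc)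
    also have "\<dots> \<le> real (Suc n) powr (1 - Re s) * (2 ^ Suc M * H * real (Suc n) powr (- real (Suc M)))"
      by (rule mult_left_mono[OF est]) auto
    also have "\<dots> = 2 ^ Suc M * H * real (Suc n) powr (- Re s - real M)"
      by (simp add: mult_ac algebra_simps flip: powr_add)
    also have "\<dots> \<le> C * real (Suc n) powr (- Re s - real M)"
      using C00 by (intro mult_right_mono) (auto simp: C_def)
    finally show ?thesis .
  qed
  then show ?thesis using C00 H0 by (intro exI[of _ C]) (auto simp: C_def)
qed

section \<open>Meromorphic continuation\<close>

text \<open>The points that enter the region of convergence once the last argument is raised by
  \<open>M\<close>, since the last argument occurs in every tail. These regions increase with
  \<open>M\<close> and exhaust the space.\<close>

definition shifted_region :: "nat \<Rightarrow> nat \<Rightarrow> (nat \<Rightarrow> complex) set" where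
  "shifted_region r M = {s \<in> Cspace r. \<forall>j\<in>{1..r}. Re (\<Sum>i\<in>{j..r}. s i) + real M > real (r - j + 1)}"

lemma mzeta_region_eq: "mzeta_region r = shifted_region r 0"
proof -
  have "(\<forall>k\<in>{1..r}. Re (\<Sum>i\<in>{r - k + 1..r}. s i) > real k) \<longleftrightarrow>
        (\<forall>j\<in>{1..r}. Re (\<Sum>i\<in>{j..r}. s i) > real (r - j + 1))" for s :: "nat \<Rightarrow> complex"
  proof (intro iffI ballI)
    fix j assume "\<forall>k\<in>{1..r}. Re (\<Sum>i\<in>{r - k + 1..r}. s i) > real k" "j \<in> {1..r}"
    moreover from this(2) have "r - j + 1 \<in> {1..r}" "r - (r - j + 1) + 1 = j" by auto
    ultimately show "Re (\<Sum>i\<in>{j..r}. s i) > real (r - j + 1)" by metis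
  next
    fix k assume "\<forall>j\<in>{1..r}. Re (\<Sum>i\<in>{j..r}. s i) > real (r - j + 1)" "k \<in> {1..r}"
    moreover from this(2) have "r - k + 1 \<in> {1..r}" "r - (r - k + 1) + 1 = k" by auto
    ultimately show "Re (\<Sum>i\<in>{r - k + 1..r}. s i) > real k" by metis
  qed
  then show ?thesis by (simp add: mzeta_region_def shifted_region_def)
qed

lemma shifted_region_subset: "shifted_region r M \<subseteq> Cspace r"
  by (auto simp: shifted_region_def)

lemma shifted_region_mono: "M \<le> N \<Longrightarrow> shifted_region r M \<subseteq> shifted_region r N"
  by (force simp: shifted_region_def)

lemma openin_shifted_region: "openin (Cpow r) (shifted_region r M)"
proof -
  have o: "openin (top_of_set (Cspace r)) (Cspace r \<inter> (\<lambda>s. Re (\<Sum>i\<in>{j..r}. s i) + real M) -` {real (r - j + 1)<..})" for j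
    by (rule continuous_openin_preimage_gen) (auto intro!: continuous_intros continuous_on_coord)
  have "openin (Cpow r) ((\<Inter>j\<in>{1..r}. Cspace r \<inter> (\<lambda>s. Re (\<Sum>i\<in>{j..r}. s i) + real M) -` {real (r - j + 1)<..}) \<inter> topspace (Cpow r))"
    unfolding Cpow_eq_top_of_set by (rule openin_INT[OF finite_atLeastAtMost o])
  moreover have "(\<Inter>j\<in>{1..r}. Cspace r \<inter> (\<lambda>s. Re (\<Sum>i\<in>{j..r}. s i) + real M) -` {real (r - j + 1)<..}) \<inter> topspace (Cpow r) = shifted_region r M"
    unfolding shifted_region_def topspace_Cpow by blast
  ultimately show ?thesis by simp
qed

lemma in_shifted_region_ex:
  assumes "s \<in> Cspace r"
  shows "\<exists>M. s \<in> shifted_region r M"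
proof -
  define B where "B = (\<Sum>j\<in>{1..r}. \<bar>real (r - j + 1) - Re (\<Sum>i\<in>{j..r}. s i)\<bar>)"
  obtain M :: nat where M: "real M > B" using reals_Archimedean2 by blast
  have "Re (\<Sum>i\<in>{j..r}. s i) + real M > real (r - j + 1)" if j: "j \<in> {1..r}" for j
  proof -
    have "\<bar>real (r - j + 1) - Re (\<Sum>i\<in>{j..r}. s i)\<bar> \<le> B"
      unfolding B_def by (rule member_le_sum) (use j in auto)
    then show ?thesis using M by linarith
  qed
  then show ?thesis using assms unfolding shifted_region_def by blast
qed

text \<open>Finitely many strict inequalities survive lowering every real part by a small
  \<open>e\<close>; this margin makes the resulting majorant valid on a whole polydisc.\<close>

lemma shifted_region_real_region:
  assumes "p \<in> shifted_region (Suc r) M"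
  shows "\<exists>e>0. real_region (Suc r) (\<lambda>i. Re (p i) - e + (if i = Suc r then real M else 0))"
proof -
  have "\<forall>\<^sub>F e in at_right 0. \<forall>j\<in>{1..Suc r}. (\<Sum>i\<in>{j..Suc r}. Re (p i) - e + (if i = Suc r then real M else 0)) > real (Suc r - j + 1)"
  proof (rule eventually_ball_finite; safe?)
    fix j assume j: "j \<in> {1..Suc r}"
    have lim: "((\<lambda>e. \<Sum>i\<in>{j..Suc r}. Re (p i) - e + (if i = Suc r then real M else 0)) \<longlongrightarrow>
        (\<Sum>i\<in>{j..Suc r}. Re (p i) - 0 + (if i = Suc r then real M else 0))) (at_right 0)"
      by (intro tendsto_intros)
    have "(\<Sum>i\<in>{j..Suc r}. Re (p i) - 0 + (if i = Suc r then real M else 0)) = Re (\<Sum>i\<in>{j..Suc r}. p i) + real M"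
      using j by (simp add: sum.distrib)
    also have "\<dots> > real (Suc r - j + 1)" using assms j unfolding shifted_region_def by blast
    finally show "\<forall>\<^sub>F e in at_right 0. real (Suc r - j + 1) < (\<Sum>i\<in>{j..Suc r}. Re (p i) - e + (if i = Suc r then real M else 0))"
      by (rule order_tendstoD(1)[OF lim])
  qed
  moreover have "\<forall>\<^sub>F e in at_right (0::real). e > 0" by (rule eventually_at_right_less)
  ultimately have "\<forall>\<^sub>F e in at_right 0. e > 0 \<and> real_region (Suc r) (\<lambda>i. Re (p i) - e + (if i = Suc r then real M else 0))"
    unfolding real_region_def by eventually_elim auto
  then show ?thesis using eventually_happens'[OF trivial_limit_at_right_real[of "0::real"]] by blast
qed

text \<open>The summands decrease in the real parts, so the real series at the lowered exponents
  dominates on the polydisc. The case M = 0 serves the series itself, general \<open>M\<close> the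
  remainder series.\<close>

lemma truncated_mzeta_majorant:
  assumes p: "p \<in> shifted_region (Suc r) M"
  shows "\<exists>e b. e > 0 \<and> summable b \<and> polydisc (Suc r) p e \<subseteq> shifted_region (Suc r) M \<and>
    (\<forall>n. \<forall>z\<in>polydisc (Suc r) p e. real (Suc n) powr (- Re (z (Suc r)) - real M) * norm (truncated_mzeta z r (Suc n)) \<le> b n)"
proof -
  obtain e1 where e1: "e1 > 0" "real_region (Suc r) (\<lambda>i. Re (p i) - e1 + (if i = Suc r then real M else 0))" (is "real_region _ ?\<sigma>")
    using shifted_region_real_region[OF p] by blast
  obtain e2 where e2: "e2 > 0" "polydisc (Suc r) p e2 \<subseteq> shifted_region (Suc r) M"
    using openin_Cpow_contains_polydisc[OF openin_shifted_region p] by blast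
  define e where "e = min e1 e2"
  define b where "b n = real (Suc n) powr (- ?\<sigma> (Suc r)) * truncated_mzeta_real ?\<sigma> r (Suc n)" for n
  have "real (Suc n) powr (- Re (z (Suc r)) - real M) * norm (truncated_mzeta z r (Suc n)) \<le> b n"
    if z: "z \<in> polydisc (Suc r) p e" for z n
  proof -
    have close: "Re (z i) \<ge> Re (p i) - e1" if i: "i \<in> {1..Suc r}" for i
    proof -
      have "dist (p i) (z i) < e" using z i by (auto simp: polydisc_def PiE_iff)
      then have "norm (p i - z i) < e1" by (simp add: dist_norm e_def)
      then show ?thesis using abs_Re_le_cmod[of "p i - z i"] by simp
    qed
    show ?thesis unfolding b_def
    proof (intro mult_mono norm_truncated_mzeta_le powr_mono)
      show "- Re (z (Suc r)) - real M \<le> - ?\<sigma> (Suc r)" using close[of "Suc r"] by simp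
      show "?\<sigma> i \<le> Re (z i)" if "i \<in> {1..r}" for i using close[of i] that by auto
    qed auto
  qed
  moreover have "summable b" unfolding b_def by (rule truncated_mzeta_real_summable[OF e1(2)])
  moreover have "polydisc (Suc r) p e \<subseteq> shifted_region (Suc r) M"
    using e2(2) polydisc_mono[of e e2 "Suc r" p] by (auto simp: e_def)
  moreover have "e > 0" using e1 e2 by (simp add: e_def)
  ultimately show ?thesis by blast
qed

text \<open>The multiple series grouped by its largest summation index, which is
  \<open>Suc n\<close> here; \<open>mzeta_series_eq_sum\<close> relates it to the unordered
  sum.\<close>

definition mzeta_sum :: "nat \<Rightarrow> (nat \<Rightarrow> complex) \<Rightarrow> complex" where
  "mzeta_sum r s = (\<Sum>n. of_nat (Suc n) powr (- s r) * truncated_mzeta s (r - 1) (Suc n))"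

definition mzeta_remainder :: "nat \<Rightarrow> nat \<Rightarrow> (nat \<Rightarrow> complex) \<Rightarrow> complex" where
  "mzeta_remainder r M s = (\<Sum>n. powr_remainder M (s (Suc r)) n * truncated_mzeta s r (Suc n))"

lemma holomorphic_truncated_mzeta:
  "openin (Cpow N) U \<Longrightarrow> holomorphic_several N (\<lambda>z. truncated_mzeta z j n) U"
proof (induction j arbitrary: n)
  case (Suc j)
  have "holomorphic_several N (\<lambda>z. of_nat m powr (- z (Suc j))) U" for m
    by (rule holomorphic_several_compose[OF holomorphic_several_coord[OF Suc.prems], where h = "\<lambda>w. of_nat m powr (- w)"])
       (intro holomorphic_intros)
  then show ?case
    unfolding truncated_mzeta.simps by (intro holomorphic_several_sum holomorphic_several_mult Suc)
qed (simp add: holomorphic_several_const)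

lemma mzeta_sum_abs_summable:
  assumes "s \<in> shifted_region (Suc r) 0"
  shows "summable (\<lambda>n. norm (of_nat (Suc n) powr (- s (Suc r)) * truncated_mzeta s r (Suc n)))"
proof -
  obtain e b where eb: "e > 0" "summable b"
    "\<And>n z. z \<in> polydisc (Suc r) s e \<Longrightarrow> real (Suc n) powr (- Re (z (Suc r)) - real 0) * norm (truncated_mzeta z r (Suc n)) \<le> b n"
    using truncated_mzeta_majorant[OF assms] by blast
  have s: "s \<in> polydisc (Suc r) s e"
    by (rule centre_in_polydisc) (use assms shifted_region_subset eb(1) in auto)
  show ?thesis
    by (rule summable_comparison_test'[OF eb(2), of 0])
       (use eb(3)[OF s] in \<open>simp add: norm_mult norm_of_nat_powr del: of_nat_Suc\<close>)
qed

lemma holomorphic_mzeta_sum: "holomorphic_several (Suc r) (mzeta_sum (Suc r)) (shifted_region (Suc r) 0)"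
proof -
  have "holomorphic_several (Suc r) (\<lambda>s. \<Sum>n. of_nat (Suc n) powr (- s (Suc r)) * truncated_mzeta s r (Suc n)) (shifted_region (Suc r) 0)"
  proof (rule holomorphic_several_suminf)
    fix n
    have "holomorphic_several (Suc r) (\<lambda>s. of_nat (Suc n) powr (- s (Suc r))) (shifted_region (Suc r) 0)"
      by (rule holomorphic_several_compose[OF holomorphic_several_coord[OF openin_shifted_region], where h = "\<lambda>w. of_nat (Suc n) powr (- w)"])
         (intro holomorphic_intros)
    then show "holomorphic_several (Suc r) (\<lambda>s. of_nat (Suc n) powr (- s (Suc r)) * truncated_mzeta s r (Suc n)) (shifted_region (Suc r) 0)"
      by (intro holomorphic_several_mult holomorphic_truncated_mzeta openin_shifted_region)
  next
    fix p assume "p \<in> shifted_region (Suc r) 0"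
    from truncated_mzeta_majorant[OF this] obtain e b where eb: "e > 0" "summable b" "polydisc (Suc r) p e \<subseteq> shifted_region (Suc r) 0"
      "\<And>n z. z \<in> polydisc (Suc r) p e \<Longrightarrow> real (Suc n) powr (- Re (z (Suc r)) - real 0) * norm (truncated_mzeta z r (Suc n)) \<le> b n"
      by blast
    have "norm (of_nat (Suc n) powr (- z (Suc r)) * truncated_mzeta z r (Suc n)) \<le> b n" if "z \<in> polydisc (Suc r) p e" for z n
      using eb(4)[OF that, of n] by (simp add: norm_mult norm_of_nat_powr del: of_nat_Suc)
    with eb show "\<exists>e b. 0 < e \<and> summable b \<and> polydisc (Suc r) p e \<subseteq> shifted_region (Suc r) 0 \<and>
       (\<forall>n. \<forall>z\<in>polydisc (Suc r) p e. norm (of_nat (Suc n) powr (- z (Suc r)) * truncated_mzeta z r (Suc n)) \<le> b n)"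
      by blast
  qed
  then show ?thesis unfolding mzeta_sum_def by simp
qed

lemma mzeta_remainder_majorant:
  assumes "p \<in> shifted_region (Suc r) M"
  shows "\<exists>e b. e > 0 \<and> summable b \<and> polydisc (Suc r) p e \<subseteq> shifted_region (Suc r) M \<and>
    (\<forall>n. \<forall>z\<in>polydisc (Suc r) p e. norm (powr_remainder M (z (Suc r)) n * truncated_mzeta z r (Suc n)) \<le> b n)"
proof -
  obtain e b where eb: "e > 0" "summable b" "polydisc (Suc r) p e \<subseteq> shifted_region (Suc r) M"
    "\<And>n z. z \<in> polydisc (Suc r) p e \<Longrightarrow> real (Suc n) powr (- Re (z (Suc r)) - real M) * norm (truncated_mzeta z r (Suc n)) \<le> b n"
    using truncated_mzeta_majorant[OF assms] by blast
  define A where "A = norm (p (Suc r)) + e"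
  have "A \<ge> 0" using eb(1) by (simp add: A_def)
  then obtain C where C: "C \<ge> 0" "\<And>s n. norm s \<le> A \<Longrightarrow> norm (powr_remainder M s n) \<le> C * real (Suc n) powr (- Re s - real M)"
    using powr_remainder_bound by blast
  have "norm (powr_remainder M (z (Suc r)) n * truncated_mzeta z r (Suc n)) \<le> C * b n" if z: "z \<in> polydisc (Suc r) p e" for z n
  proof -
    have "dist (p (Suc r)) (z (Suc r)) < e" using z by (auto simp: polydisc_def PiE_iff)
    then have "norm (z (Suc r)) \<le> A" unfolding A_def dist_norm
      using norm_triangle_sub[of "z (Suc r)" "p (Suc r)"] by (simp add: norm_minus_commute)
    from C(2)[OF this, of n] have "norm (powr_remainder M (z (Suc r)) n * truncated_mzeta z r (Suc n)) \<le>
      C * real (Suc n) powr (- Re (z (Suc r)) - real M) * norm (truncated_mzeta z r (Suc n))"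
      unfolding norm_mult by (intro mult_right_mono) auto
    also have "\<dots> \<le> C * b n" using eb(4)[OF z, of n] C(1) by (simp only: mult.assoc mult_left_mono)
    finally show ?thesis .
  qed
  moreover have "summable (\<lambda>n. C * b n)" using eb(2) by (rule summable_mult)
  ultimately show ?thesis using eb(1,3) by blast
qed

lemma mzeta_remainder_summable:
  assumes "s \<in> shifted_region (Suc r) M"
  shows "summable (\<lambda>n. powr_remainder M (s (Suc r)) n * truncated_mzeta s r (Suc n))"
proof -
  obtain e b where eb: "e > 0" "summable b"
    "\<And>n z. z \<in> polydisc (Suc r) s e \<Longrightarrow> norm (powr_remainder M (z (Suc r)) n * truncated_mzeta z r (Suc n)) \<le> b n"
    using mzeta_remainder_majorant[OF assms] by blast
  have s: "s \<in> polydisc (Suc r) s e"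
    by (rule centre_in_polydisc) (use assms shifted_region_subset eb(1) in auto)
  show ?thesis
    by (rule summable_comparison_test'[OF eb(2), of 0]) (use eb(3)[OF s] in simp)
qed

lemma holomorphic_powr_remainder: "(\<lambda>w. powr_remainder M w n) holomorphic_on UNIV"
  unfolding powr_remainder_def by (intro holomorphic_intros) auto

lemma holomorphic_mzeta_remainder: "holomorphic_several (Suc r) (mzeta_remainder r M) (shifted_region (Suc r) M)"
  unfolding mzeta_remainder_def[abs_def]
  by (intro holomorphic_several_suminf holomorphic_several_mult holomorphic_truncated_mzeta openin_shifted_region
       holomorphic_several_compose[OF holomorphic_several_coord holomorphic_powr_remainder] mzeta_remainder_majorant)

text \<open>Abel summation multiplies n^(1 - s_(r+1)) by the increment of the truncated sum, whose
  last factor is n^(-s_r). The product has the single exponent s_r + s_(r+1) - 1.\<close>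

definition merge_last :: "nat \<Rightarrow> (nat \<Rightarrow> complex) \<Rightarrow> nat \<Rightarrow> complex" where
  "merge_last r s = (\<lambda>i\<in>{1..r}. if i = r then s r + s (Suc r) - 1 else s i)"

abbreviation shift_last :: "nat \<Rightarrow> nat \<Rightarrow> (nat \<Rightarrow> complex) \<Rightarrow> nat \<Rightarrow> complex" where
  "shift_last r j s \<equiv> s(r := s r + of_nat j)"

lemma merge_last_in_Cspace [simp]: "merge_last r s \<in> Cspace r"
  by (simp add: merge_last_def)

lemma sum_merge_last:
  assumes "j \<in> {1..r}"
  shows "(\<Sum>i\<in>{j..r}. merge_last r s i) = (\<Sum>i\<in>{j..Suc r}. s i) - 1"
proof -
  obtain q where q: "r = Suc q" using assms by (cases r) auto
  have "(\<Sum>i\<in>{j..Suc q}. merge_last r s i) = (\<Sum>i\<in>{j..q}. merge_last r s i) + merge_last r s (Suc q)"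
    using assms q by (simp add: sum.atLeast_Suc_atMost)
  also have "(\<Sum>i\<in>{j..q}. merge_last r s i) = (\<Sum>i\<in>{j..q}. s i)"
    using assms q by (intro sum.cong) (auto simp: merge_last_def)
  finally show ?thesis using assms q by (simp add: merge_last_def)
qed

lemma sum_shift_last:
  assumes "k \<in> {1..r}"
  shows "(\<Sum>i\<in>{k..r}. shift_last r j s i) = (\<Sum>i\<in>{k..r}. s i) + of_nat j"
proof -
  have "(\<Sum>i\<in>{k..r}. shift_last r j s i) = (\<Sum>i\<in>{k..r}. s i + (if i = r then of_nat j else 0))"
    by (rule sum.cong) auto
  then show ?thesis using assms by (simp add: sum.distrib)
qed

text \<open>Merging lowers each tail sum by 1 and each tail length by 1, so the inequalities are
  carried over unchanged.\<close>

lemma merge_last_in_shifted_region: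
  "s \<in> shifted_region (Suc r) M \<Longrightarrow> merge_last r s \<in> shifted_region r M"
  unfolding shifted_region_def
proof (intro CollectI conjI ballI merge_last_in_Cspace)
  fix j assume s: "s \<in> {s \<in> Cspace (Suc r). \<forall>j\<in>{1..Suc r}. real (Suc r - j + 1) < Re (\<Sum>i = j..Suc r. s i) + real M}"
    and j: "j \<in> {1..r}"
  from s j have "real (Suc r - j + 1) < Re (\<Sum>i = j..Suc r. s i) + real M" by auto
  then show "real (r - j + 1) < Re (\<Sum>i = j..r. merge_last r s i) + real M"
    using j by (simp add: sum_merge_last Suc_diff_le del: sum.cl_ivl_Suc Re_sum)
qed

lemma shift_last_in_shifted_region:
  assumes "s \<in> shifted_region (Suc r) (M + j)"
  shows "shift_last (Suc r) j s \<in> shifted_region (Suc r) M"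
proof -
  have "s \<in> Cspace (Suc r)" using assms shifted_region_subset by blast
  then have "shift_last (Suc r) j s \<in> Cspace (Suc r)" by (rule fun_upd_in_Cspace) simp
  moreover have "real (Suc r - k + 1) < Re (\<Sum>i = k..Suc r. shift_last (Suc r) j s i) + real M" if k: "k \<in> {1..Suc r}" for k
  proof -
    have "real (Suc r - k + 1) < Re (\<Sum>i = k..Suc r. s i) + real (M + j)"
      using assms k unfolding shifted_region_def by blast
    then show ?thesis unfolding sum_shift_last[OF k] by simp
  qed
  ultimately show ?thesis unfolding shifted_region_def by blast
qed

lemma translates_merge_last: "r \<ge> 1 \<Longrightarrow> translates_coords (Suc r) r (merge_last r)"
  unfolding translates_coords_def
proof
  fix i assume "r \<ge> 1" "i \<in> {1..Suc r}"
  then show "\<exists>i'\<in>{1..r}. \<forall>z w. merge_last r (z(i := w)) = (merge_last r z)(i' := merge_last r z i' + (w - z i))"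
    \<comment> \<open>The coordinates r and r + 1 both feed coordinate r of the image, hence the
      minimum.\<close>
    by (intro bexI[of _ "min i r"]) (auto simp: merge_last_def fun_eq_iff restrict_def min_def le_Suc_eq)
qed

lemma translates_shift_last: "translates_coords r r (shift_last r j)"
  unfolding translates_coords_def by (intro ballI bexI) (auto simp: fun_eq_iff)

lemma continuous_merge_last: "continuous_on UNIV (merge_last r)"
proof (rule continuous_on_coordinatewise_then_product)
  fix i
  show "continuous_on UNIV (\<lambda>s. merge_last r s i)"
    by (cases "i \<in> {1..r}"; cases "i = r")
       (auto simp: merge_last_def intro!: continuous_intros continuous_on_coord)
qed

lemma continuous_shift_last: "continuous_on UNIV (shift_last r j)"
  by (intro continuous_on_fun_upd_left continuous_on_id continuous_intros continuous_on_coord)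

text \<open>With \<open>G\<close> the continuation of depth \<open>r\<close>, \<open>mzeta_phi r G M\<close> continues \<open>(s\<^bsub>r+1\<^esub> - 1) \<zeta>\<^bsub>r+1\<^esub>(s)\<close> to
  \<open>shifted_region (Suc r) M\<close>. The factor \<open>s\<^bsub>r+1\<^esub> - 1\<close> is kept because the Pochhammer coefficient of each
  shifted term \<open>\<zeta>\<^bsub>r+1\<^esub>(\<dots>, s\<^bsub>r+1\<^esub> + j)\<close> then absorbs its pole, so that no spurious singularities appear.\<close>

function mzeta_phi :: "nat \<Rightarrow> ((nat \<Rightarrow> complex) \<Rightarrow> complex) \<Rightarrow> nat \<Rightarrow> (nat \<Rightarrow> complex) \<Rightarrow> complex" where
  "mzeta_phi r G M s =
     (if M = 0 then (s (Suc r) - 1) * mzeta_sum (Suc r) s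
      else G (merge_last r s)
         - (\<Sum>j\<in>{1..<M}. pochhammer (s (Suc r) - 1) j / fact (Suc j) * mzeta_phi r G (M - j) (shift_last (Suc r) j s))
         - mzeta_remainder r M s)"
  by pat_completeness auto
termination by (relation "Wellfounded.measure (\<lambda>(r, G, M, s). M)") auto

declare mzeta_phi.simps [simp del]

text \<open>The value \<open>0\<close> in depth \<open>0\<close> is the value of the telescoped series in depth \<open>1\<close>, see
  \<open>telescoped_sums\<close>; it is not \<open>\<zeta>\<^sub>0 = 1\<close>.\<close>

primrec mzeta_cont :: "nat \<Rightarrow> (nat \<Rightarrow> complex) \<Rightarrow> complex" where
  "mzeta_cont 0 = (\<lambda>s. 0)"
| "mzeta_cont (Suc r) = (\<lambda>s. mzeta_phi r (mzeta_cont r) (LEAST M. s \<in> shifted_region (Suc r) M) s / (s (Suc r) - 1))"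

text \<open>This is the boundary term of the Abel summation; it vanishes by the power saving in
  \<open>truncated_mzeta_real_bound\<close>.\<close>

lemma truncated_mzeta_times_powr_tendsto_0:
  assumes "s \<in> shifted_region (Suc r) 0"
  shows "(\<lambda>n. of_nat n powr (1 - s (Suc r)) * truncated_mzeta s r n) \<longlonglongrightarrow> 0"
proof -
  have "real_region (Suc r) (\<lambda>i. Re (s i))"
    using assms by (simp add: shifted_region_def real_region_def del: sum.cl_ivl_Suc)
  from truncated_mzeta_real_bound[OF this] obtain \<delta> C where dC: "\<delta> > 0" "C \<ge> 0"
    "\<And>n. n \<ge> 1 \<Longrightarrow> truncated_mzeta_real (\<lambda>i. Re (s i)) r n \<le> C * real n powr (Re (s (Suc r)) - 1 - \<delta>)"
    by blast
  have "norm (of_nat n powr (1 - s (Suc r)) * truncated_mzeta s r n) \<le> C * real n powr (- \<delta>)" if n: "n \<ge> 1" for n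
  proof -
    have "norm (of_nat n powr (1 - s (Suc r)) * truncated_mzeta s r n) \<le>
        real n powr (1 - Re (s (Suc r))) * (C * real n powr (Re (s (Suc r)) - 1 - \<delta>))"
      unfolding norm_mult using n
      by (intro mult_mono order_trans[OF norm_truncated_mzeta_le dC(3)]) (auto simp: norm_of_nat_powr)
    also have "\<dots> = C * real n powr (- \<delta>)" by (simp add: mult_ac flip: powr_add)
    finally show ?thesis .
  qed
  moreover have "(\<lambda>n. C * real n powr (- \<delta>)) \<longlonglongrightarrow> 0"
    using tendsto_mult_right_zero[OF tendsto_neg_powr[OF _ filterlim_real_sequentially, of "- \<delta>"]] dC(1) by simp
  ultimately show ?thesis
    by (rule Lim_null_comparison[OF eventually_sequentiallyI[of 1]])
qed

lemma truncated_mzeta_merge_last: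
  assumes "r \<ge> 1"
  shows "of_nat (Suc n) powr (1 - s (Suc r)) * (truncated_mzeta s r (Suc (Suc n)) - truncated_mzeta s r (Suc n))
     = of_nat (Suc n) powr (- merge_last r s r) * truncated_mzeta (merge_last r s) (r - 1) (Suc n)"
proof -
  obtain q where q: "r = Suc q" using assms by (cases r) auto
  have "truncated_mzeta s (Suc q) (Suc (Suc n)) - truncated_mzeta s (Suc q) (Suc n) = of_nat (Suc n) powr (- s (Suc q)) * truncated_mzeta s q (Suc n)"
    by (simp add: atLeastLessThanSuc)
  moreover have "of_nat (Suc n) powr (- merge_last r s r) = of_nat (Suc n) powr (1 - s (Suc r)) * (of_nat (Suc n) powr (- s (Suc q)) :: complex)"
    by (subst powr_add[symmetric]) (simp add: merge_last_def q algebra_simps)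
  moreover have "truncated_mzeta (merge_last r s) (r - 1) (Suc n) = truncated_mzeta s q (Suc n)"
    unfolding q diff_Suc_1 by (rule truncated_mzeta_cong) (auto simp: merge_last_def)
  ultimately show ?thesis unfolding q by (simp only: mult.assoc)
qed

text \<open>Abel summation of the telescoping series
  \<open>\<Sum>\<^sub>n ((n - 1)\<^bsup>1 - s\<^esup> - n\<^bsup>1 - s\<^esup>) T n\<close>.\<close>

lemma telescoped_sums:
  assumes s: "s \<in> shifted_region (Suc r) 0"
  shows "(\<lambda>n. (of_nat n powr (1 - s (Suc r)) - of_nat (Suc n) powr (1 - s (Suc r))) * truncated_mzeta s r (Suc n)) sums
      (if r = 0 then 0 else mzeta_sum r (merge_last r s))"
proof -
  define a where "a n = of_nat n powr (1 - s (Suc r))" for n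
  define t where "t = truncated_mzeta s r"
  define B where "B = (if r = 0 then 0 else mzeta_sum r (merge_last r s))"
  \<comment> \<open>Summation by parts. No boundary term appears at 0 because
    \<open>a 0 = 0\<close>, as \<open>0 powr z = 0\<close>; this matters for r = 0, where
    \<open>t 0 = 1\<close>.\<close>
  have partial: "(\<Sum>n<N. (a n - a (Suc n)) * t (Suc n)) = (\<Sum>n<N. a n * (t (Suc n) - t n)) - a N * t N" for N
    by (induction N) (simp_all add: a_def algebra_simps)
  have "(\<lambda>n. a n * (t (Suc n) - t n)) sums B"
  proof (cases r)
    case 0
    then show ?thesis by (simp add: t_def B_def)
  next
    case (Suc q)
    have m: "merge_last r s \<in> shifted_region (Suc q) 0"
      using merge_last_in_shifted_region[OF s] Suc by simp
    have "(\<lambda>n. of_nat (Suc n) powr (- merge_last r s r) * truncated_mzeta (merge_last r s) (r - 1) (Suc n)) sums mzeta_sum r (merge_last r s)"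
      unfolding mzeta_sum_def using summable_norm_cancel[OF mzeta_sum_abs_summable[OF m]] Suc by (intro summable_sums) simp
    then have "(\<lambda>n. a (Suc n) * (t (Suc (Suc n)) - t (Suc n))) sums B"
      unfolding a_def t_def by (subst truncated_mzeta_merge_last) (use Suc in \<open>auto simp: B_def\<close>)
    then have "(\<lambda>n. a n * (t (Suc n) - t n)) sums (B + a 0 * (t (Suc 0) - t 0))"
      by (rule sums_Suc)
    then show ?thesis by (simp add: a_def)
  qed
  then have "(\<lambda>N. (\<Sum>n<N. a n * (t (Suc n) - t n)) - a N * t N) \<longlonglongrightarrow> B - 0"
    unfolding sums_def using truncated_mzeta_times_powr_tendsto_0[OF s] unfolding a_def t_def by (intro tendsto_diff)
  then show ?thesis unfolding sums_def partial[symmetric] by (simp add: a_def t_def B_def)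
qed

text \<open>The binomial expansion to order one splits the telescoping term into (s - 1)(n + 1)^(-s)
  and a remainder. Summed against the truncated sums, the left side is the telescoped value and the
  right side is (s - 1) zeta plus the remainder series.\<close>

lemma mzeta_phi_Suc_0:
  assumes s: "s \<in> shifted_region (Suc r) 0"
    and G: "G (merge_last r s) = (if r = 0 then 0 else mzeta_sum r (merge_last r s))"
  shows "mzeta_phi r G (Suc 0) s = mzeta_phi r G 0 s"
proof -
  define \<sigma> where "\<sigma> = s (Suc r)"
  have s1: "s \<in> shifted_region (Suc r) 1" using shifted_region_mono[of 0 1] s by blast
  have "(of_nat n powr (1 - \<sigma>) - of_nat (Suc n) powr (1 - \<sigma>)) * truncated_mzeta s r (Suc n)
     = (\<sigma> - 1) * (of_nat (Suc n) powr (- \<sigma>) * truncated_mzeta s r (Suc n)) + powr_remainder 1 \<sigma> n * truncated_mzeta s r (Suc n)" for n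
  proof -
    have "{..1::nat} = {0, 1}" by auto
    then have *: "powr_remainder 1 \<sigma> n = of_nat n powr (1 - \<sigma>) - (of_nat (Suc n) powr (1 - \<sigma>) + (\<sigma> - 1) * of_nat (Suc n) powr (- \<sigma>))"
      by (simp add: powr_remainder_def del: of_nat_Suc One_nat_def)
    show ?thesis unfolding * by (simp add: algebra_simps del: of_nat_Suc)
  qed
  then have "(\<lambda>n. (\<sigma> - 1) * (of_nat (Suc n) powr (- \<sigma>) * truncated_mzeta s r (Suc n)) + powr_remainder 1 \<sigma> n * truncated_mzeta s r (Suc n))
     sums G (merge_last r s)"
    using telescoped_sums[OF s] unfolding G \<sigma>_def by simp
  moreover have "(\<lambda>n. (\<sigma> - 1) * (of_nat (Suc n) powr (- \<sigma>) * truncated_mzeta s r (Suc n)) + powr_remainder 1 \<sigma> n * truncated_mzeta s r (Suc n))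
     sums ((\<sigma> - 1) * mzeta_sum (Suc r) s + mzeta_remainder r 1 s)"
    unfolding mzeta_sum_def mzeta_remainder_def \<sigma>_def diff_Suc_1
    by (intro sums_add sums_mult summable_sums mzeta_remainder_summable[OF s1] summable_norm_cancel[OF mzeta_sum_abs_summable[OF s]])
  ultimately have "G (merge_last r s) = (\<sigma> - 1) * mzeta_sum (Suc r) s + mzeta_remainder r 1 s"
    by (rule sums_unique2)
  then show ?thesis by (simp add: mzeta_phi.simps[of r G] \<sigma>_def)
qed

text \<open>Raising the order removes one more binomial term from every summand, and these terms add
  up to a value of the series with last argument raised by \<open>M\<close>, which converges in
  \<open>shifted_region (Suc r) M\<close>.\<close>

lemma mzeta_remainder_Suc:
  assumes s: "s \<in> shifted_region (Suc r) M"
  shows "mzeta_remainder r (Suc M) s = mzeta_remainder r M s -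
    pochhammer (s (Suc r) - 1) (Suc M) / fact (Suc M) * mzeta_sum (Suc r) (shift_last (Suc r) M s)"
proof -
  let ?s' = "shift_last (Suc r) M s" and ?c = "pochhammer (s (Suc r) - 1) (Suc M) / fact (Suc M)"
  have s': "?s' \<in> shifted_region (Suc r) 0" using shift_last_in_shifted_region[of s r 0 M] s by simp
  have t: "truncated_mzeta ?s' r n = truncated_mzeta s r n" for n by (rule truncated_mzeta_cong) auto
  have e: "1 - s (Suc r) - of_nat (Suc M) = - ?s' (Suc r)" by simp
  have "powr_remainder (Suc M) (s (Suc r)) n * truncated_mzeta s r (Suc n) =
     powr_remainder M (s (Suc r)) n * truncated_mzeta s r (Suc n) - ?c * (of_nat (Suc n) powr (- ?s' (Suc r)) * truncated_mzeta ?s' r (Suc n))" for n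
    unfolding t powr_remainder_def sum.atMost_Suc e by (simp add: algebra_simps del: of_nat_Suc pochhammer_Suc fact_Suc)
  then show ?thesis unfolding mzeta_remainder_def mzeta_sum_def diff_Suc_1
    using mzeta_remainder_summable[OF s] summable_norm_cancel[OF mzeta_sum_abs_summable[OF s']]
    by (simp only: suminf_diff[symmetric] suminf_mult summable_mult)
qed

text \<open>Consistency on overlaps. Passing from \<open>M\<close> to M + 1 adds the summand j = M
  and changes the remainder by the same amount, so both cancel; the other summands agree by
  induction, being taken at the smaller orders M - j.\<close>

lemma mzeta_phi_Suc:
  assumes G: "\<And>s. s \<in> shifted_region (Suc r) 0 \<Longrightarrow> G (merge_last r s) = (if r = 0 then 0 else mzeta_sum r (merge_last r s))"
    and s: "s \<in> shifted_region (Suc r) M"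
  shows "mzeta_phi r G (Suc M) s = mzeta_phi r G M s"
  using s
proof (induction M arbitrary: s rule: less_induct)
  case (less M)
  show ?case
  proof (cases "M = 0")
    case True with less.prems show ?thesis using mzeta_phi_Suc_0[of s r G] G[of s] by simp
  next
    case False
    let ?c = "\<lambda>j. pochhammer (s (Suc r) - 1) j / fact (Suc j)"
    let ?s' = "shift_last (Suc r) M s"
    have s': "?s' \<in> shifted_region (Suc r) 0" using shift_last_in_shifted_region[of s r 0 M] less.prems by simp
    have "(\<Sum>j\<in>{1..<Suc M}. ?c j * mzeta_phi r G (Suc M - j) (shift_last (Suc r) j s))
      = (\<Sum>j\<in>{1..<M}. ?c j * mzeta_phi r G (Suc M - j) (shift_last (Suc r) j s)) + ?c M * mzeta_phi r G 1 ?s'"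
      using False by (simp add: atLeastLessThanSuc)
    also have "(\<Sum>j\<in>{1..<M}. ?c j * mzeta_phi r G (Suc M - j) (shift_last (Suc r) j s)) =
               (\<Sum>j\<in>{1..<M}. ?c j * mzeta_phi r G (M - j) (shift_last (Suc r) j s))"
    proof (rule sum.cong[OF refl])
      fix j assume j: "j \<in> {1..<M}"
      have in_region: "shift_last (Suc r) j s \<in> shifted_region (Suc r) (M - j)"
        using less.prems j by (intro shift_last_in_shifted_region) simp
      have "mzeta_phi r G (Suc (M - j)) (shift_last (Suc r) j s) = mzeta_phi r G (M - j) (shift_last (Suc r) j s)"
        by (rule less.IH[OF _ in_region]) (use j in auto)
      moreover have "Suc M - j = Suc (M - j)" using j by (simp add: Suc_diff_le)
      ultimately show "?c j * mzeta_phi r G (Suc M - j) (shift_last (Suc r) j s) = ?c j * mzeta_phi r G (M - j) (shift_last (Suc r) j s)"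
        by metis
    qed
    \<comment> \<open>The factor s - 1 + M contributed by \<open>mzeta_phi\<close> at the shifted
      point is the last factor of the Pochhammer symbol of length M + 1. This is why the recursion
      uses length \<open>j\<close> over the factorial of j + 1.\<close>
    also have "mzeta_phi r G 1 ?s' = (s (Suc r) - 1 + of_nat M) * mzeta_sum (Suc r) ?s'"
      using mzeta_phi_Suc_0[where G = G, OF s' G[OF s']] by (simp add: mzeta_phi.simps[of r G 0] algebra_simps)
    also have "?c M * \<dots> = pochhammer (s (Suc r) - 1) (Suc M) / fact (Suc M) * mzeta_sum (Suc r) ?s'"
      by (simp add: pochhammer_Suc mult_ac)
    finally have split: "(\<Sum>j\<in>{1..<Suc M}. ?c j * mzeta_phi r G (Suc M - j) (shift_last (Suc r) j s))
      = (\<Sum>j\<in>{1..<M}. ?c j * mzeta_phi r G (M - j) (shift_last (Suc r) j s))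
        + pochhammer (s (Suc r) - 1) (Suc M) / fact (Suc M) * mzeta_sum (Suc r) ?s'" .
    have unfold: "mzeta_phi r G N s = G (merge_last r s)
        - (\<Sum>j\<in>{1..<N}. ?c j * mzeta_phi r G (N - j) (shift_last (Suc r) j s)) - mzeta_remainder r N s"
      if "N \<noteq> 0" for N
      by (subst mzeta_phi.simps) (simp only: that if_False)
    have "a - (b + c) - (d - c) = a - b - d" for a b c d :: complex by simp
    then show ?thesis
      unfolding unfold[OF nat.discI[OF refl]] unfold[OF False] split mzeta_remainder_Suc[OF less.prems] .
  qed
qed

lemma mzeta_cont_eq_sum_Suc:
  assumes "s \<in> shifted_region (Suc r) 0"
  shows "mzeta_cont (Suc r) s = mzeta_sum (Suc r) s"
proof -
  have "(LEAST M. s \<in> shifted_region (Suc r) M) = 0" using assms by (intro Least_equality) auto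
  moreover have "1 < Re (s (Suc r))" using assms by (auto simp: shifted_region_def dest!: bspec[of _ _ "Suc r"])
  then have "s (Suc r) \<noteq> 1" by auto
  ultimately show ?thesis by (simp add: mzeta_phi.simps)
qed

lemma mzeta_cont_merge_last:
  assumes "s \<in> shifted_region (Suc r) 0"
  shows "mzeta_cont r (merge_last r s) = (if r = 0 then 0 else mzeta_sum r (merge_last r s))"
  using merge_last_in_shifted_region[OF assms] by (cases r) (auto simp: mzeta_cont_eq_sum_Suc simp del: mzeta_cont.simps(2))

text \<open>Any admissible order may replace the least one, so on each of the open regions
  \<open>mzeta_cont\<close> is given by a single formula.\<close>

lemma mzeta_cont_eq_phi:
  assumes s: "s \<in> shifted_region (Suc r) M"
  shows "mzeta_cont (Suc r) s = mzeta_phi r (mzeta_cont r) M s / (s (Suc r) - 1)"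
proof -
  define L where "L = (LEAST M. s \<in> shifted_region (Suc r) M)"
  have L: "s \<in> shifted_region (Suc r) L" unfolding L_def by (rule LeastI[where P = "\<lambda>M. s \<in> shifted_region (Suc r) M", OF s])
  have "L \<le> M" unfolding L_def by (rule Least_le[where P = "\<lambda>M. s \<in> shifted_region (Suc r) M", OF s])
  have "mzeta_phi r (mzeta_cont r) M s = mzeta_phi r (mzeta_cont r) L s"
    using \<open>L \<le> M\<close>
  proof (induction M rule: dec_induct)
    case (step M)
    have "s \<in> shifted_region (Suc r) M" using L shifted_region_mono[OF step(1)] by blast
    with mzeta_phi_Suc[OF mzeta_cont_merge_last this] step show ?case by simp
  qed simp
  then show ?thesis by (simp add: L_def)
qed

text \<open>Only tails of length at least 2 impose conditions; the hyperplane s_r = 1 enters in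
  \<open>mzeta_domain\<close> through the division by s_r - 1. Whole half-lines of integers are
  excluded, to make the set stable under \<open>shift_last\<close>, without claiming that each
  hyperplane is singular.\<close>

definition mzeta_phi_domain :: "nat \<Rightarrow> (nat \<Rightarrow> complex) set" where
  "mzeta_phi_domain r = {s \<in> Cspace r. \<forall>j\<in>{1..<r}. (\<Sum>i\<in>{j..r}. s i) - of_nat (r - j + 1) \<notin> \<int>\<^sub>\<le>\<^sub>0}"

definition mzeta_domain :: "nat \<Rightarrow> (nat \<Rightarrow> complex) set" where
  "mzeta_domain r = {s \<in> mzeta_phi_domain r. s r \<noteq> 1}"

section \<open>Meromorphy of the continuation\<close>

text \<open>\<open>1/\<Gamma>\<close> is an entire function with zeros exactly at the non-positive integers, so it supplies
  global denominators for the infinitely many polar hyperplanes.\<close>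

lemma quotient_on_phi_domain:
  assumes "openin (Cpow r) U"
  shows "quotient_on r U (mzeta_phi_domain r) (\<lambda>_. 0)"
proof (rule quotient_onI[OF holomorphic_several_const[OF assms, of 0]])
  let ?h = "\<lambda>s. \<Prod>j\<in>{1..<r}. rGamma ((\<Sum>i\<in>{j..r}. s i) - of_nat (r - j + 1))"
  show "holomorphic_several r ?h U"
    by (intro holomorphic_several_prod holomorphic_several_compose[OF _ holomorphic_rGamma] holomorphic_several_diff
        holomorphic_several_sum holomorphic_several_coord holomorphic_several_const assms)
  show "?h s \<noteq> 0 \<longleftrightarrow> s \<in> mzeta_phi_domain r" if "s \<in> U" for s
  proof -
    have "s \<in> Cspace r" using that openin_subset[OF assms] by auto
    then show ?thesis by (simp add: mzeta_phi_domain_def rGamma_eq_zero_iff)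
  qed
qed simp

lemma quotient_on_domain:
  assumes "openin (Cpow r) U"
  shows "quotient_on r U (mzeta_domain r) (\<lambda>s. 1 / (s r - 1))"
proof -
  obtain g h where gh: "holomorphic_several r h U" "\<And>z. z \<in> U \<Longrightarrow> h z \<noteq> 0 \<longleftrightarrow> z \<in> mzeta_phi_domain r"
    using quotient_on_phi_domain[OF assms] by (rule quotient_onE) (rule that)
  show ?thesis
  proof (rule quotient_onI[OF gh(1) holomorphic_several_mult[OF gh(1)]])
    show "holomorphic_several r (\<lambda>s. s r - 1) U"
      by (intro holomorphic_several_diff holomorphic_several_coord holomorphic_several_const assms)
    show "h s * (s r - 1) \<noteq> 0 \<longleftrightarrow> s \<in> mzeta_domain r" if "s \<in> U" for s
      using gh(2)[OF that] by (auto simp: mzeta_domain_def)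
    show "1 / (s r - 1) = h s / (h s * (s r - 1))" if "s \<in> U" "s \<in> mzeta_domain r" for s
      using gh(2)[OF that(1)] that by (simp add: mzeta_domain_def)
  qed
qed

text \<open>Tails of length at least 3 become the tail conditions in depth r; the tail of length 2
  excludes s_r + s_(r+1) = 2, which is exactly the pole of the merged last argument at 1.\<close>

lemma merge_last_in_domain:
  assumes s: "s \<in> mzeta_phi_domain (Suc r)" and r: "r \<ge> 1"
  shows "merge_last r s \<in> mzeta_domain r"
proof -
  have n: "(\<Sum>i\<in>{j..Suc r}. s i) - of_nat (Suc r - j + 1) \<notin> \<int>\<^sub>\<le>\<^sub>0" if "j \<in> {1..r}" for j
    using s that unfolding mzeta_phi_domain_def by auto
  have "(\<Sum>i\<in>{j..r}. merge_last r s i) - of_nat (r - j + 1) \<notin> \<int>\<^sub>\<le>\<^sub>0" if "j \<in> {1..<r}" for j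
    using n[of j] that by (simp add: sum_merge_last Suc_diff_le algebra_simps del: sum.cl_ivl_Suc)
  moreover have "merge_last r s r \<noteq> 1"
  proof
    assume "merge_last r s r = 1"
    then have "(\<Sum>i\<in>{r..Suc r}. s i) - of_nat (Suc r - r + 1) = 0"
      using r by (simp add: merge_last_def algebra_simps)
    then show False using n[of r] r by (metis atLeastAtMost_iff order_refl nonpos_Ints_of_int of_int_0)
  qed
  ultimately show ?thesis
    unfolding mzeta_domain_def mzeta_phi_domain_def using merge_last_in_Cspace[of r s] by blast
qed

text \<open>A tail that is bad after adding \<open>j\<close> was bad before: subtracting
  \<open>j\<close> from a non-positive integer leaves it non-positive.\<close>

lemma shift_last_in_phi_domain:
  assumes "s \<in> mzeta_phi_domain r" "r \<ge> 1"
  shows "shift_last r j s \<in> mzeta_phi_domain r"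
proof -
  have "shift_last r j s \<in> Cspace r" using assms unfolding mzeta_phi_domain_def by (intro fun_upd_in_Cspace) auto
  moreover have "(\<Sum>i\<in>{k..r}. shift_last r j s i) - of_nat (r - k + 1) \<notin> \<int>\<^sub>\<le>\<^sub>0" if k: "k \<in> {1..<r}" for k
  proof
    assume "(\<Sum>i\<in>{k..r}. shift_last r j s i) - of_nat (r - k + 1) \<in> \<int>\<^sub>\<le>\<^sub>0"
    then have "((\<Sum>i\<in>{k..r}. s i) - of_nat (r - k + 1)) + of_nat j \<in> \<int>\<^sub>\<le>\<^sub>0"
      using k by (subst (asm) sum_shift_last) (auto simp: algebra_simps)
    then obtain n where "((\<Sum>i\<in>{k..r}. s i) - of_nat (r - k + 1)) + of_nat j = - of_nat n" by (auto elim!: nonpos_Ints_cases')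
    then have "(\<Sum>i\<in>{k..r}. s i) - of_nat (r - k + 1) = - of_nat (n + j)" by (simp add: algebra_simps)
    then have "(\<Sum>i\<in>{k..r}. s i) - of_nat (r - k + 1) \<in> \<int>\<^sub>\<le>\<^sub>0" by (metis minus_of_nat_in_nonpos_Ints)
    then show False using assms(1) k unfolding mzeta_phi_domain_def by blast
  qed
  ultimately show ?thesis unfolding mzeta_phi_domain_def by blast
qed

text \<open>Follows the recursion of \<open>mzeta_phi\<close>: each term is pulled back from a
  region where it is already a quotient, and \<open>quotient_on_weaken\<close> restricts the
  pulled-back domain to the common one.\<close>

lemma quotient_on_phi:
  assumes G: "r \<ge> 1 \<Longrightarrow> \<forall>M. quotient_on r (shifted_region r M) (mzeta_domain r) G" and G0: "r = 0 \<Longrightarrow> G = (\<lambda>_. 0)"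
  shows "quotient_on (Suc r) (shifted_region (Suc r) M) (mzeta_phi_domain (Suc r)) (mzeta_phi r G M)"
proof (induction M rule: less_induct)
  case (less M)
  let ?U = "shifted_region (Suc r)" and ?D = "mzeta_phi_domain (Suc r)"
  have o: "openin (Cpow (Suc r)) (?U M)" by (rule openin_shifted_region)
  note hol = quotient_on_holomorphic[OF quotient_on_phi_domain[OF o]]
  show ?case
  proof (cases "M = 0")
    case True
    have "holomorphic_several (Suc r) (\<lambda>s. (s (Suc r) - 1) * mzeta_sum (Suc r) s) (?U 0)"
      by (intro holomorphic_several_mult holomorphic_several_diff holomorphic_several_coord holomorphic_several_const
          openin_shifted_region holomorphic_mzeta_sum)
    then have "quotient_on (Suc r) (?U M) ?D (\<lambda>s. (s (Suc r) - 1) * mzeta_sum (Suc r) s)" using True by (intro hol) simp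
    then show ?thesis using True by (simp add: mzeta_phi.simps)
  next
    case False
    have 1: "quotient_on (Suc r) (?U M) ?D (\<lambda>s. G (merge_last r s))"
    proof (cases "r = 0")
      case True then show ?thesis using G0 quotient_on_phi_domain[OF o] by simp
    next
      case r: False
      have "quotient_on (Suc r) (?U M) (merge_last r -` mzeta_domain r) (\<lambda>s. G (merge_last r s))"
        by (rule quotient_on_translate[OF _ o merge_last_in_shifted_region continuous_merge_last translates_merge_last])
           (use G r in auto)
      then show ?thesis
        by (rule quotient_on_weaken[OF _ quotient_on_phi_domain[OF o]]) (use merge_last_in_domain r in auto)
    qed
    have 2: "quotient_on (Suc r) (?U M) ?D (\<lambda>s. pochhammer (s (Suc r) - 1) j / fact (Suc j) * mzeta_phi r G (M - j) (shift_last (Suc r) j s))"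
      if j: "j \<in> {1..<M}" for j
    proof (rule quotient_on_mult)
      show "quotient_on (Suc r) (?U M) ?D (\<lambda>s. pochhammer (s (Suc r) - 1) j / fact (Suc j))"
        by (intro hol holomorphic_several_compose[OF holomorphic_several_coord[OF o], where h = "\<lambda>w. pochhammer (w - 1) j / fact (Suc j)"] holomorphic_intros) auto
      have "quotient_on (Suc r) (?U M) (shift_last (Suc r) j -` ?D) (\<lambda>s. mzeta_phi r G (M - j) (shift_last (Suc r) j s))"
      proof (rule quotient_on_translate[OF _ o _ continuous_shift_last translates_shift_last])
        show "quotient_on (Suc r) (?U (M - j)) ?D (mzeta_phi r G (M - j))" using j by (intro less.IH) auto
        show "shift_last (Suc r) j s \<in> ?U (M - j)" if "s \<in> ?U M" for s
          using j that by (intro shift_last_in_shifted_region) auto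
      qed
      then show "quotient_on (Suc r) (?U M) ?D (\<lambda>s. mzeta_phi r G (M - j) (shift_last (Suc r) j s))"
        by (rule quotient_on_weaken[OF _ quotient_on_phi_domain[OF o]]) (use shift_last_in_phi_domain[of _ "Suc r"] in auto)
    qed
    have neg: "quotient_on (Suc r) (?U M) ?D (\<lambda>_. - 1)" by (intro hol holomorphic_several_const o)
    have "quotient_on (Suc r) (?U M) ?D (\<lambda>s. G (merge_last r s) +
        (- 1) * (\<Sum>j\<in>{1..<M}. pochhammer (s (Suc r) - 1) j / fact (Suc j) * mzeta_phi r G (M - j) (shift_last (Suc r) j s)) +
        (- 1) * mzeta_remainder r M s)"
      by (intro quotient_on_add quotient_on_mult neg 1 quotient_on_sum[OF neg] 2 hol holomorphic_mzeta_remainder)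
    moreover have "mzeta_phi r G M = (\<lambda>s. G (merge_last r s) +
        (- 1) * (\<Sum>j\<in>{1..<M}. pochhammer (s (Suc r) - 1) j / fact (Suc j) * mzeta_phi r G (M - j) (shift_last (Suc r) j s)) +
        (- 1) * mzeta_remainder r M s)"
      using False by (subst mzeta_phi.simps[abs_def]) simp
    ultimately show ?thesis by simp
  qed
qed

lemma quotient_on_mzeta_cont: "r \<ge> 1 \<Longrightarrow> quotient_on r (shifted_region r M) (mzeta_domain r) (mzeta_cont r)"
proof (induction r arbitrary: M)
  case (Suc r)
  let ?U = "shifted_region (Suc r) M"
  have "quotient_on (Suc r) ?U (mzeta_phi_domain (Suc r)) (mzeta_phi r (mzeta_cont r) M)"
    by (rule quotient_on_phi) (use Suc in auto)
  then have "quotient_on (Suc r) ?U (mzeta_domain (Suc r)) (mzeta_phi r (mzeta_cont r) M)"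
    by (rule quotient_on_weaken[OF _ quotient_on_domain[OF openin_shifted_region]]) (auto simp: mzeta_domain_def)
  then have "quotient_on (Suc r) ?U (mzeta_domain (Suc r)) (\<lambda>s. mzeta_phi r (mzeta_cont r) M s * (1 / (s (Suc r) - 1)))"
    by (rule quotient_on_mult[OF _ quotient_on_domain[OF openin_shifted_region]])
  then show ?case
    by (rule quotient_on_cong) (simp add: mzeta_cont_eq_phi del: mzeta_cont.simps)
qed simp

text \<open>Moving only the last coordinate suffices: the excluded hyperplanes remove countably many
  of its values, while a disc is uncountable.\<close>

lemma mzeta_domain_dense:
  assumes W: "openin (Cpow r) W" "W \<noteq> {}" and r: "r \<ge> 1"
  shows "W \<inter> mzeta_domain r \<noteq> {}"
proof -
  obtain p where p: "p \<in> W" using W by blast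
  have pC: "p \<in> Cspace r" using openin_subset[OF W(1)] p by auto
  have "open {w. p(r := w) \<in> W}" by (rule open_slice[OF W(1) _ pC]) (use openin_subset[OF W(1)] r in auto)
  moreover have "p r \<in> {w. p(r := w) \<in> W}" using p by simp
  ultimately obtain e where e: "e > 0" "ball (p r) e \<subseteq> {w. p(r := w) \<in> W}" using open_contains_ball by blast
  have unc: "uncountable (ball (p r) e)" using e(1) by (rule uncountable_ball)
  define B where "B = insert 1 (\<Union>j\<in>{1..<r}. (\<lambda>z. z + of_nat (r - j + 1) - (\<Sum>i\<in>{j..<r}. p i)) ` \<int>)"
  have "countable B" unfolding B_def by (auto intro!: countable_image countable_int[THEN countable_subset[rotated]] simp: Ints_def)
  then have "\<not> ball (p r) e \<subseteq> B" using unc countable_subset by blast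
  then obtain w where w: "p(r := w) \<in> W" "w \<notin> B" using e(2) by blast
  have "p(r := w) \<in> mzeta_domain r"
  proof -
    have "(\<Sum>i\<in>{j..r}. (p(r := w)) i) - of_nat (r - j + 1) \<notin> \<int>\<^sub>\<le>\<^sub>0" if j: "j \<in> {1..<r}" for j
    proof
      assume "(\<Sum>i\<in>{j..r}. (p(r := w)) i) - of_nat (r - j + 1) \<in> \<int>\<^sub>\<le>\<^sub>0"
      moreover have "(\<Sum>i\<in>{j..r}. (p(r := w)) i) = (\<Sum>i\<in>{j..<r}. p i) + w"
      proof -
        have "{j..r} = insert r {j..<r}" using j by auto
        then show ?thesis by (simp add: add.commute)
      qed
      ultimately have "(\<Sum>i\<in>{j..<r}. p i) + w - of_nat (r - j + 1) \<in> \<int>" (is "?z \<in> \<int>")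
        using nonpos_Ints_Int by metis
      moreover have "w = ?z + of_nat (r - j + 1) - (\<Sum>i\<in>{j..<r}. p i)" by simp
      ultimately obtain z where "z \<in> \<int>" "w = z + of_nat (r - j + 1) - (\<Sum>i\<in>{j..<r}. p i)" by blast
      with j w(2) show False by (auto simp: B_def)
    qed
    moreover have "(p(r := w)) r \<noteq> 1" using w(2) by (auto simp: B_def)
    moreover have "p(r := w) \<in> Cspace r" using pC r by (intro fun_upd_in_Cspace) auto
    ultimately show ?thesis unfolding mzeta_domain_def mzeta_phi_domain_def by blast
  qed
  with w show ?thesis by blast
qed

lemma meromorphic_mzeta_cont:
  assumes r: "r \<ge> 1"
  shows "meromorphic_several r (mzeta_domain r) (mzeta_cont r)"
proof (rule meromorphic_severalI)
  show "mzeta_domain r \<subseteq> Cspace r" by (auto simp: mzeta_domain_def mzeta_phi_domain_def)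
  show "W \<inter> mzeta_domain r \<noteq> {}" if "openin (Cpow r) W" "W \<noteq> {}" for W by (rule mzeta_domain_dense[OF that r])
  show "\<exists>U. p \<in> U \<and> quotient_on r U (mzeta_domain r) (mzeta_cont r)" if "p \<in> Cspace r" for p
    using in_shifted_region_ex[OF that] quotient_on_mzeta_cont[OF r] by blast
qed

section \<open>The multiple series and its continuation\<close>

definition mzeta_index :: "nat \<Rightarrow> (nat \<Rightarrow> nat) set" where
  "mzeta_index r = {n \<in> {1..r} \<rightarrow>\<^sub>E {1::nat..}. strict_mono_on {1..r} n}"

definition mzeta_index_below :: "nat \<Rightarrow> nat \<Rightarrow> (nat \<Rightarrow> nat) set" where
  "mzeta_index_below r N = {n \<in> mzeta_index r. \<forall>i\<in>{1..r}. n i < N}"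

lemma finite_mzeta_index_below: "finite (mzeta_index_below r N)"
proof (rule finite_subset)
  show "mzeta_index_below r N \<subseteq> {1..r} \<rightarrow>\<^sub>E {..<N}"
    unfolding mzeta_index_below_def mzeta_index_def by (auto simp: PiE_iff extensional_def)
qed (auto intro: finite_PiE)

lemma mzeta_index_below_Suc:
  assumes m: "m \<in> {1..<N}" and k: "k \<in> mzeta_index_below r m"
  shows "k(Suc r := m) \<in> mzeta_index_below (Suc r) N"
proof -
  have k': "\<And>i. i \<in> {1..r} \<Longrightarrow> 1 \<le> k i \<and> k i < m" "\<And>i. i \<notin> {1..r} \<Longrightarrow> k i = undefined"
    "\<And>i j. i \<in> {1..r} \<Longrightarrow> j \<in> {1..r} \<Longrightarrow> i < j \<Longrightarrow> k i < k j"
    using k unfolding mzeta_index_below_def mzeta_index_def by (auto simp: PiE_iff extensional_def strict_mono_on_def)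
  have "k(Suc r := m) \<in> {1..Suc r} \<rightarrow>\<^sub>E {1..}" using k'(1,2) m by (auto simp: PiE_iff extensional_def)
  moreover have "strict_mono_on {1..Suc r} (k(Suc r := m))"
  proof (rule strict_mono_onI)
    fix i j assume "i \<in> {1..Suc r}" "j \<in> {1..Suc r}" "i < j"
    then show "(k(Suc r := m)) i < (k(Suc r := m)) j" using k'(1)[of i] k'(3)[of i j] by auto
  qed
  moreover have "(k(Suc r := m)) i < N" if "i \<in> {1..Suc r}" for i
    using that m k'(1)[of i] by auto
  ultimately show ?thesis unfolding mzeta_index_below_def mzeta_index_def by blast
qed

lemma mzeta_index_below_SucD:
  assumes n: "n \<in> mzeta_index_below (Suc r) N"
  shows "n (Suc r) \<in> {1..<N}" "n(Suc r := undefined) \<in> mzeta_index_below r (n (Suc r))"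
proof -
  have n': "\<And>i. i \<in> {1..Suc r} \<Longrightarrow> 1 \<le> n i \<and> n i < N" "\<And>i. i \<notin> {1..Suc r} \<Longrightarrow> n i = undefined"
    "\<And>i j. i \<in> {1..Suc r} \<Longrightarrow> j \<in> {1..Suc r} \<Longrightarrow> i < j \<Longrightarrow> n i < n j"
    using n unfolding mzeta_index_below_def mzeta_index_def by (auto simp: PiE_iff extensional_def strict_mono_on_def)
  show "n (Suc r) \<in> {1..<N}" using n'(1)[of "Suc r"] by auto
  have "n(Suc r := undefined) \<in> {1..r} \<rightarrow>\<^sub>E {1..}" using n'(1,2) by (auto simp: PiE_iff extensional_def)
  moreover have "strict_mono_on {1..r} (n(Suc r := undefined))"
    using n'(3) by (auto simp: strict_mono_on_def)
  moreover have "(n(Suc r := undefined)) i < n (Suc r)" if "i \<in> {1..r}" for i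
    using that n'(3)[of i "Suc r"] by auto
  ultimately show "n(Suc r := undefined) \<in> mzeta_index_below r (n (Suc r))"
    unfolding mzeta_index_below_def mzeta_index_def by blast
qed

text \<open>The recursion splits off the largest index. It is stated for abstract factors so that it
  covers both the complex sums and their real majorants.\<close>

lemma sum_mzeta_index_below:
  fixes f :: "nat \<Rightarrow> nat \<Rightarrow> 'a::comm_semiring_1"
  assumes t0: "\<And>n. t 0 n = 1" and tS: "\<And>j n. t (Suc j) n = (\<Sum>m\<in>{1..<n}. f (Suc j) m * t j m)"
  shows "(\<Sum>n\<in>mzeta_index_below r N. \<Prod>i=1..r. f i (n i)) = t r N"
proof (induction r arbitrary: N)
  case 0
  have "mzeta_index_below 0 N = {\<lambda>_. undefined}"
    by (auto simp: mzeta_index_below_def mzeta_index_def strict_mono_on_def)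
  then show ?case by (simp add: t0)
next
  case (Suc r)
  have "(\<Sum>n\<in>mzeta_index_below (Suc r) N. \<Prod>i=1..Suc r. f i (n i))
     = (\<Sum>(m, k)\<in>Sigma {1..<N} (mzeta_index_below r). f (Suc r) m * (\<Prod>i=1..r. f i (k i)))"
  proof (rule sum.reindex_bij_witness[of _ "\<lambda>(m, k). k(Suc r := m)" "\<lambda>n. (n (Suc r), n(Suc r := undefined))"])
    fix n assume n: "n \<in> mzeta_index_below (Suc r) N"
    show "(case (n (Suc r), n(Suc r := undefined)) of (m, k) \<Rightarrow> k(Suc r := m)) = n" by simp
    show "(n (Suc r), n(Suc r := undefined)) \<in> Sigma {1..<N} (mzeta_index_below r)"
      using mzeta_index_below_SucD[OF n] by blast
    have "(\<Prod>i=1..r. f i ((n(Suc r := undefined)) i)) = (\<Prod>i=1..r. f i (n i))"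
      by (rule prod.cong) auto
    then show "(case (n (Suc r), n(Suc r := undefined)) of (m, k) \<Rightarrow> f (Suc r) m * (\<Prod>i=1..r. f i (k i))) = (\<Prod>i=1..Suc r. f i (n i))"
      by (simp add: mult.commute)
  next
    fix x assume "x \<in> Sigma {1..<N} (mzeta_index_below r)"
    then obtain m k where x: "x = (m, k)" "m \<in> {1..<N}" "k \<in> mzeta_index_below r m" by blast
    have "k (Suc r) = undefined" using x(3) by (auto simp: mzeta_index_below_def mzeta_index_def PiE_iff extensional_def)
    then show "(case case x of (m, k) \<Rightarrow> k(Suc r := m) of n \<Rightarrow> (n (Suc r), n(Suc r := undefined))) = x"
      using x(1) by auto
    show "(case x of (m, k) \<Rightarrow> k(Suc r := m)) \<in> mzeta_index_below (Suc r) N"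
      using mzeta_index_below_Suc[OF x(2,3)] x(1) by simp
  qed
  also have "\<dots> = (\<Sum>m\<in>{1..<N}. \<Sum>k\<in>mzeta_index_below r m. f (Suc r) m * (\<Prod>i=1..r. f i (k i)))"
    by (rule sum.Sigma[symmetric]) (auto intro: finite_mzeta_index_below)
  also have "\<dots> = t (Suc r) N" by (simp only: tS sum_distrib_left[symmetric] Suc.IH)
  finally show ?case .
qed

lemma sum_pred_eq: "(\<Sum>m\<in>{1..<Suc N}. f m) = (\<Sum>n<N. f (Suc n))"
  by (rule sum.reindex_bij_witness[of _ Suc "\<lambda>m. m - 1"]) auto

lemma finite_subset_mzeta_index_below:
  assumes "finite F" "F \<subseteq> mzeta_index r"
  shows "\<exists>N. \<forall>N'\<ge>N. F \<subseteq> mzeta_index_below r N'"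
proof -
  define N where "N = Suc (\<Sum>n\<in>F. \<Sum>i\<in>{1..r}. n i)"
  have "n i < N" if "n \<in> F" "i \<in> {1..r}" for n i
  proof -
    have "n i \<le> (\<Sum>i\<in>{1..r}. n i)" by (rule member_le_sum) (use that in auto)
    also have "\<dots> \<le> (\<Sum>n\<in>F. \<Sum>i\<in>{1..r}. n i)" by (rule member_le_sum) (use that assms in auto)
    finally show ?thesis by (simp add: N_def)
  qed
  then show ?thesis using assms unfolding mzeta_index_below_def
    by (intro exI[of _ N]) (auto intro: less_le_trans[of _ N])
qed

text \<open>Every finite set of indices lies in some \<open>mzeta_index_below\<close>, whose sums of
  norms are bounded by the real series; this gives absolute summability. The sets
  \<open>mzeta_index_below\<close> are cofinal among the finite sets, so the unordered sum is the
  limit of the truncated sums.\<close>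

lemma mzeta_series_eq_sum:
  assumes s: "s \<in> shifted_region (Suc r) 0"
  shows "mzeta_series (Suc r) s = mzeta_sum (Suc r) s"
proof -
  define f where "f n = (\<Prod>i=1..Suc r. of_nat (n i) powr (- s i))" for n
  define \<sigma> where "\<sigma> i = Re (s i)" for i
  define K where "K = (\<Sum>n. real (Suc n) powr (- \<sigma> (Suc r)) * truncated_mzeta_real \<sigma> r (Suc n))"
  have region: "real_region (Suc r) \<sigma>"
    using s by (simp add: shifted_region_def real_region_def \<sigma>_def del: sum.cl_ivl_Suc)
  have f_below: "(\<Sum>n\<in>mzeta_index_below (Suc r) N. f n) = truncated_mzeta s (Suc r) N" for N
    unfolding f_def by (rule sum_mzeta_index_below) auto
  have norm_f: "norm (f n) = (\<Prod>i=1..Suc r. real (n i) powr (- \<sigma> i))" if "n \<in> mzeta_index (Suc r)" for n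
    unfolding f_def prod_norm[symmetric] \<sigma>_def
    by (rule prod.cong) (use that in \<open>auto simp: mzeta_index_def PiE_iff norm_of_nat_powr\<close>)
  have "sum (\<lambda>n. norm (f n)) F \<le> K" if F: "finite F" "F \<subseteq> mzeta_index (Suc r)" for F
  proof -
    obtain N where N: "F \<subseteq> mzeta_index_below (Suc r) (Suc N)"
      using finite_subset_mzeta_index_below[OF F] le_SucI by blast
    have "sum (\<lambda>n. norm (f n)) F \<le> (\<Sum>n\<in>mzeta_index_below (Suc r) (Suc N). norm (f n))"
      by (rule sum_mono2[OF finite_mzeta_index_below N]) auto
    also have "\<dots> = (\<Sum>n\<in>mzeta_index_below (Suc r) (Suc N). \<Prod>i=1..Suc r. real (n i) powr (- \<sigma> i))"
      by (rule sum.cong) (auto simp: norm_f mzeta_index_below_def simp del: prod.cl_ivl_Suc)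
    also have "\<dots> = truncated_mzeta_real \<sigma> (Suc r) (Suc N)"
      by (rule sum_mzeta_index_below) auto
    also have "\<dots> = (\<Sum>n<N. real (Suc n) powr (- \<sigma> (Suc r)) * truncated_mzeta_real \<sigma> r (Suc n))"
      by (simp only: truncated_mzeta_real.simps sum_pred_eq)
    also have "\<dots> \<le> K" unfolding K_def
      by (rule sum_le_suminf[OF truncated_mzeta_real_summable[OF region]]) (auto intro: mult_nonneg_nonneg truncated_mzeta_real_nonneg)
    finally show ?thesis .
  qed
  then have "(\<lambda>n. norm (f n)) summable_on mzeta_index (Suc r)"
    by (intro nonneg_bounded_partial_sums_imp_summable_on[of _ _ K] eventually_finite_subsets_at_top_weakI) auto
  then have "f summable_on mzeta_index (Suc r)" by (rule abs_summable_summable)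
  then have "(sum f \<longlongrightarrow> infsum f (mzeta_index (Suc r))) (finite_subsets_at_top (mzeta_index (Suc r)))"
    by (rule infsum_tendsto)
  moreover have "filterlim (mzeta_index_below (Suc r)) (finite_subsets_at_top (mzeta_index (Suc r))) sequentially"
    unfolding filterlim_finite_subsets_at_top
  proof (intro allI impI)
    fix X assume "finite X \<and> X \<subseteq> mzeta_index (Suc r)"
    then obtain N where "\<And>N'. N' \<ge> N \<Longrightarrow> X \<subseteq> mzeta_index_below (Suc r) N'" using finite_subset_mzeta_index_below by blast
    then show "\<forall>\<^sub>F y in sequentially. finite (mzeta_index_below (Suc r) y) \<and> X \<subseteq> mzeta_index_below (Suc r) y \<and> mzeta_index_below (Suc r) y \<subseteq> mzeta_index (Suc r)"
      using finite_mzeta_index_below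
      by (intro eventually_sequentiallyI[of N]) (auto simp: mzeta_index_below_def)
  qed
  ultimately have "(\<lambda>N. sum f (mzeta_index_below (Suc r) N)) \<longlonglongrightarrow> infsum f (mzeta_index (Suc r))"
    by (rule filterlim_compose)
  then have "(\<lambda>N. truncated_mzeta s (Suc r) (Suc N)) \<longlonglongrightarrow> infsum f (mzeta_index (Suc r))"
    unfolding f_below by (rule LIMSEQ_Suc)
  moreover have "(\<lambda>n. of_nat (Suc n) powr (- s (Suc r)) * truncated_mzeta s r (Suc n)) sums mzeta_sum (Suc r) s"
    unfolding mzeta_sum_def diff_Suc_1 by (intro summable_sums summable_norm_cancel[OF mzeta_sum_abs_summable[OF s]])
  then have "(\<lambda>N. truncated_mzeta s (Suc r) (Suc N)) \<longlonglongrightarrow> mzeta_sum (Suc r) s"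
    unfolding sums_def truncated_mzeta.simps sum_pred_eq .
  ultimately have "infsum f (mzeta_index (Suc r)) = mzeta_sum (Suc r) s" by (rule LIMSEQ_unique)
  then show ?thesis by (simp only: mzeta_series_def f_def[abs_def] mzeta_index_def)
qed

lemma shifted_region_0_subset_domain: "r \<ge> 1 \<Longrightarrow> shifted_region r 0 \<subseteq> mzeta_domain r"
proof
  fix s assume r: "r \<ge> 1" and s: "s \<in> shifted_region r 0"
  have Re: "Re (\<Sum>i\<in>{j..r}. s i) > real (r - j + 1)" if "j \<in> {1..r}" for j
    using s that unfolding shifted_region_def by auto
  have "(\<Sum>i\<in>{j..r}. s i) - of_nat (r - j + 1) \<notin> \<int>\<^sub>\<le>\<^sub>0" if "j \<in> {1..<r}" for j
  proof
    assume "(\<Sum>i\<in>{j..r}. s i) - of_nat (r - j + 1) \<in> \<int>\<^sub>\<le>\<^sub>0"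
    then obtain n where "(\<Sum>i\<in>{j..r}. s i) - of_nat (r - j + 1) = - of_nat n" by (auto elim!: nonpos_Ints_cases')
    then have "(\<Sum>i\<in>{j..r}. s i) = of_nat (r - j + 1) - of_nat n" by (simp add: algebra_simps)
    then have "Re (\<Sum>i\<in>{j..r}. s i) = real (r - j + 1) - real n" by (simp only: minus_complex.sel complex_Re_of_nat)
    then show False using Re[of j] that by simp
  qed
  moreover have "s r \<noteq> 1" using Re[of r] r by auto
  ultimately show "s \<in> mzeta_domain r"
    using s shifted_region_subset unfolding mzeta_domain_def mzeta_phi_domain_def by blast
qed

lemma shifted_region_nonempty: "shifted_region r 0 \<noteq> {}"
proof -
  have "(\<lambda>i\<in>{1..r}. 2) \<in> shifted_region r 0"
    unfolding shifted_region_def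
  proof (intro CollectI conjI ballI)
    fix j assume j: "j \<in> {1..r}"
    have "(\<Sum>i\<in>{j..r}. (\<lambda>i\<in>{1..r}. 2 :: complex) i) = (\<Sum>i\<in>{j..r}. 2)" using j by (intro sum.cong) auto
    also have "\<dots> = of_nat (2 * (r - j + 1))" using j by (simp add: Suc_diff_le)
    finally have "Re (\<Sum>i\<in>{j..r}. (\<lambda>i\<in>{1..r}. 2 :: complex) i) = real (2 * (r - j + 1))"
      by (simp only: complex_Re_of_nat)
    then show "real (r - j + 1) < Re (\<Sum>i\<in>{j..r}. (\<lambda>i\<in>{1..r}. 2 :: complex) i) + real 0" by simp
  qed auto
  then show ?thesis by blast
qed

text \<open>The pair \<open>mzeta_domain\<close>, \<open>mzeta_cont\<close> witnesses the
  description, and any other continuation agrees with it on the open nonempty region of convergence,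
  hence at \<open>z\<close>.\<close>

theorem mzeta_eq_cont:
  assumes r: "r \<ge> 1" and z: "z \<in> mzeta_domain r"
  shows "mzeta r z = mzeta_cont r z"
proof -
  have series: "mzeta_cont r s = mzeta_series r s" if "s \<in> mzeta_region r" for s
    using that r unfolding mzeta_region_eq
    by (cases r) (auto simp: mzeta_cont_eq_sum_Suc mzeta_series_eq_sum simp del: mzeta_cont.simps)
  have reg: "mzeta_region r \<subseteq> mzeta_domain r"
    unfolding mzeta_region_eq by (rule shifted_region_0_subset_domain[OF r])
  show ?thesis unfolding mzeta_def
  proof (rule the_equality)
    show "\<exists>D F. meromorphic_several r D F \<and> mzeta_region r \<subseteq> D \<and> (\<forall>s\<in>mzeta_region r. F s = mzeta_series r s) \<and> z \<in> D \<and> F z = mzeta_cont r z"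
      using meromorphic_mzeta_cont[OF r] reg series z by blast
    fix v assume "\<exists>D F. meromorphic_several r D F \<and> mzeta_region r \<subseteq> D \<and> (\<forall>s\<in>mzeta_region r. F s = mzeta_series r s) \<and> z \<in> D \<and> F z = v"
    then obtain D F where F: "meromorphic_several r D F" "mzeta_region r \<subseteq> D" "\<And>s. s \<in> mzeta_region r \<Longrightarrow> F s = mzeta_series r s" "z \<in> D" "F z = v"
      by blast
    have "F z = mzeta_cont r z"
    proof (rule meromorphic_several_unique[OF F(1) meromorphic_mzeta_cont[OF r], of "mzeta_region r"])
      show "openin (Cpow r) (mzeta_region r)" "mzeta_region r \<noteq> {}"
        unfolding mzeta_region_eq by (rule openin_shifted_region, rule shifted_region_nonempty)
    qed (use F reg series z in auto)
    then show "v = mzeta_cont r z" using F(5) by simp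
  qed
qed

section \<open>A non-positive integer as first argument\<close>

text \<open>Non-integrality of all tails is a cruder condition than membership in the domain, but it
  is unaffected by the integral shifts that occur below.\<close>

lemma mzeta_domain_all_sums:
  assumes "s \<in> Cspace r" "r \<ge> 1" "\<And>j. j \<in> {1..r} \<Longrightarrow> (\<Sum>i\<in>{j..r}. s i) \<notin> \<int>"
  shows "s \<in> mzeta_domain r"
proof -
  have "(\<Sum>i\<in>{j..r}. s i) - of_nat (r - j + 1) \<notin> \<int>\<^sub>\<le>\<^sub>0" if "j \<in> {1..<r}" for j
  proof
    assume "(\<Sum>i\<in>{j..r}. s i) - of_nat (r - j + 1) \<in> \<int>\<^sub>\<le>\<^sub>0"
    then have "(\<Sum>i\<in>{j..r}. s i) - of_nat (r - j + 1) + of_nat (r - j + 1) \<in> \<int>"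
      using nonpos_Ints_subset_Ints by (intro Ints_add) auto
    then show False using assms(3)[of j] that by simp
  qed
  moreover have "s r \<noteq> 1" using assms(3)[of r] assms(2) by auto
  ultimately show ?thesis using assms(1) unfolding mzeta_domain_def mzeta_phi_domain_def by blast
qed

lemma mzeta_domain_first_Int:
  assumes s: "s \<in> Cspace r" and r: "r \<ge> 2" and s1: "s 1 \<in> \<int>"
    and n: "\<And>j. j \<in> {2..r} \<Longrightarrow> (\<Sum>i\<in>{j..r}. s i) \<notin> \<int>"
  shows "s \<in> mzeta_domain r"
proof (rule mzeta_domain_all_sums[OF s])
  fix j assume j: "j \<in> {1..r}"
  show "(\<Sum>i\<in>{j..r}. s i) \<notin> \<int>"
  proof (cases "j = 1")
    case True
    have "(\<Sum>i\<in>{1..r}. s i) = s 1 + (\<Sum>i\<in>{2..r}. s i)"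
      using r by (simp add: sum.atLeast_Suc_atMost numeral_2_eq_2)
    moreover have "s 1 + (\<Sum>i\<in>{2..r}. s i) \<notin> \<int>"
      using n[of 2] r Ints_diff[OF _ s1, of "s 1 + (\<Sum>i\<in>{2..r}. s i)"] by auto
    ultimately show ?thesis using True by simp
  next
    case False then show ?thesis using j by (intro n) auto
  qed
qed (use r in simp)

text \<open>A factor n_2^m, coming from a power sum over n_1, is absorbed into the exponent of n_2,
  which becomes the first argument.\<close>

definition drop_first :: "nat \<Rightarrow> nat \<Rightarrow> (nat \<Rightarrow> complex) \<Rightarrow> nat \<Rightarrow> complex" where
  "drop_first r m s = (\<lambda>i\<in>{1..r}. if i = 1 then s 2 - of_nat m else s (Suc i))"

lemma drop_first_in_Cspace [simp]: "drop_first r m s \<in> Cspace r"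
  by (simp add: drop_first_def)

lemma sum_drop_first:
  assumes "j \<in> {1..r}"
  shows "(\<Sum>i\<in>{j..r}. drop_first r m s i) = (\<Sum>i\<in>{Suc j..Suc r}. s i) - (if j = 1 then of_nat m else 0)"
proof -
  have "(\<Sum>i\<in>{j..r}. drop_first r m s i) = (\<Sum>i\<in>{j..r}. s (Suc i) - (if i = 1 then of_nat m else 0))"
    using assms by (intro sum.cong) (auto simp: drop_first_def numeral_2_eq_2)
  also have "\<dots> = (\<Sum>i\<in>{j..r}. s (Suc i)) - (if j = 1 then of_nat m else 0)"
    using assms by (auto simp: sum_subtractf)
  also have "(\<Sum>i\<in>{j..r}. s (Suc i)) = (\<Sum>i\<in>{Suc j..Suc r}. s i)"
    by (rule sum.reindex_bij_witness[of _ "\<lambda>i. i - 1" Suc]) auto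
  finally show ?thesis .
qed

lemma drop_first_fun_upd:
  "r \<ge> 1 \<Longrightarrow> drop_first r m (s(Suc r := w)) = (drop_first r m s)(r := w - (if r = 1 then of_nat m else 0))"
  by (auto simp: drop_first_def fun_eq_iff restrict_def numeral_2_eq_2)

text \<open>The sum over n_1 is P(n_2), expanded in powers of n_2. The outer power is included in
  the statement because in the base case it is the factor that absorbs the shift by
  \<open>m\<close>.\<close>

lemma truncated_mzeta_drop_first:
  fixes P :: "complex poly"
  assumes P: "\<And>n. n \<ge> 1 \<Longrightarrow> poly P (of_nat n) = (\<Sum>m\<in>{1..<n}. of_nat m ^ l)"
    and s1: "s 1 = - of_nat l" and n: "n \<ge> 1" and j: "j < r"
  shows "of_nat n powr (- s (Suc (Suc j))) * truncated_mzeta s (Suc j) n =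
     (\<Sum>m\<le>degree P. coeff P m * (of_nat n powr (- drop_first r m s (Suc j)) * truncated_mzeta (drop_first r m s) j n))"
  using n j
proof (induction j arbitrary: n)
  case 0
  have "truncated_mzeta s (Suc 0) n = (\<Sum>m\<in>{1..<n}. of_nat m ^ l)"
    using s1 by (simp add: powr_nat)
  also have "\<dots> = (\<Sum>m\<le>degree P. coeff P m * of_nat n ^ m)"
    using P[OF 0(1)] by (simp add: poly_altdef)
  finally have split: "of_nat n powr (- s (Suc (Suc 0))) * truncated_mzeta s (Suc 0) n
      = (\<Sum>m\<le>degree P. coeff P m * (of_nat n powr (- s 2) * of_nat n ^ m))"
    by (simp add: sum_distrib_left mult_ac numeral_2_eq_2)
  have "of_nat n powr (- s 2) * of_nat n ^ m = of_nat n powr (- drop_first r m s (Suc 0)) * truncated_mzeta (drop_first r m s) 0 n" for m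
  proof -
    have "of_nat n powr (- s 2) * of_nat n ^ m = of_nat n powr (- s 2) * of_nat n powr (of_nat m :: complex)"
      using 0 by (simp add: powr_nat)
    also have "\<dots> = of_nat n powr (- s 2 + of_nat m)" by (rule powr_add[symmetric])
    finally show ?thesis using 0 by (simp add: drop_first_def algebra_simps)
  qed
  then show ?case unfolding split by simp
next
  case (Suc j)
  have "truncated_mzeta s (Suc (Suc j)) n =
     (\<Sum>k\<in>{1..<n}. \<Sum>m\<le>degree P. coeff P m * (of_nat k powr (- drop_first r m s (Suc j)) * truncated_mzeta (drop_first r m s) j k))"
    unfolding truncated_mzeta.simps(2)[of s "Suc j"]
    by (rule sum.cong[OF refl], rule Suc.IH) (use Suc.prems in auto)
  also have "\<dots> = (\<Sum>m\<le>degree P. coeff P m * truncated_mzeta (drop_first r m s) (Suc j) n)"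
    by (subst sum.swap) (simp add: sum_distrib_left)
  finally have "of_nat n powr (- s (Suc (Suc (Suc j)))) * truncated_mzeta s (Suc (Suc j)) n =
     (\<Sum>m\<le>degree P. coeff P m * (of_nat n powr (- s (Suc (Suc (Suc j)))) * truncated_mzeta (drop_first r m s) (Suc j) n))"
    by (simp only: sum_distrib_left mult_ac)
  moreover have "drop_first r m s (Suc (Suc j)) = s (Suc (Suc (Suc j)))" for m
    using Suc.prems by (simp add: drop_first_def)
  ultimately show ?case by simp
qed

lemma mzeta_sum_drop_first:
  fixes P :: "complex poly"
  assumes P: "\<And>n. n \<ge> 1 \<Longrightarrow> poly P (of_nat n) = (\<Sum>m\<in>{1..<n}. of_nat m ^ l)"
    and s1: "s 1 = - of_nat l"
    and drop: "\<And>m. m \<le> degree P \<Longrightarrow> drop_first (Suc r) m s \<in> shifted_region (Suc r) 0"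
  shows "mzeta_sum (Suc (Suc r)) s = (\<Sum>m\<le>degree P. coeff P m * mzeta_sum (Suc r) (drop_first (Suc r) m s))"
proof -
  let ?t = "\<lambda>m n. of_nat (Suc n) powr (- drop_first (Suc r) m s (Suc r)) * truncated_mzeta (drop_first (Suc r) m s) r (Suc n)"
  have "(\<lambda>n. \<Sum>m\<le>degree P. coeff P m * ?t m n) sums (\<Sum>m\<le>degree P. coeff P m * mzeta_sum (Suc r) (drop_first (Suc r) m s))"
    unfolding mzeta_sum_def diff_Suc_1
    by (intro sums_sum sums_mult summable_sums summable_norm_cancel[OF mzeta_sum_abs_summable] drop) auto
  moreover have "(\<Sum>m\<le>degree P. coeff P m * ?t m n) = of_nat (Suc n) powr (- s (Suc (Suc r))) * truncated_mzeta s (Suc r) (Suc n)" for n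
    by (rule truncated_mzeta_drop_first[where P = P and l = l and s = s, symmetric]) (use P s1 in auto)
  ultimately show ?thesis unfolding mzeta_sum_def[of "Suc (Suc r)"] diff_Suc_1 by (simp only: sums_iff)
qed

lemma holomorphic_mzeta_cont: "r \<ge> 1 \<Longrightarrow> holomorphic_several r (mzeta_cont r) (mzeta_domain r)"
  using meromorphic_mzeta_cont unfolding meromorphic_several_def by blast

text \<open>Both sides are holomorphic in the last variable off a countable closed set, and for large
  real part they are the absolutely convergent series.\<close>

lemma mzeta_cont_drop_first:
  fixes P :: "complex poly"
  assumes P: "\<And>n. n \<ge> 1 \<Longrightarrow> poly P (of_nat n) = (\<Sum>m\<in>{1..<n}. of_nat m ^ l)"
    and r: "r \<ge> 1" and s: "s \<in> Cspace (Suc r)" and s1: "s 1 = - of_nat l"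
    and gen: "\<And>j. j \<in> {2..Suc r} \<Longrightarrow> (\<Sum>i\<in>{j..Suc r}. s i) \<notin> \<int>"
  shows "mzeta_cont (Suc r) s = (\<Sum>m\<le>degree P. coeff P m * mzeta_cont r (drop_first r m s))"
proof -
  define S where "S j = (\<Sum>i\<in>{j..<Suc r}. s i)" for j
  \<comment> \<open>The values of the last coordinate for which all tails from the second on are
    non-integral. The complement is countable and closed, so this set is open and connected.\<close>
  define \<Omega> where "\<Omega> = {w. \<forall>j\<in>{2..Suc r}. S j + w \<notin> \<int>}"
  let ?u = "\<lambda>w. s(Suc r := w)"
  have sum_u: "(\<Sum>i\<in>{j..Suc r}. ?u w i) = S j + w" if "j \<in> {1..Suc r}" for j w
  proof -
    have "{j..Suc r} = insert (Suc r) {j..<Suc r}" using that by auto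
    then show ?thesis by (simp add: S_def add.commute)
  qed
  have uC: "?u w \<in> Cspace (Suc r)" for w using s by (rule fun_upd_in_Cspace) simp
  have u1: "?u w 1 = - of_nat l" for w using s1 r by simp
  have u_dom: "?u w \<in> mzeta_domain (Suc r)" if "w \<in> \<Omega>" for w
  proof (rule mzeta_domain_first_Int[OF uC])
    show "?u w 1 \<in> \<int>" unfolding u1 by simp
    show "(\<Sum>i\<in>{j..Suc r}. ?u w i) \<notin> \<int>" if "j \<in> {2..Suc r}" for j
      using that \<open>w \<in> \<Omega>\<close> by (subst sum_u) (auto simp: \<Omega>_def)
  qed (use r in simp)
  have drop_dom: "drop_first r m (?u w) \<in> mzeta_domain r" if "w \<in> \<Omega>" for w m
  proof (rule mzeta_domain_all_sums[OF drop_first_in_Cspace r])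
    fix j assume j: "j \<in> {1..r}"
    have "(\<Sum>i\<in>{j..r}. drop_first r m (?u w) i) = S (Suc j) + w - (if j = 1 then of_nat m else 0)"
      unfolding sum_drop_first[OF j] using j by (subst sum_u) auto
    moreover have "S (Suc j) + w - (if j = 1 then of_nat m else 0) \<notin> \<int>"
    proof
      assume "S (Suc j) + w - (if j = 1 then of_nat m else 0) \<in> \<int>"
      then have "S (Suc j) + w - (if j = 1 then of_nat m else 0) + (if j = 1 then of_nat m else 0) \<in> \<int>"
        by (rule Ints_add) auto
      moreover have "Suc j \<in> {2..Suc r}" using j by auto
      ultimately show False using \<open>w \<in> \<Omega>\<close> by (auto simp: \<Omega>_def)
    qed
    ultimately show "(\<Sum>i\<in>{j..r}. drop_first r m (?u w) i) \<notin> \<int>" by simp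
  qed
  define Z where "Z = (\<Union>j\<in>{2..Suc r}. (\<lambda>z. z - S j) ` \<int>)"
  have countZ: "countable Z" unfolding Z_def Ints_def by (intro countable_UN countable_image) auto
  have compl: "\<Omega> = - Z"
  proof -
    have "w \<in> (\<lambda>z. z - S j) ` \<int> \<longleftrightarrow> S j + w \<in> \<int>" for w j
      by (auto simp: image_iff algebra_simps intro!: bexI[of _ "S j + w"])
    then show ?thesis unfolding \<Omega>_def Z_def by auto
  qed
  have conn: "connected \<Omega>"
    unfolding compl using countZ by (intro path_connected_imp_connected path_connected_complement_countable) auto
  have opn: "open \<Omega>"
  proof -
    have "open (\<Inter>j\<in>{2..Suc r}. (\<lambda>w. S j + w) -` (- \<int>))"
      by (intro open_INT ballI open_vimage open_Compl closed_Ints continuous_intros) auto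
    moreover have "(\<Inter>j\<in>{2..Suc r}. (\<lambda>w. S j + w) -` (- \<int>)) = \<Omega>" by (auto simp: \<Omega>_def)
    ultimately show ?thesis by simp
  qed
  define f where "f w = mzeta_cont (Suc r) (?u w)" for w
  define g where "g w = (\<Sum>m\<le>degree P. coeff P m * mzeta_cont r (drop_first r m (?u w)))" for w
  have f_hol: "f holomorphic_on \<Omega>" unfolding f_def
    by (rule holomorphic_on_subset[OF holomorphic_several_slice[OF holomorphic_mzeta_cont s]]) (use u_dom in auto)
  have g_hol: "g holomorphic_on \<Omega>" unfolding g_def
  proof (intro holomorphic_on_sum holomorphic_on_mult holomorphic_on_const)
    fix m
    \<comment> \<open>In depth 1 the remaining coordinate is first and last at once, so the shift by
      \<open>m\<close> acts on the moving variable.\<close>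
    define c :: complex where "c = (if r = 1 then of_nat m else 0)"
    let ?d = "drop_first r m s"
    have eq: "drop_first r m (?u w) = ?d(r := w - c)" for w
      using drop_first_fun_upd[OF r] by (simp add: c_def)
    have "(\<lambda>v. mzeta_cont r (?d(r := v))) holomorphic_on {v. ?d(r := v) \<in> mzeta_domain r}"
      by (rule holomorphic_several_slice[OF holomorphic_mzeta_cont[OF r] drop_first_in_Cspace]) (use r in simp)
    moreover have "(\<lambda>w. w - c) ` \<Omega> \<subseteq> {v. ?d(r := v) \<in> mzeta_domain r}"
      using drop_dom[of _ m] by (auto simp: eq)
    ultimately have "(\<lambda>v. mzeta_cont r (?d(r := v))) \<circ> (\<lambda>w. w - c) holomorphic_on \<Omega>"
      by (intro holomorphic_on_compose_gen[where t = "{v. ?d(r := v) \<in> mzeta_domain r}"] holomorphic_intros)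
    then show "(\<lambda>w. mzeta_cont r (drop_first r m (?u w))) holomorphic_on \<Omega>"
      unfolding eq by (simp add: o_def)
  qed
  \<comment> \<open>Beyond \<open>B\<close> all tail sums have real part greater than r + 1 + degree
    P, so they stay in the region of convergence even after the first argument is lowered by some m
    up to the degree.\<close>
  define B where "B = real (Suc r) + real (degree P) + (\<Sum>i\<in>{1..<Suc r}. \<bar>Re (s i)\<bar>)"
  have Re_large: "Re (S j + w) > real (Suc r) + real (degree P)" if "Re w > B" "j \<ge> 1" for w j
  proof -
    have "(\<Sum>i\<in>{j..<Suc r}. - Re (s i)) \<le> (\<Sum>i\<in>{j..<Suc r}. \<bar>Re (s i)\<bar>)" by (intro sum_mono) auto
    also have "\<dots> \<le> (\<Sum>i\<in>{1..<Suc r}. \<bar>Re (s i)\<bar>)" using that by (intro sum_mono2) auto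
    finally have "- Re (S j) \<le> (\<Sum>i\<in>{1..<Suc r}. \<bar>Re (s i)\<bar>)" by (simp add: S_def sum_negf del: sum.op_ivl_Suc)
    then show ?thesis using that unfolding B_def by simp
  qed
  define \<Omega>' where "\<Omega>' = \<Omega> \<inter> {w. Re w > B}"
  obtain q where q: "r = Suc q" using r by (cases r) auto
  have agree: "f w = g w" if "w \<in> \<Omega>'" for w
  proof -
    have w: "Re w > B" using that by (simp add: \<Omega>'_def)
    have u_reg: "?u w \<in> shifted_region (Suc r) 0"
      unfolding shifted_region_def
    proof (intro CollectI conjI ballI uC)
      fix j assume j: "j \<in> {1..Suc r}"
      have "real (Suc r - j + 1) \<le> real (Suc r)" using j by auto
      then show "real (Suc r - j + 1) < Re (\<Sum>i\<in>{j..Suc r}. ?u w i) + real 0"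
        unfolding sum_u[OF j] using Re_large[OF w, of j] j by simp
    qed
    have d_reg: "drop_first r m (?u w) \<in> shifted_region r 0" if m: "m \<le> degree P" for m
      unfolding shifted_region_def
    proof (intro CollectI conjI ballI drop_first_in_Cspace)
      fix j assume j: "j \<in> {1..r}"
      have j': "Suc j \<in> {1..Suc r}" using j by auto
      have "real (r - j + 1) \<le> real (Suc r)" using j by auto
      moreover have "Re (if j = 1 then of_nat m else 0 :: complex) \<le> real (degree P)" using m by auto
      moreover have "Re (S (Suc j) + w) > real (Suc r) + real (degree P)" using w by (rule Re_large) simp
      ultimately show "real (r - j + 1) < Re (\<Sum>i\<in>{j..r}. drop_first r m (?u w) i) + real 0"
        unfolding sum_drop_first[OF j] sum_u[OF j'] minus_complex.sel
        by linarith
    qed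
    have "f w = mzeta_sum (Suc r) (?u w)" unfolding f_def by (rule mzeta_cont_eq_sum_Suc[OF u_reg])
    also have "\<dots> = (\<Sum>m\<le>degree P. coeff P m * mzeta_sum r (drop_first r m (?u w)))"
      unfolding q by (rule mzeta_sum_drop_first[OF P]) (use u1[of w] d_reg q in auto)
    also have "\<dots> = g w" unfolding g_def
      using mzeta_cont_eq_sum_Suc d_reg unfolding q by (intro sum.cong) (auto simp del: mzeta_cont.simps)
    finally show ?thesis .
  qed
  have "\<not> {w. Re w > B} \<subseteq> Z" using uncountable_halfspace_Re_gt[of B] countZ countable_subset by blast
  then have "\<Omega>' \<noteq> {}" unfolding \<Omega>'_def compl by blast
  moreover have "open \<Omega>'" unfolding \<Omega>'_def by (intro open_Int opn open_halfspace_Re_gt)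
  moreover have "s (Suc r) \<in> \<Omega>"
    unfolding \<Omega>_def using gen sum_u[of _ "s (Suc r)"] by auto
  ultimately have "f (s (Suc r)) = g (s (Suc r))"
    using analytic_continuation_open[OF _ opn _ conn _ f_hol g_hol agree, of \<Omega>'] unfolding \<Omega>'_def by blast
  then show ?thesis by (simp add: f_def g_def)
qed

section \<open>Stirling polynomials\<close>

lemma falling_factorial_0 [simp]: "falling_factorial x 0 = 1"
  and falling_factorial_Suc: "falling_factorial x (Suc m) = falling_factorial x m * (x - of_nat m)"
  by (simp_all add: falling_factorial_def)

text \<open>Rests on (X + Y)(X)_m = (X)_(m+1) + (Y + m)(X)_m. In a general ring the recursion serves
  both the formal identity in Z[Y][X] and its evaluations, without a substitution
  homomorphism.\<close>

lemma stirling_expansion: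
  fixes x y :: "'a::comm_ring_1" and c :: "nat \<Rightarrow> nat \<Rightarrow> 'a"
  assumes c0: "c 0 0 = 1" and c_gt: "\<And>n m. n < m \<Longrightarrow> c n m = 0"
    and cS0: "\<And>n. c (Suc n) 0 = y * c n 0"
    and cSS: "\<And>n m. c (Suc n) (Suc m) = c n m + (y + of_nat (Suc m)) * c n (Suc m)"
  shows "(x + y) ^ n = (\<Sum>m\<le>n. c n m * falling_factorial x m)"
proof (induction n)
  case (Suc n)
  let ?f = "falling_factorial x"
  have "(x + y) ^ Suc n = (\<Sum>m\<le>n. c n m * ((x + y) * ?f m))"
    by (simp add: Suc.IH sum_distrib_left mult_ac)
  also have "\<dots> = (\<Sum>m\<le>n. c n m * ?f (Suc m)) + (\<Sum>m\<le>n. (y + of_nat m) * c n m * ?f m)"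
    unfolding sum.distrib[symmetric] falling_factorial_Suc by (rule sum.cong) (simp_all add: algebra_simps)
  also have "(\<Sum>m\<le>n. (y + of_nat m) * c n m * ?f m) = (\<Sum>m\<le>Suc n. (y + of_nat m) * c n m * ?f m)"
    using c_gt[of n "Suc n"] by simp
  also have "\<dots> = y * c n 0 + (\<Sum>m\<le>n. (y + of_nat (Suc m)) * c n (Suc m) * ?f (Suc m))"
    by (subst sum.atMost_Suc_shift) simp
  also have "(\<Sum>m\<le>n. c n m * ?f (Suc m)) + \<dots> = y * c n 0 + (\<Sum>m\<le>n. c (Suc n) (Suc m) * ?f (Suc m))"
    by (simp only: cSS distrib_right sum.distrib) simp
  also have "\<dots> = (\<Sum>m\<le>Suc n. c (Suc n) m * ?f m)"
    unfolding sum.atMost_Suc_shift[of "\<lambda>m. c (Suc n) m * ?f m"] by (simp add: cS0)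
  finally show ?case .
qed (simp add: c0)

fun stirling2_rec :: "nat \<Rightarrow> nat \<Rightarrow> int poly" where
  "stirling2_rec 0 m = (if m = 0 then 1 else 0)"
| "stirling2_rec (Suc n) 0 = [:0, 1:] * stirling2_rec n 0"
| "stirling2_rec (Suc n) (Suc m) = stirling2_rec n m + ([:0, 1:] + of_nat (Suc m)) * stirling2_rec n (Suc m)"

lemma stirling2_rec_eq_0: "n < m \<Longrightarrow> stirling2_rec n m = 0"
  by (induction n m rule: stirling2_rec.induct) auto

lemma falling_factorial_X:
  "falling_factorial [:0, 1 :: 'a::idom:] m \<noteq> 0 \<and> degree (falling_factorial [:0, 1 :: 'a::idom:] m) = m \<and> lead_coeff (falling_factorial [:0, 1 :: 'a:] m) = 1"
proof (induction m)
  case (Suc m)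
  define q where "q = [:- of_nat m, 1 :: 'a:]"
  have "falling_factorial [:0, 1:] (Suc m) = falling_factorial [:0, 1 :: 'a:] m * q"
    by (simp only: falling_factorial_Suc q_def of_nat_poly) simp
  moreover have "q \<noteq> 0" "degree q = 1" "lead_coeff q = 1" by (simp_all add: q_def)
  moreover have "falling_factorial [:0, 1 :: 'a:] m \<noteq> 0" "degree (falling_factorial [:0, 1 :: 'a:] m) = m"
    "coeff (falling_factorial [:0, 1 :: 'a:] m) m = 1"
    using Suc by auto
  ultimately show ?case using coeff_mult_degree_sum[of "falling_factorial [:0, 1 :: 'a:] m" q]
    by (simp add: degree_mult_eq)
qed auto

text \<open>The falling factorials are monic of degree \<open>m\<close>, so the top coefficient
  isolates the last summand. This is the uniqueness half of the description of
  \<open>stirling2_poly\<close>.\<close>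

lemma falling_factorial_X_independent:
  fixes c :: "nat \<Rightarrow> 'a::idom"
  assumes "(\<Sum>m\<le>n. smult (c m) (falling_factorial [:0, 1:] m)) = 0"
  shows "\<forall>m\<le>n. c m = 0"
  using assms
proof (induction n)
  case (Suc n)
  have "coeff (\<Sum>m\<le>Suc n. smult (c m) (falling_factorial [:0, 1:] m)) (Suc n)
      = (\<Sum>m\<le>Suc n. c m * coeff (falling_factorial [:0, 1:] m) (Suc n))" by (simp add: coeff_sum)
  also have "\<dots> = (\<Sum>m\<le>Suc n. if m = Suc n then c m else 0)"
  proof (rule sum.cong[OF refl])
    fix m assume "m \<in> {..Suc n}"
    then show "c m * coeff (falling_factorial [:0, 1:] m) (Suc n) = (if m = Suc n then c m else 0)"
      using falling_factorial_X[of m, where 'a = 'a] by (cases "m = Suc n") (auto simp: coeff_eq_0)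
  qed
  finally have "c (Suc n) = 0" unfolding Suc.prems by simp
  with Suc show ?case by (auto simp: le_Suc_eq)
qed auto

lemma stirling2_poly_eq_rec: "stirling2_poly = stirling2_rec"
  unfolding stirling2_poly_def
proof (rule the_equality)
  have "([:0, 1:] + [:[:0, 1:]:]) ^ n
            = (\<Sum>m\<le>n. smult (stirling2_rec n m) (falling_factorial [:0, 1:] m))" for n
    using stirling_expansion[of "\<lambda>n m. [:stirling2_rec n m:]" "[:[:0, 1:]:]" "[:0, 1:]" n]
    by (simp add: stirling2_rec_eq_0 of_nat_poly one_pCons add_ac)
  then show *: "(\<forall>n. ([:0, 1:] + [:[:0, 1:]:]) ^ n
            = (\<Sum>m\<le>n. smult (stirling2_rec n m) (falling_factorial [:0, 1:] m))) \<and>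
     (\<forall>n m. n < m \<longrightarrow> stirling2_rec n m = 0)" by (auto simp: stirling2_rec_eq_0)
  fix S :: "nat \<Rightarrow> nat \<Rightarrow> int poly"
  assume S: "(\<forall>n. ([:0, 1:] + [:[:0, 1:]:]) ^ n
            = (\<Sum>m\<le>n. smult (S n m) (falling_factorial [:0, 1:] m))) \<and>
     (\<forall>n m. n < m \<longrightarrow> S n m = 0)"
  show "S = stirling2_rec"
  proof (intro ext)
    fix n m
    have "(\<Sum>m\<le>n. smult (S n m - stirling2_rec n m) (falling_factorial [:0, 1:] m)) = 0"
      using S * by (simp add: smult_diff_left sum_subtractf)
    from falling_factorial_X_independent[OF this] show "S n m = stirling2_rec n m"
      using S stirling2_rec_eq_0[of n m] by (cases "m \<le> n") auto
  qed
qed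

lemma stirling2_poly_expansion:
  fixes x :: "'a::comm_ring_1"
  shows "(x + of_nat y) ^ n = (\<Sum>m\<le>n. of_int (poly (stirling2_poly n m) (int y)) * falling_factorial x m)"
  unfolding stirling2_poly_eq_rec
  by (rule stirling_expansion) (auto simp: stirling2_rec_eq_0 algebra_simps)

text \<open>The difference N - a is formed in the field. Each induction step is the absorption
  identity; for N < a + k both binomial coefficients involved vanish.\<close>

lemma binomial_times_falling_factorial:
  "of_nat (N choose a) * falling_factorial (of_nat N - of_nat a) k
     = (fact (a + k) / fact a * of_nat (N choose (a + k)) :: 'a::field_char_0)"
proof (induction k)
  case (Suc k)
  have "of_nat (N choose (a + k)) * (of_nat N - of_nat a - of_nat k :: 'a) = of_nat (Suc (a + k)) * of_nat (N choose Suc (a + k))"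
  proof (cases "a + k \<le> N")
    case True
    have "Suc (a + k) * (N choose Suc (a + k)) = (N - (a + k)) * (N choose (a + k))"
      using binomial_absorb_comp[of N "a + k"] binomial_absorption[of "a + k" N] True
      by (cases "N = 0") (auto simp: binomial_absorption)
    then have "of_nat (Suc (a + k)) * of_nat (N choose Suc (a + k)) = (of_nat (N - (a + k)) * of_nat (N choose (a + k)) :: 'a)"
      by (metis of_nat_mult)
    then show ?thesis using True by (simp add: of_nat_diff algebra_simps)
  next
    case False then show ?thesis by (simp add: binomial_eq_0)
  qed
  then show ?case
    by (simp add: falling_factorial_Suc mult.assoc[symmetric] Suc.IH)
qed simp

text \<open>Expand n^l with X = n - 1 - a and Y = a + 1; the falling factorials of X then merge with
  binomial(n - 1, a).\<close>

lemma power_times_binomial: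
  fixes n :: nat
  assumes "n \<ge> 1"
  shows "of_nat n ^ l * (of_nat ((n - 1) choose a) :: 'a::field_char_0) =
    (\<Sum>k\<le>l. of_int (poly (stirling2_poly l k) (int (Suc a))) * (fact (a + k) / fact a) * of_nat ((n - 1) choose (a + k)))"
proof -
  have "(of_nat n :: 'a) = (of_nat (n - 1) - of_nat a) + of_nat (Suc a)" using assms by (simp add: of_nat_diff)
  then have "(of_nat n :: 'a) ^ l = (\<Sum>k\<le>l. of_int (poly (stirling2_poly l k) (int (Suc a))) * falling_factorial (of_nat (n - 1) - of_nat a) k)"
    using stirling2_poly_expansion[of "of_nat (n - 1) - of_nat a :: 'a" "Suc a" l] by simp
  then have "of_nat n ^ l * (of_nat ((n - 1) choose a) :: 'a) =
     (\<Sum>k\<le>l. of_int (poly (stirling2_poly l k) (int (Suc a))) * falling_factorial (of_nat (n - 1) - of_nat a) k) * of_nat ((n - 1) choose a)"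
    by (rule arg_cong)
  also have "\<dots> = (\<Sum>k\<le>l. of_int (poly (stirling2_poly l k) (int (Suc a))) * (of_nat ((n - 1) choose a) * falling_factorial (of_nat (n - 1) - of_nat a) k))"
    unfolding sum_distrib_right by (simp only: mult_ac)
  finally show ?thesis by (simp only: binomial_times_falling_factorial mult.assoc)
qed

text \<open>The hockey-stick identity; each summation raises the lower index by one.\<close>

lemma sum_binomial_pred: "(\<Sum>m\<in>{1..<n}. (m - 1) choose a) = (n - 1) choose Suc a"
proof (induction n)
  case (Suc n) then show ?case by (cases n) auto
qed auto

definition stirling_weight :: "nat \<Rightarrow> (nat \<Rightarrow> nat) \<Rightarrow> (nat \<Rightarrow> nat) \<Rightarrow> complex" where
  "stirling_weight r l k = (\<Prod>j=1..r. of_int (poly (stirling2_poly (l j) (k j)) (int (psum k (j - 1) + j)))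
                  * (fact (psum k j + j - 1) / fact (psum k (j - 1) + j - 1)))"

lemma psum_upd [simp]: "j < i \<Longrightarrow> psum (k(i := x)) j = psum k j"
  unfolding psum_def by (rule sum.cong) auto

lemma psum_Suc: "psum k (Suc j) = psum k j + k (Suc j)"
  by (simp add: psum_def)

lemma stirling_weight_Suc:
  "stirling_weight (Suc j) l (k(Suc j := x)) = stirling_weight j l k *
     (of_int (poly (stirling2_poly (l (Suc j)) x) (int (Suc (j + psum k j)))) * (fact (j + psum k j + x) / fact (j + psum k j)))"
proof -
  have "(\<Prod>i=1..j. of_int (poly (stirling2_poly (l i) ((k(Suc j := x)) i)) (int (psum (k(Suc j := x)) (i - 1) + i)))
                  * (fact (psum (k(Suc j := x)) i + i - 1) / fact (psum (k(Suc j := x)) (i - 1) + i - 1))) = stirling_weight j l k"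
    unfolding stirling_weight_def by (rule prod.cong) auto
  then show ?thesis unfolding stirling_weight_def[of "Suc j"]
    by (simp add: psum_Suc add_ac)
qed

lemma sum_PiE_Suc:
  "(\<Sum>k\<in>PiE {1..Suc j} A. f k) = (\<Sum>k\<in>PiE {1..j} A. \<Sum>x\<in>A (Suc j). f (k(Suc j := x)))"
proof -
  have "{1..Suc j} = insert (Suc j) {1..j}" by auto
  then have "(\<Sum>k\<in>PiE {1..Suc j} A. f k) = (\<Sum>k\<in>(\<lambda>(y, g). g(Suc j := y)) ` (A (Suc j) \<times> PiE {1..j} A). f k)"
    by (metis PiE_insert_eq)
  also have "\<dots> = (\<Sum>(x, k)\<in>A (Suc j) \<times> PiE {1..j} A. f (k(Suc j := x)))"
    by (subst sum.reindex) (auto intro!: inj_combinator sum.cong)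
  also have "\<dots> = (\<Sum>x\<in>A (Suc j). \<Sum>k\<in>PiE {1..j} A. f (k(Suc j := x)))"
    by (rule sum.cartesian_product[symmetric])
  also have "\<dots> = (\<Sum>k\<in>PiE {1..j} A. \<Sum>x\<in>A (Suc j). f (k(Suc j := x)))"
    by (rule sum.swap)
  finally show ?thesis .
qed

text \<open>After \<open>j\<close> rounds the lower index is j + K_j, so the next Stirling
  polynomial is taken at K_j + j + 1. The step stands apart from the summation because the last
  power, that of n_r, is multiplied in but not summed.\<close>

lemma power_times_stirling_sum:
  assumes n: "n \<ge> 1"
    and t: "t = (\<Sum>k\<in>(\<Pi>\<^sub>E i\<in>{1..j}. {0..l i}). stirling_weight j l k * of_nat ((n - 1) choose (j + psum k j)))"
  shows "of_nat n ^ l (Suc j) * t =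
    (\<Sum>k\<in>(\<Pi>\<^sub>E i\<in>{1..Suc j}. {0..l i}). stirling_weight (Suc j) l k * of_nat ((n - 1) choose (j + psum k (Suc j))))"
proof -
  have "of_nat n ^ l (Suc j) * t = (\<Sum>k\<in>(\<Pi>\<^sub>E i\<in>{1..j}. {0..l i}).
     stirling_weight j l k * (of_nat n ^ l (Suc j) * of_nat ((n - 1) choose (j + psum k j))))"
    unfolding t by (simp add: sum_distrib_left mult_ac)
  also have "\<dots> = (\<Sum>k\<in>(\<Pi>\<^sub>E i\<in>{1..j}. {0..l i}). \<Sum>x\<in>{0..l (Suc j)}.
       stirling_weight (Suc j) l (k(Suc j := x)) * of_nat ((n - 1) choose (j + psum (k(Suc j := x)) (Suc j))))"
    unfolding power_times_binomial[OF n] sum_distrib_left stirling_weight_Suc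
    by (intro sum.cong) (auto simp: psum_Suc mult_ac add_ac)
  finally show ?thesis by (simp only: sum_PiE_Suc)
qed

lemma truncated_mzeta_nonpos_Ints:
  assumes n: "n \<ge> 1"
  shows "truncated_mzeta (\<lambda>i. - of_nat (l i)) j n =
    (\<Sum>k\<in>(\<Pi>\<^sub>E i\<in>{1..j}. {0..l i}). stirling_weight j l k * of_nat ((n - 1) choose (j + psum k j)))"
  using n
proof (induction j arbitrary: n)
  case 0 then show ?case by (simp add: stirling_weight_def psum_def)
next
  case (Suc j)
  have "truncated_mzeta (\<lambda>i. - of_nat (l i)) (Suc j) n =
     (\<Sum>m\<in>{1..<n}. of_nat m ^ l (Suc j) * truncated_mzeta (\<lambda>i. - of_nat (l i)) j m)"
    by (simp add: powr_nat)
  also have "\<dots> = (\<Sum>m\<in>{1..<n}. \<Sum>k\<in>(\<Pi>\<^sub>E i\<in>{1..Suc j}. {0..l i}). stirling_weight (Suc j) l k * of_nat ((m - 1) choose (j + psum k (Suc j))))"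
    by (intro sum.cong refl power_times_stirling_sum Suc.IH) auto
  also have "\<dots> = (\<Sum>k\<in>(\<Pi>\<^sub>E i\<in>{1..Suc j}. {0..l i}). stirling_weight (Suc j) l k * of_nat (\<Sum>m\<in>{1..<n}. (m - 1) choose (j + psum k (Suc j))))"
    by (subst sum.swap) (simp add: sum_distrib_left)
  finally show ?case by (simp only: sum_binomial_pred) simp
qed

lemma truncated_mzeta_zeros:
  "n \<ge> 1 \<Longrightarrow> truncated_mzeta (\<lambda>_. 0) j n = of_nat ((n - 1) choose j)"
proof (induction j arbitrary: n)
  case (Suc j)
  have "truncated_mzeta (\<lambda>_. 0) (Suc j) n = (\<Sum>m\<in>{1..<n}. of_nat ((m - 1) choose j))"
    using Suc.IH by simp
  also have "\<dots> = of_nat (\<Sum>m\<in>{1..<n}. (m - 1) choose j)" by simp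
  finally show ?case by (simp only: sum_binomial_pred)
qed simp

section \<open>Iterated limits\<close>

definition poly_functional :: "(nat \<Rightarrow> complex) \<Rightarrow> complex poly \<Rightarrow> complex" where
  "poly_functional \<phi> p = (\<Sum>m\<le>degree p. coeff p m * \<phi> m)"

lemma poly_functional_eq:
  assumes "degree p \<le> N"
  shows "poly_functional \<phi> p = (\<Sum>m\<le>N. coeff p m * \<phi> m)"
  unfolding poly_functional_def
  by (rule sum.mono_neutral_left) (use assms in \<open>auto simp: coeff_eq_0\<close>)

lemma poly_functional_add: "poly_functional \<phi> (p + q) = poly_functional \<phi> p + poly_functional \<phi> q"
proof -
  let ?N = "max (degree p) (degree q)"
  have "poly_functional \<phi> (p + q) = (\<Sum>m\<le>?N. coeff (p + q) m * \<phi> m)"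
    by (rule poly_functional_eq) (rule degree_add_le_max)
  then show ?thesis
    by (simp add: poly_functional_eq[of p ?N] poly_functional_eq[of q ?N] distrib_right sum.distrib)
qed

lemma poly_functional_smult: "poly_functional \<phi> (smult c p) = c * poly_functional \<phi> p"
  by (simp add: poly_functional_eq[OF degree_smult_le] poly_functional_def sum_distrib_left mult_ac)

lemma poly_functional_sum:
  "poly_functional \<phi> (\<Sum>x\<in>A. smult (c x) (p x)) = (\<Sum>x\<in>A. c x * poly_functional \<phi> (p x))"
proof (induction A rule: infinite_finite_induct)
  case (insert x A)
  then show ?case by (simp add: poly_functional_add poly_functional_smult)
qed (simp_all add: poly_functional_def)

lemma poly_functional_monom_mult:
  "poly_functional \<phi> (monom 1 l * p) = poly_functional (\<lambda>m. \<phi> (l + m)) p"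
proof -
  have "poly_functional \<phi> (monom 1 l * p) = (\<Sum>m\<le>l + degree p. coeff (monom 1 l * p) m * \<phi> m)"
    by (rule poly_functional_eq) (metis degree_monom_eq degree_mult_le one_neq_zero)
  also have "\<dots> = (\<Sum>m\<in>{l..l + degree p}. coeff p (m - l) * \<phi> m)"
    by (rule sum.mono_neutral_cong_right) (auto simp: coeff_monom_mult)
  also have "\<dots> = (\<Sum>m\<le>degree p. coeff p m * \<phi> (l + m))"
    by (rule sum.reindex_bij_witness[of _ "\<lambda>m. l + m" "\<lambda>m. m - l"]) auto
  finally show ?thesis by (simp add: poly_functional_def)
qed

lemma poly_eqI_of_nat:
  fixes p q :: "complex poly"
  assumes "\<And>n. n \<ge> 1 \<Longrightarrow> poly p (of_nat n) = poly q (of_nat n)"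
  shows "p = q"
proof (rule ccontr)
  assume "p \<noteq> q"
  then have "finite {x. poly (p - q) x = 0}" by (intro poly_roots_finite) simp
  moreover have "of_nat ` {1..} \<subseteq> {x. poly (p - q) x = 0}" using assms by auto
  ultimately have "finite (of_nat ` {1::nat..} :: complex set)" by (rule finite_subset[rotated])
  then have "finite {1::nat..}" by (rule finite_imageD) (simp add: inj_on_def)
  then show False using infinite_Ici by blast
qed

lemma binomial_poly_exists:
  "\<exists>p :: complex poly. \<forall>n\<ge>1. poly p (of_nat n) = of_nat ((n - 1) choose a)"
proof -
  define p where "p = smult (1 / fact a) (\<Prod>i<a. [:- 1 - of_nat i, 1 :: complex:])"
  have "poly p (of_nat n) = of_nat ((n - 1) choose a)" if "n \<ge> 1" for n
  proof -
    have "poly p (of_nat n) = falling_factorial (of_nat (n - 1)) a / fact a"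
      using that by (simp add: p_def poly_prod falling_factorial_def of_nat_diff algebra_simps)
    also have "\<dots> = of_nat ((n - 1) choose a)"
      using binomial_times_falling_factorial[of "n - 1" 0 a, where 'a = complex] by simp
    finally show ?thesis .
  qed
  then show ?thesis by blast
qed

text \<open>Expand m^l by \<open>power_times_binomial\<close> with a = 0 and sum by the hockey-stick
  identity.\<close>

lemma power_sum_poly_exists:
  "\<exists>p :: complex poly. \<forall>n\<ge>1. poly p (of_nat n) = (\<Sum>m\<in>{1..<n}. of_nat m ^ l)"
proof -
  obtain b :: "nat \<Rightarrow> complex poly" where b: "\<And>a n. n \<ge> 1 \<Longrightarrow> poly (b a) (of_nat n) = of_nat ((n - 1) choose a)"
    using binomial_poly_exists by metis
  define c where "c k = (of_int (poly (stirling2_poly l k) (int (Suc 0))) * (fact (0 + k) / fact 0) :: complex)" for k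
  have "poly (\<Sum>k\<le>l. smult (c k) (b (Suc k))) (of_nat n) = (\<Sum>m\<in>{1..<n}. of_nat m ^ l)" if n: "n \<ge> 1" for n
  proof -
    have "(\<Sum>m\<in>{1..<n}. of_nat m ^ l :: complex) = (\<Sum>m\<in>{1..<n}. \<Sum>k\<le>l. c k * of_nat ((m - 1) choose k))"
    proof (rule sum.cong[OF refl])
      fix m assume "m \<in> {1..<n}"
      then show "(of_nat m ^ l :: complex) = (\<Sum>k\<le>l. c k * of_nat ((m - 1) choose k))"
        using power_times_binomial[of m l 0, where 'a = complex] by (simp add: c_def)
    qed
    also have "\<dots> = (\<Sum>k\<le>l. c k * of_nat (\<Sum>m\<in>{1..<n}. (m - 1) choose k))"
      by (subst sum.swap) (simp add: sum_distrib_left)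
    also have "\<dots> = poly (\<Sum>k\<le>l. smult (c k) (b (Suc k))) (of_nat n)"
      unfolding sum_binomial_pred by (simp add: poly_sum b[OF n])
    finally show ?thesis by simp
  qed
  then show ?thesis by blast
qed

section \<open>Evaluation of the iterated limits\<close>

lemma isCont_mzeta_cont_slice:
  assumes "r \<ge> 1" "i \<in> {1..r}" "x(i := v) \<in> mzeta_domain r"
  shows "isCont (\<lambda>w. mzeta_cont r (x(i := w))) v"
  using holomorphic_severalD(4)[OF holomorphic_mzeta_cont[OF assms(1)] assms(3,2)]
  by (simp add: field_differentiable_imp_continuous_at)

text \<open>The arguments left after \<open>j\<close> limits: \<open>drop_first\<close> has been
  applied \<open>j\<close> times, and only the last shift \<open>m\<close> is still visible, because
  each earlier one sat on a coordinate since removed.\<close>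

definition tail_point :: "nat \<Rightarrow> nat \<Rightarrow> nat \<Rightarrow> (nat \<Rightarrow> complex) \<Rightarrow> nat \<Rightarrow> complex" where
  "tail_point r j m s = (\<lambda>i\<in>{1..r - j}. if i = 1 then s (Suc j) - of_nat m else s (j + i))"

lemma sum_tail_point:
  assumes "k \<in> {1..r - j}"
  shows "(\<Sum>i\<in>{k..r - j}. tail_point r j m s i) = (\<Sum>i\<in>{j + k..r}. s i) - (if k = 1 then of_nat m else 0)"
proof -
  have "(\<Sum>i\<in>{k..r - j}. tail_point r j m s i) = (\<Sum>i\<in>{k..r - j}. s (j + i) - (if i = 1 then of_nat m else 0))"
    using assms by (intro sum.cong) (auto simp: tail_point_def)
  also have "\<dots> = (\<Sum>i\<in>{k..r - j}. s (j + i)) - (if k = 1 then of_nat m else 0)"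
    using assms by (auto simp: sum_subtractf)
  also have "(\<Sum>i\<in>{k..r - j}. s (j + i)) = (\<Sum>i\<in>{j + k..r}. s i)"
    using assms by (intro sum.reindex_bij_witness[of _ "\<lambda>i. i - j" "\<lambda>i. j + i"]) auto
  finally show ?thesis .
qed

lemma tail_point_fun_upd:
  "j < r \<Longrightarrow> tail_point r j m (s(Suc j := w)) = (tail_point r j m s)(1 := w - of_nat m)"
  by (auto simp: tail_point_def fun_eq_iff restrict_def)

lemma drop_first_tail_point:
  assumes "Suc j < r" "r - j = Suc q"
  shows "drop_first q m' (tail_point r j m s) = tail_point r (Suc j) m' s"
  using assms by (auto simp: drop_first_def tail_point_def fun_eq_iff restrict_def)

text \<open>The next coordinate tends to \<open>-l\<^bsub>j+1\<^esub>\<close>, where the shifted continuations are still regular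
  because all later tails of coordinates have non-integral sums; there the relation for a
  non-positive integral first argument lowers the depth.\<close>

lemma iterated_Lim_mzeta:
  fixes l :: "nat \<Rightarrow> nat"
  defines "a \<equiv> \<lambda>i. - of_nat (l i)"
  assumes "j < r"
  shows "\<exists>Q. (\<forall>n\<ge>1. poly Q (of_nat n) = truncated_mzeta a j n) \<and>
    (\<forall>s\<in>Cspace r. (\<forall>i\<in>{Suc j..r}. (\<Sum>t\<in>{i..r}. s t) \<notin> \<int>) \<longrightarrow>
       iterated_Lim j a (mzeta r) s = poly_functional (\<lambda>m. mzeta_cont (r - j) (tail_point r j m s)) Q)"
  using assms(2)
proof (induction j)
  case 0
  have "mzeta r s = mzeta_cont r (tail_point r 0 0 s)"
    if s: "s \<in> Cspace r" "\<forall>i\<in>{Suc 0..r}. (\<Sum>t\<in>{i..r}. s t) \<notin> \<int>" for s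
  proof -
    have "tail_point r 0 0 s = s"
      using s(1) by (auto simp: tail_point_def fun_eq_iff PiE_iff extensional_def restrict_def)
    moreover have "s \<in> mzeta_domain r"
      by (rule mzeta_domain_all_sums[OF s(1)]) (use 0 s(2) in auto)
    ultimately show ?thesis using mzeta_eq_cont[of r s] 0 by simp
  qed
  then show ?case by (intro exI[of _ 1]) (auto simp: poly_functional_def)
next
  case (Suc j)
  then obtain Q where Q: "\<And>n. n \<ge> 1 \<Longrightarrow> poly Q (of_nat n) = truncated_mzeta a j n"
    "\<And>s. s \<in> Cspace r \<Longrightarrow> \<forall>i\<in>{Suc j..r}. (\<Sum>t\<in>{i..r}. s t) \<notin> \<int> \<Longrightarrow>
       iterated_Lim j a (mzeta r) s = poly_functional (\<lambda>m. mzeta_cont (r - j) (tail_point r j m s)) Q"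
    by (metis Suc_lessD)
  obtain F :: "nat \<Rightarrow> complex poly" where F: "\<And>l n. n \<ge> 1 \<Longrightarrow> poly (F l) (of_nat n) = (\<Sum>m\<in>{1..<n}. of_nat m ^ l)"
    using power_sum_poly_exists by metis
  obtain q where q: "r - j = Suc q" "q \<ge> 1" "r - Suc j = q" using Suc.prems by (cases "r - j") auto
  let ?l = "l (Suc j)"
  \<comment> \<open>Multiplication by n^l followed by summation, done monomial by monomial: each X^m
    of \<open>Q\<close> turns into the power-sum polynomial of exponent l + m.\<close>
  define R where "R = (\<Sum>m\<le>degree Q. smult (coeff Q m) (F (?l + m)))"
  have "poly R (of_nat n) = truncated_mzeta a (Suc j) n" if n: "n \<ge> 1" for n
  proof -
    have "truncated_mzeta a (Suc j) n = (\<Sum>k\<in>{1..<n}. of_nat k ^ ?l * poly Q (of_nat k))"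
      unfolding truncated_mzeta.simps by (rule sum.cong) (auto simp: Q(1) a_def powr_nat)
    also have "\<dots> = (\<Sum>k\<in>{1..<n}. \<Sum>m\<le>degree Q. coeff Q m * of_nat k ^ (?l + m))"
      by (simp add: poly_altdef sum_distrib_left power_add mult_ac)
    also have "\<dots> = poly R (of_nat n)"
      by (subst sum.swap) (simp add: R_def poly_sum F[OF n] sum_distrib_left)
    finally show ?thesis by simp
  qed
  moreover have "iterated_Lim (Suc j) a (mzeta r) s = poly_functional (\<lambda>m. mzeta_cont (r - Suc j) (tail_point r (Suc j) m s)) R"
    if s: "s \<in> Cspace r" and gen: "\<forall>i\<in>{Suc (Suc j)..r}. (\<Sum>t\<in>{i..r}. s t) \<notin> \<int>" for s
  proof -
    let ?u = "\<lambda>w. s(Suc j := w)"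
    define \<sigma> where "\<sigma> = (\<Sum>t\<in>{Suc (Suc j)..r}. s t)"
    define w0 where "w0 = a (Suc j)"
    \<comment> \<open>Since the tail \<open>\<sigma>\<close> beyond the moving coordinate is
      non-integral, \<open>W\<close> is a full neighbourhood of the integer \<open>w0\<close>. The
      formula for \<open>j\<close> limits therefore holds around \<open>w0\<close> and is continuous
      there.\<close>
    define W where "W = (\<lambda>w. w + \<sigma>) -` (- \<int>)"
    have "open W" unfolding W_def by (intro open_vimage open_Compl closed_Ints continuous_intros)
    have "\<sigma> \<notin> \<int>" unfolding \<sigma>_def using gen Suc.prems by auto
    have "w0 \<in> W"
    proof -
      have "w0 + \<sigma> \<notin> \<int>"
      proof
        assume "w0 + \<sigma> \<in> \<int>"
        then have "(w0 + \<sigma>) - w0 \<in> \<int>" by (rule Ints_diff) (simp add: w0_def a_def)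
        then show False using \<open>\<sigma> \<notin> \<int>\<close> by simp
      qed
      then show ?thesis by (simp add: W_def)
    qed
    have uC: "?u w \<in> Cspace r" for w using s Suc.prems by (intro fun_upd_in_Cspace) auto
    have sum_u: "(\<Sum>t\<in>{i..r}. ?u w t) = (\<Sum>t\<in>{i..r}. s t)" if "i \<ge> Suc (Suc j)" for i w
      using that by (intro sum.cong) auto
    have u_gen: "(\<Sum>t\<in>{i..r}. ?u w t) \<notin> \<int>" if "w \<in> W" "i \<in> {Suc j..r}" for w i
    proof (cases "i = Suc j")
      case True
      have "(\<Sum>t\<in>{Suc j..r}. ?u w t) = w + \<sigma>"
        using Suc.prems sum_u[of "Suc (Suc j)" w] unfolding \<sigma>_def by (subst sum.atLeast_Suc_atMost) auto
      then show ?thesis using True that by (simp add: W_def)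
    next
      case False
      then show ?thesis using that gen sum_u[of i w] by auto
    qed
    define g where "g w = poly_functional (\<lambda>m. mzeta_cont (r - j) (tail_point r j m (?u w))) Q" for w
    have dom: "tail_point r j m (?u w) \<in> mzeta_domain (r - j)" if "w \<in> W" for w m
    proof (rule mzeta_domain_all_sums)
      fix k assume k: "k \<in> {1..r - j}"
      have "(\<Sum>i\<in>{k..r - j}. tail_point r j m (?u w) i) = (\<Sum>i\<in>{j + k..r}. ?u w i) - (if k = 1 then of_nat m else 0)"
        by (rule sum_tail_point[OF k])
      moreover have "(\<Sum>i\<in>{j + k..r}. ?u w i) - (if k = 1 then of_nat m else 0) \<notin> \<int>" (is "?x - ?y \<notin> \<int>")
      proof
        assume "?x - ?y \<in> \<int>"
        then have "(?x - ?y) + ?y \<in> \<int>" by (rule Ints_add) auto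
        moreover have "?x \<notin> \<int>" by (rule u_gen[OF that]) (use k in auto)
        ultimately show False by simp
      qed
      ultimately show "(\<Sum>i\<in>{k..r - j}. tail_point r j m (?u w) i) \<notin> \<int>" by simp
    qed (use Suc.prems in \<open>auto simp: tail_point_def\<close>)
    have "isCont g w0"
      unfolding g_def poly_functional_def
    proof (intro continuous_intros)
      fix m
      have "isCont (\<lambda>w. mzeta_cont (r - j) ((tail_point r j m s)(1 := w))) (w0 - of_nat m)"
        by (rule isCont_mzeta_cont_slice)
           (use Suc.prems dom[OF \<open>w0 \<in> W\<close>, of m] in \<open>auto simp: tail_point_fun_upd\<close>)
      then have "isCont (\<lambda>w. mzeta_cont (r - j) ((tail_point r j m s)(1 := w - of_nat m))) w0"
        by (intro isCont_o2[where g = "\<lambda>w. mzeta_cont (r - j) ((tail_point r j m s)(1 := w))" and f = "\<lambda>w. w - of_nat m"] continuous_intros)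
      then show "isCont (\<lambda>w. mzeta_cont (r - j) (tail_point r j m (?u w))) w0"
        using Suc.prems by (simp add: tail_point_fun_upd)
    qed
    then have "(g \<longlongrightarrow> g w0) (at w0)" by (simp add: isCont_def)
    moreover have "\<forall>\<^sub>F w in at w0. g w = iterated_Lim j a (mzeta r) (?u w)"
    proof -
      have "\<forall>\<^sub>F w in at w0. w \<in> W" using \<open>open W\<close> \<open>w0 \<in> W\<close> by (rule eventually_at_in_open')
      then show ?thesis
      proof eventually_elim
        case (elim w)
        then show ?case unfolding g_def by (intro Q(2)[symmetric] uC ballI u_gen)
      qed
    qed
    ultimately have "((\<lambda>w. iterated_Lim j a (mzeta r) (?u w)) \<longlongrightarrow> g w0) (at w0)"
      by (rule Lim_transform_eventually)
    then have "iterated_Lim (Suc j) a (mzeta r) s = g w0"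
      unfolding iterated_Lim.simps w0_def by (intro tendsto_Lim) auto
    \<comment> \<open>At \<open>w0\<close> the first argument of every shifted point is -(l + m), a
      non-positive integer, so \<open>mzeta_cont_drop_first\<close> lowers the depth.\<close>
    also have "g w0 = (\<Sum>m\<le>degree Q. coeff Q m * poly_functional (\<lambda>m'. mzeta_cont q (tail_point r (Suc j) m' s)) (F (?l + m)))"
      unfolding g_def poly_functional_def[of _ Q]
    proof (intro sum.cong refl arg_cong2[of _ _ _ _ "(*)"])
      fix m
      let ?x = "tail_point r j m (?u w0)"
      have "mzeta_cont (Suc q) ?x = (\<Sum>m'\<le>degree (F (?l + m)). coeff (F (?l + m)) m' * mzeta_cont q (drop_first q m' ?x))"
      proof (rule mzeta_cont_drop_first[OF F q(2)])
        show "?x \<in> Cspace (Suc q)" using q by (simp add: tail_point_def)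
        show "?x 1 = - of_nat (?l + m)" using q by (simp add: tail_point_def w0_def a_def)
        fix k assume k: "k \<in> {2..Suc q}"
        have "(\<Sum>i\<in>{k..r - j}. ?x i) = (\<Sum>i\<in>{j + k..r}. ?u w0 i)"
          using k q by (subst sum_tail_point) auto
        moreover have "(\<Sum>i\<in>{j + k..r}. ?u w0 i) \<notin> \<int>"
          by (rule u_gen[OF \<open>w0 \<in> W\<close>]) (use k q in auto)
        ultimately show "(\<Sum>i\<in>{k..Suc q}. ?x i) \<notin> \<int>" unfolding q(1) by simp
      qed
      moreover have "drop_first q m' ?x = tail_point r (Suc j) m' s" for m'
      proof -
        have "drop_first q m' ?x = tail_point r (Suc j) m' (?u w0)"
          by (rule drop_first_tail_point) (use Suc.prems q in auto)
        then show ?thesis by (auto simp: tail_point_def fun_eq_iff restrict_def)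
      qed
      ultimately show "mzeta_cont (r - j) ?x = poly_functional (\<lambda>m'. mzeta_cont q (tail_point r (Suc j) m' s)) (F (?l + m))"
        unfolding q(1) by (simp only: poly_functional_def)
    qed
    also have "\<dots> = poly_functional (\<lambda>m. mzeta_cont (r - Suc j) (tail_point r (Suc j) m s)) R"
      unfolding R_def poly_functional_sum q(3) ..
    finally show ?thesis .
  qed
  ultimately show ?case by blast
qed

section \<open>The last limit and the final expansion\<close>

definition zeta_functional :: "complex poly \<Rightarrow> complex" where
  "zeta_functional = poly_functional (\<lambda>m. mzeta_cont 1 (\<lambda>i\<in>{1}. - of_nat m))"

text \<open>In the last limit the only tail is \<open>w\<close> itself, tending to an integer, so
  the formula for the inner limits holds only on a punctured neighbourhood. The limit still exists,
  as depth one has its only excluded point at 1 and \<open>w0 - m\<close> is never positive.\<close>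

lemma zeta_rev_eq_functional:
  fixes l :: "nat \<Rightarrow> nat"
  assumes R: "\<And>n. n \<ge> 1 \<Longrightarrow> poly R (of_nat n) = of_nat n ^ l (Suc q) * truncated_mzeta (\<lambda>i. - of_nat (l i)) q n"
  shows "zeta_rev (Suc q) l = zeta_functional R"
proof -
  define a :: "nat \<Rightarrow> complex" where "a = (\<lambda>i. - of_nat (l i))"
  obtain Q where Q: "\<And>n. n \<ge> 1 \<Longrightarrow> poly Q (of_nat n) = truncated_mzeta a q n"
    "\<And>s. s \<in> Cspace (Suc q) \<Longrightarrow> \<forall>i\<in>{Suc q..Suc q}. (\<Sum>t\<in>{i..Suc q}. s t) \<notin> \<int> \<Longrightarrow>
       iterated_Lim q a (mzeta (Suc q)) s = poly_functional (\<lambda>m. mzeta_cont (Suc q - q) (tail_point (Suc q) q m s)) Q"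
    using iterated_Lim_mzeta[of q "Suc q" l] unfolding a_def by blast
  define w0 where "w0 = a (Suc q)"
  let ?p = "\<lambda>m w. (\<lambda>i\<in>{1}. w - of_nat m) :: nat \<Rightarrow> complex"
  define g where "g w = poly_functional (\<lambda>m. mzeta_cont 1 (?p m w)) Q" for w
  define u :: "nat \<Rightarrow> complex" where "u = (\<lambda>_. undefined)"
  have "isCont g w0"
    unfolding g_def poly_functional_def
  proof (intro continuous_intros)
    fix m
    have upd: "?p m w = (?p m w0)(1 := w - of_nat m)" for w by (auto simp: fun_eq_iff)
    have "?p m w0 \<in> mzeta_domain 1"
    proof -
      have "w0 - of_nat m \<noteq> 1"
      proof
        assume "w0 - of_nat m = 1"
        then have "Re (w0 - of_nat m) = 1" by simp
        then show False by (simp add: w0_def a_def)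
      qed
      then show ?thesis by (simp add: mzeta_domain_def mzeta_phi_domain_def)
    qed
    then have "isCont (\<lambda>w. mzeta_cont 1 ((?p m w0)(1 := w))) (w0 - of_nat m)"
      using upd[of w0] by (intro isCont_mzeta_cont_slice) (auto simp del: One_nat_def)
    then have "isCont (\<lambda>w. mzeta_cont 1 ((?p m w0)(1 := w - of_nat m))) w0"
      by (intro isCont_o2[where g = "\<lambda>w. mzeta_cont 1 ((?p m w0)(1 := w))" and f = "\<lambda>w. w - of_nat m"] continuous_intros)
    then show "isCont (\<lambda>w. mzeta_cont 1 (?p m w)) w0" by (subst upd)
  qed
  then have "(g \<longlongrightarrow> g w0) (at w0)" by (simp add: isCont_def)
  moreover have "\<forall>\<^sub>F w in at w0. g w = iterated_Lim q a (mzeta (Suc q)) (u(Suc q := w))"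
  proof -
    \<comment> \<open>The integers other than \<open>w0\<close> form a closed set; avoiding them and
      \<open>w0\<close> makes \<open>w\<close> non-integral.\<close>
    have "open (- (\<int> - {w0}))" by (intro open_Compl closed_subset_Ints) auto
    then have "\<forall>\<^sub>F w in at w0. w \<in> - (\<int> - {w0}) - {w0}" by (intro eventually_at_in_open) auto
    then show ?thesis
    proof eventually_elim
      case (elim w)
      then have w: "w \<notin> \<int>" by auto
      define s where "s = u(Suc q := w)"
      have "s \<in> Cspace (Suc q)" by (auto simp: s_def u_def PiE_iff extensional_def)
      then have "iterated_Lim q a (mzeta (Suc q)) s = poly_functional (\<lambda>m. mzeta_cont (Suc q - q) (tail_point (Suc q) q m s)) Q"
        by (rule Q(2)) (use w in \<open>simp add: s_def\<close>)
      moreover have "tail_point (Suc q) q m s = ?p m w" for m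
        by (auto simp: tail_point_def s_def fun_eq_iff restrict_def)
      ultimately show ?case by (simp add: g_def s_def)
    qed
  qed
  ultimately have "((\<lambda>w. iterated_Lim q a (mzeta (Suc q)) (u(Suc q := w))) \<longlongrightarrow> g w0) (at w0)"
    by (rule Lim_transform_eventually)
  then have "zeta_rev (Suc q) l = g w0"
    unfolding zeta_rev_def iterated_Lim.simps w0_def a_def u_def by (intro tendsto_Lim) auto
  also have "g w0 = zeta_functional (monom 1 (l (Suc q)) * Q)"
    unfolding g_def zeta_functional_def poly_functional_monom_mult w0_def a_def by simp
  \<comment> \<open>Both polynomials agree at all positive integers, so any polynomial
    \<open>R\<close> with the prescribed values may be used.\<close>
  also have "monom 1 (l (Suc q)) * Q = R"
    by (rule poly_eqI_of_nat) (simp add: poly_monom R Q(1) a_def)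
  finally show ?thesis .
qed

theorem theorem3p3:
  fixes r :: nat and l :: "nat \<Rightarrow> nat"
  assumes "r \<ge> 1"
  shows "zeta_rev r l =
    (\<Sum>k\<in>(\<Pi>\<^sub>E i\<in>{1..r}. {0..l i}).
       (\<Prod>j=1..r. of_int (poly (stirling2_poly (l j) (k j)) (int (psum k (j - 1) + j)))
                  * (fact (psum k j + j - 1) / fact (psum k (j - 1) + j - 1)))
       * zeta_rev (r + psum k r) (\<lambda>_. 0))"
proof -
  obtain q where q: "r = Suc q" using assms by (cases r) auto
  obtain b :: "nat \<Rightarrow> complex poly" where b: "\<And>a n. n \<ge> 1 \<Longrightarrow> poly (b a) (of_nat n) = of_nat ((n - 1) choose a)"
    using binomial_poly_exists by metis
  \<comment> \<open>Depth m + 1 corresponds to lower index \<open>m\<close>, because the outermost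
    variable is not summed. Hence the lower index q + K_r gives depth r + K_r.\<close>
  have zeros: "zeta_rev (Suc m) (\<lambda>_. 0) = zeta_functional (b m)" for m
    by (rule zeta_rev_eq_functional) (simp add: b truncated_mzeta_zeros)
  let ?K = "\<Pi>\<^sub>E i\<in>{1..Suc q}. {0..l i}"
  define R where "R = (\<Sum>k\<in>?K. smult (stirling_weight (Suc q) l k) (b (q + psum k (Suc q))))"
  have "zeta_rev (Suc q) l = zeta_functional R"
  proof (rule zeta_rev_eq_functional)
    fix n :: nat assume n: "n \<ge> 1"
    show "poly R (of_nat n) = of_nat n ^ l (Suc q) * truncated_mzeta (\<lambda>i. - of_nat (l i)) q n"
      unfolding power_times_stirling_sum[OF n truncated_mzeta_nonpos_Ints[OF n]]
      by (simp add: R_def poly_sum b[OF n])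
  qed
  also have "\<dots> = (\<Sum>k\<in>?K. stirling_weight (Suc q) l k * zeta_rev (Suc (q + psum k (Suc q))) (\<lambda>_. 0))"
    unfolding zeros R_def zeta_functional_def poly_functional_sum ..
  finally show ?thesis by (simp only: q stirling_weight_def add_Suc)
qed

end
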